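(* Let $0<|q|<1$, fix a square root $q^{1/2}$ and set $q^{3/2}=(q^{1/2})^3$, $q^{5/2}=(q^{1/2})^5$. Then $$\sum_{i,j,k=0}^{\infty}\frac{(-1)^{j+k}q^{2\binom{i+j+3k}{2}+6\binom k2+2i+\frac 32j+9k}}{(q;q)_i(-q;-q)_{j}(q^6;q^6)_k}=\frac{1}{(-q^{3/2},q^{5/2};-q^3)_\infty(q^4;q^6)_\infty(q^2;q^{12})_\infty}.$$
   Context: Notation: $(a;p)_n=\prod_{m=0}^{n-1}(1-ap^m)$ for any base $p$ ($n=\infty$ allowed), and $(a_1,\dots,a_m;p)_n=(a_1;p)_n\cdots(a_m;p)_n$; $q^{\frac32 j}=(q^{3/2})^j$. *)

theory Defs
  imports "HOL-Analysis.Analysis"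
begin

definition qpoch :: "complex \<Rightarrow> complex \<Rightarrow> nat \<Rightarrow> complex" where
  "qpoch a p n = (\<Prod>m<n. 1 - a * p ^ m)"

definition qpoch_inf :: "complex \<Rightarrow> complex \<Rightarrow> complex" where
  "qpoch_inf a p = (\<Prod>m. 1 - a * p ^ m)"

text \<open>
  For bases inside the unit disc the infinite product converges, so the value of
  \<^const>\<open>qpoch_inf\<close> is the limit of the finite products.
\<close>

lemma convergent_prod_qpoch:
  fixes a p :: complex
  assumes "norm p < 1"
  shows "convergent_prod (\<lambda>m. 1 - a * p ^ m)"
proof -
  have "summable (\<lambda>m. norm a * norm p ^ m)"
    using assms by (intro summable_mult summable_geometric) simp
  hence "abs_convergent_prod (\<lambda>m. 1 - a * p ^ m)"
    by (simp add: abs_convergent_prod_conv_summable norm_mult norm_power)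
  thus ?thesis
    by (rule abs_convergent_prod_imp_convergent_prod)
qed

lemma qpoch_tendsto_qpoch_inf:
  assumes "norm p < 1"
  shows "(\<lambda>n. qpoch a p n) \<longlonglongrightarrow> qpoch_inf a p"
proof -
  have "(\<lambda>n. qpoch a p (Suc n)) \<longlonglongrightarrow> qpoch_inf a p"
    using convergent_prod_LIMSEQ[OF convergent_prod_qpoch[OF assms]]
    by (simp only: qpoch_def qpoch_inf_def lessThan_Suc_atMost)
  thus ?thesis
    by (rule LIMSEQ_imp_Suc)
qed

end

theory Submission
  imports Defs
begin

text \<open>
  Let $\omega$ be a primitive cube root of unity. Grouping the triple sum by $N = i + j + 3k$ turns
  it into $\sum_N q^{N(N+1)} a_N$, where $a_N$ is a coefficient of a product of three power series.
  That product satisfies a first order $q^2$-difference equation whose cubic factor splits over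
  $\omega$, and this rewrites the triple sum as
  $(-q^2, \omega^2 q; q^2)_\infty \sum_n (\omega s; -q)_{2n} (\omega^2 q)^n / (q^4; q^4)_n$.
  A quadratic transformation and a cubic summation evaluate the single sum as a combination $B(\omega)$
  of two infinite products. The triple sum does not depend on the choice of $\omega$, so
  $B(\omega)^2 = B(\omega) B(\omega^2)$; expanding the right-hand side and applying
  the dissection $j(y;q) = j(-qy^2;q^4) - y\,j(-q^3y^2;q^4)$ of the Jacobi theta function three times
  turns it into the square of the expected product. Continuity in $s$ fixes the sign.
\<close>

section \<open>Infinite products and the q-binomial theorem\<close>

text \<open>With N = i + j + 3k the exponent 2 (N choose 2) + 2i is N (N + 1) - 2j - 6k. This leaves
  the weights 1, (-1/s)^j and (-1)^k q^(6 (k choose 2) + 3k), so the three series in a variable Z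
  are 1/(Z; q)_inf, 1/(-Z/s; -q)_inf and (q^3 Z^3; q^6)_inf. Under Z -> q^2 Z the last contributes 1
  - q^3 Z^3. Its factor 1 - qZ cancels against the first series, and the two factors with
  \<open>w\<close> and \<open>w ^ 2\<close> remain. One goes into a q-binomial series, the other
  into an Euler product; this breaks the symmetry between \<open>w\<close> and \<open>w ^ 2\<close>,
  which is why equating the two choices gives information. Since |1/s| > 1, the product has a pole
  inside the unit disc. It is therefore factored as a formal power series, and convergence enters
  only with the weights q^(N (N + 1)). A second obstacle is that the cubic summation is needed at a
  parameter 1/q outside the unit disc, where its natural derivation diverges. Squaring helps because
  in the product of the two conjugate values the cube roots of unity combine in threes, so that
  \<open>w\<close> disappears.\<close>

lemma qpoch_0 [simp]: "qpoch a p 0 = 1"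
  by (simp add: qpoch_def)

lemma qpoch_Suc: "qpoch a p (Suc n) = qpoch a p n * (1 - a * p ^ n)"
  by (simp add: qpoch_def)

lemma qpoch_Suc': "qpoch a p (Suc n) = (1 - a) * qpoch (a * p) p n"
  unfolding qpoch_def prod.lessThan_Suc_shift by (simp add: mult.assoc)

lemma qpoch_zero [simp]: "qpoch 0 p n = 1"
  by (simp add: qpoch_def)

lemma qpoch_inf_zero [simp]: "qpoch_inf 0 p = 1"
  by (simp add: qpoch_inf_def)

lemma qpoch_inf_eqI:
  assumes "norm p < 1" "(\<lambda>n. qpoch a p n) \<longlonglongrightarrow> l"
  shows "qpoch_inf a p = l"
  using qpoch_tendsto_qpoch_inf[OF assms(1)] assms(2) by (rule LIMSEQ_unique)

lemma qpoch_add: "qpoch a p (m + n) = qpoch a p m * qpoch (a * p ^ m) p n"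
  by (induction n) (simp_all add: qpoch_Suc power_add mult.assoc)

lemma qpoch_inf_split:
  assumes "norm p < 1"
  shows "qpoch_inf a p = qpoch a p n * qpoch_inf (a * p ^ n) p"
proof (rule qpoch_inf_eqI[OF assms])
  have "(\<lambda>k. qpoch a p n * qpoch (a * p ^ n) p k) \<longlonglongrightarrow> qpoch a p n * qpoch_inf (a * p ^ n) p"
    by (intro tendsto_intros qpoch_tendsto_qpoch_inf assms)
  hence "(\<lambda>k. qpoch a p (k + n)) \<longlonglongrightarrow> qpoch a p n * qpoch_inf (a * p ^ n) p"
    by (simp only: qpoch_add add.commute[of _ n])
  thus "(\<lambda>k. qpoch a p k) \<longlonglongrightarrow> qpoch a p n * qpoch_inf (a * p ^ n) p"
    by (rule LIMSEQ_offset)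
qed

lemma qpoch_inf_Suc:
  assumes "norm p < 1"
  shows "qpoch_inf a p = (1 - a) * qpoch_inf (a * p) p"
  using qpoch_inf_split[OF assms, of a 1] by (simp add: qpoch_def)

lemma qpoch_inf_nonzero:
  assumes "norm p < 1" "\<And>n. a * p ^ n \<noteq> 1"
  shows "qpoch_inf a p \<noteq> 0"
  unfolding qpoch_inf_def
  using assms by (intro prodinf_nonzero convergent_prod_qpoch) auto

lemma norm_mult_power_less_1:
  fixes a p :: complex
  assumes "norm p \<le> 1" "norm a < 1"
  shows "norm (a * p ^ n) < 1"
  using assms mult_left_le[of "norm p ^ n" "norm a"]
  by (simp add: norm_mult norm_power power_le_one)

lemma qpoch_inf_nonzero':
  assumes "norm p < 1" "norm a < 1"
  shows "qpoch_inf a p \<noteq> 0"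
proof (rule qpoch_inf_nonzero[OF assms(1)])
  fix n show "a * p ^ n \<noteq> 1"
    using norm_mult_power_less_1[of p a n] assms by auto
qed

lemma qpoch_nonzero:
  assumes "\<And>n. a * p ^ n \<noteq> 1"
  shows "qpoch a p n \<noteq> 0"
  using assms by (auto simp: qpoch_def)

lemma qpoch_nonzero':
  assumes "norm p < 1" "norm a < 1"
  shows "qpoch a p n \<noteq> 0"
proof (rule qpoch_nonzero)
  fix n show "a * p ^ n \<noteq> 1"
    using norm_mult_power_less_1[of p a n] assms by auto
qed

lemma qpoch_conv_inf:
  assumes "norm p < 1" "\<And>n. a * p ^ n \<noteq> 1"
  shows "qpoch a p n = qpoch_inf a p / qpoch_inf (a * p ^ n) p"
proof -
  have "qpoch_inf (a * p ^ n) p \<noteq> 0"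
    by (rule qpoch_inf_nonzero) (use assms in \<open>auto simp: mult.assoc simp flip: power_add\<close>)
  thus ?thesis
    using qpoch_inf_split[OF assms(1), of a n] by simp
qed

lemma qpoch_conv_inf':
  assumes "norm p < 1" "norm a < 1"
  shows "qpoch a p n = qpoch_inf a p / qpoch_inf (a * p ^ n) p"
proof (rule qpoch_conv_inf[OF assms(1)])
  fix n show "a * p ^ n \<noteq> 1"
    using norm_mult_power_less_1[of p a n] assms by auto
qed

lemma Bseq_qpoch: "norm p < 1 \<Longrightarrow> Bseq (qpoch a p)"
  using convergent_imp_Bseq convergentI qpoch_tendsto_qpoch_inf by blast

lemma Bseq_inverse_qpoch:
  assumes "norm p < 1" "\<And>n. a * p ^ n \<noteq> 1"
  shows "Bseq (\<lambda>n. inverse (qpoch a p n))"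
  using tendsto_inverse[OF qpoch_tendsto_qpoch_inf[OF assms(1)] qpoch_inf_nonzero[OF assms]]
        convergent_imp_Bseq convergentI by blast

lemma Bseq_inverse_qpoch':
  assumes "norm p < 1" "norm a < 1"
  shows "Bseq (\<lambda>n. inverse (qpoch a p n))"
proof (rule Bseq_inverse_qpoch[OF assms(1)])
  fix n show "a * p ^ n \<noteq> 1"
    using norm_mult_power_less_1[of p a n] assms by auto
qed

lemma summable_Bseq_geometric:
  fixes f :: "nat \<Rightarrow> complex"
  assumes "Bseq f" "norm z < 1"
  shows "summable (\<lambda>n. norm (f n * z ^ n))"
proof -
  obtain K where K: "\<And>n. norm (f n) \<le> K"
    using assms(1) by (auto simp: Bseq_def)
  have "summable (\<lambda>n. K * norm z ^ n)"
    using assms(2) by (intro summable_mult summable_geometric) auto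
  thus ?thesis
    by (rule summable_comparison_test')
       (auto simp: norm_mult norm_power intro!: mult_right_mono K)
qed

lemma Bseq_qpoch_quotient:
  assumes "norm p < 1" "norm b < 1"
  shows "Bseq (\<lambda>n. qpoch a p n / qpoch b p n)"
  using Bseq_mult[OF Bseq_qpoch[OF assms(1), of a] Bseq_inverse_qpoch'[OF assms]]
  by (simp add: divide_inverse)

lemma summable_qbinomial:
  assumes "norm p < 1" "norm z < 1"
  shows "summable (\<lambda>n. norm (qpoch a p n / qpoch p p n * z ^ n))"
  using summable_Bseq_geometric[OF Bseq_qpoch_quotient[OF assms(1) assms(1)] assms(2)] .

lemma power_times_LIMSEQ_0:
  fixes p z :: complex
  assumes "norm p < 1"
  shows "(\<lambda>n. p ^ n * z) \<longlonglongrightarrow> 0"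
  using tendsto_mult_right[OF LIMSEQ_power_zero[OF assms], of z] by simp

lemma powser_at_0_LIMSEQ:
  fixes c :: "nat \<Rightarrow> complex"
  assumes "summable (\<lambda>n. c n * z ^ n)" "z \<noteq> 0" "norm p < 1"
  shows "(\<lambda>k. \<Sum>n. c n * (p ^ k * z) ^ n) \<longlonglongrightarrow> c 0"
proof -
  have "isCont (\<lambda>x. \<Sum>n. c n * x ^ n) 0"
    using assms by (intro isCont_powser[of c z]) auto
  hence "(\<lambda>k. \<Sum>n. c n * (p ^ k * z) ^ n) \<longlonglongrightarrow> (\<Sum>n. c n * 0 ^ n)"
    by (rule isCont_tendsto_compose) (rule power_times_LIMSEQ_0[OF assms(3)])
  thus ?thesis by simp
qed

text \<open>The ratio of consecutive coefficients gives
  \<open>(1 - x) * f x = (1 - a * x) * f (p * x)\<close> for the sum \<open>f\<close>. Iteration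
  pushes the argument to \<open>p ^ k * z\<close>, and continuity of a power series at 0 gives the
  limit. The case \<open>z = 0\<close> is separate because that continuity is drawn from convergence
  at a nonzero point.\<close>

theorem qbinomial_theorem:
  assumes p: "norm p < 1" and z: "norm z < 1"
  shows "(\<lambda>n. qpoch a p n / qpoch p p n * z ^ n) sums (qpoch_inf (a * z) p / qpoch_inf z p)"
proof (cases "z = 0")
  case True
  thus ?thesis using sums_If_finite[of "\<lambda>n. n = 0" "\<lambda>n. 1::complex"]
    by (simp add: power_0_left if_distrib cong: if_cong)
next
  case z0: False
  define c where "c = (\<lambda>n. qpoch a p n / qpoch p p n)"
  define f where "f = (\<lambda>z. \<Sum>n. c n * z ^ n)"
  have summ: "summable (\<lambda>n. c n * x ^ n)" if "norm x < 1" for x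
    using summable_norm_cancel[OF summable_qbinomial[OF p that]] by (simp add: c_def)
  have step: "(1 - x) * f x = (1 - a * x) * f (p * x)" if x: "norm x < 1" for x
  proof -
    have px: "norm (p * x) < 1"
      using p x by (metis mult.commute norm_mult_power_less_1 order_less_imp_le power_one_right)
    have rec: "c (Suc n) * (1 - p ^ Suc n) = c n * (1 - a * p ^ n)" for n
      using qpoch_nonzero'[OF p p, of "Suc n"] by (auto simp: c_def qpoch_Suc field_simps)
    have S: "(\<lambda>n. c n * x ^ n) sums f x" "(\<lambda>n. c n * (p * x) ^ n) sums f (p * x)"
      using summ[OF x] summ[OF px] by (simp_all add: f_def summable_sums)
    have "(\<lambda>n. c n * x ^ n - c n * (p * x) ^ n) sums (f x - f (p * x))"
      by (intro sums_diff S)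
    moreover have "c 0 * x ^ 0 - c 0 * (p * x) ^ 0 = 0" by simp
    ultimately have "(\<lambda>n. c (Suc n) * x ^ Suc n - c (Suc n) * (p * x) ^ Suc n) sums (f x - f (p * x))"
      by (subst sums_Suc_iff) simp
    also have "(\<lambda>n. c (Suc n) * x ^ Suc n - c (Suc n) * (p * x) ^ Suc n) =
               (\<lambda>n. x * (c n * x ^ n) - a * x * (c n * (p * x) ^ n))"
    proof
      fix n
      have "c (Suc n) * x ^ Suc n - c (Suc n) * (p * x) ^ Suc n = (c (Suc n) * (1 - p ^ Suc n)) * x ^ Suc n"
        by (simp add: power_mult_distrib algebra_simps)
      thus "c (Suc n) * x ^ Suc n - c (Suc n) * (p * x) ^ Suc n = x * (c n * x ^ n) - a * x * (c n * (p * x) ^ n)"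
        by (simp only: rec) (simp add: power_mult_distrib algebra_simps)
    qed
    finally have "(\<lambda>n. x * (c n * x ^ n) - a * x * (c n * (p * x) ^ n)) sums (f x - f (p * x))" .
    moreover have "(\<lambda>n. x * (c n * x ^ n) - a * x * (c n * (p * x) ^ n)) sums (x * f x - a * x * f (p * x))"
      by (intro sums_diff sums_mult S)
    ultimately have "f x - f (p * x) = x * f x - a * x * f (p * x)"
      by (rule sums_unique2)
    thus ?thesis by (simp add: algebra_simps)
  qed
  have pz: "norm (p ^ k * z) < 1" for k
    using norm_mult_power_less_1[of p z k] p z by (simp add: mult.commute)
  have iter: "qpoch z p k * f z = qpoch (a * z) p k * f (p ^ k * z)" for k
  proof (induction k)
    case (Suc k)
    have "qpoch z p (Suc k) * f z = (1 - p ^ k * z) * (qpoch z p k * f z)"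
      by (simp add: qpoch_Suc mult_ac)
    also have "\<dots> = (1 - p ^ k * z) * (qpoch (a * z) p k * f (p ^ k * z))"
      by (simp only: Suc.IH)
    also have "\<dots> = qpoch (a * z) p k * ((1 - p ^ k * z) * f (p ^ k * z))"
      by (simp add: mult_ac)
    also have "\<dots> = qpoch (a * z) p (Suc k) * f (p ^ Suc k * z)"
      by (subst step[OF pz]) (simp add: qpoch_Suc mult_ac)
    finally show ?case .
  qed simp
  have "(\<lambda>k. f (p ^ k * z)) \<longlonglongrightarrow> c 0"
    unfolding f_def using summ[OF z] z0 p by (rule powser_at_0_LIMSEQ)
  hence "(\<lambda>k. qpoch (a * z) p k * f (p ^ k * z)) \<longlonglongrightarrow> qpoch_inf (a * z) p * c 0"
    by (intro tendsto_intros qpoch_tendsto_qpoch_inf p)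
  moreover have "(\<lambda>k. qpoch z p k * f z) \<longlonglongrightarrow> qpoch_inf z p * f z"
    by (intro tendsto_intros qpoch_tendsto_qpoch_inf p)
  ultimately have "qpoch_inf z p * f z = qpoch_inf (a * z) p"
    unfolding iter by (simp add: c_def LIMSEQ_unique)
  hence "f z = qpoch_inf (a * z) p / qpoch_inf z p"
    using qpoch_inf_nonzero'[OF p z] by (simp add: field_simps)
  thus ?thesis
    using summable_sums[OF summ[OF z]] by (simp add: f_def c_def)
qed

lemma power_choose_2_Suc: "p ^ (Suc n choose 2) = p ^ (n choose 2) * (p::complex) ^ n"
  by (simp add: numeral_2_eq_2 power_add mult.commute)

lemma summable_euler:
  assumes p: "norm p < 1"
  shows "summable (\<lambda>n. norm (p ^ (n choose 2) / qpoch p p n * z ^ n))"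
proof -
  have "summable (\<lambda>n. norm (p ^ (n choose 2) * z ^ n))"
  proof (cases "z = 0")
    case False
    have "(\<lambda>n. norm p ^ n * norm z) \<longlonglongrightarrow> 0"
      using tendsto_mult_right[OF LIMSEQ_power_zero[of "norm p"], of "norm z"] p by simp
    hence ev: "eventually (\<lambda>n. norm p ^ n * norm z < 1 / 2) sequentially"
      by (rule order_tendstoD) auto
    then obtain N where N: "\<And>n. n \<ge> N \<Longrightarrow> norm p ^ n * norm z < 1 / 2"
      by (auto simp: eventually_at_top_linorder)
    show ?thesis
    proof (rule summable_ratio_test[of "1/2" N])
      fix n assume "n \<ge> N"
      have "norm (p ^ (Suc n choose 2) * z ^ Suc n) = (norm p ^ n * norm z) * norm (p ^ (n choose 2) * z ^ n)"
        by (simp add: power_choose_2_Suc norm_mult norm_power)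
      also have "\<dots> \<le> 1 / 2 * norm (p ^ (n choose 2) * z ^ n)"
        using N[OF \<open>n \<ge> N\<close>] by (intro mult_right_mono) auto
      finally show "norm (norm (p ^ (Suc n choose 2) * z ^ Suc n)) \<le> 1 / 2 * norm (norm (p ^ (n choose 2) * z ^ n))"
        by simp
    qed simp
  qed (auto intro!: summable_comparison_test'[OF summable_zero, of 1] simp: power_0_left)
  moreover obtain K where K: "\<And>n. norm (inverse (qpoch p p n)) \<le> K"
    using Bseq_inverse_qpoch'[OF p p] by (auto simp: Bseq_def)
  ultimately have "summable (\<lambda>n. K * norm (p ^ (n choose 2) * z ^ n))"
    by (intro summable_mult)
  thus ?thesis
  proof (rule summable_comparison_test'[where N = 0])
    fix n
    have "norm (p ^ (n choose 2) / qpoch p p n * z ^ n) = norm (inverse (qpoch p p n)) * norm (p ^ (n choose 2) * z ^ n)"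
      by (simp add: norm_mult norm_divide divide_simps norm_inverse)
    also have "\<dots> \<le> K * norm (p ^ (n choose 2) * z ^ n)"
      by (intro mult_right_mono K) auto
    finally show "norm (norm (p ^ (n choose 2) / qpoch p p n * z ^ n)) \<le> K * norm (p ^ (n choose 2) * z ^ n)"
      by simp
  qed
qed

text \<open>Same method as for the q-binomial theorem, with
  \<open>f x = (1 + x) * f (p * x)\<close>. The quadratic exponent makes the series entire, so
  \<open>z\<close> is unrestricted.\<close>

theorem euler_qpoch_inf:
  assumes p: "norm p < 1"
  shows "(\<lambda>n. p ^ (n choose 2) / qpoch p p n * z ^ n) sums qpoch_inf (- z) p"
proof (cases "z = 0")
  case True
  thus ?thesis using sums_If_finite[of "\<lambda>n. n = 0" "\<lambda>n. 1::complex"]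
    by (simp add: power_0_left if_distrib binomial_eq_0 cong: if_cong)
next
  case z0: False
  define c where "c = (\<lambda>n. p ^ (n choose 2) / qpoch p p n)"
  define f where "f = (\<lambda>z. \<Sum>n. c n * z ^ n)"
  have summ: "summable (\<lambda>n. c n * x ^ n)" for x
    using summable_norm_cancel[OF summable_euler[OF p]] by (simp add: c_def)
  have step: "f x = (1 + x) * f (p * x)" for x
  proof -
    have rec: "c (Suc n) * (1 - p ^ Suc n) = c n * p ^ n" for n
      using qpoch_nonzero'[OF p p, of "Suc n"] by (auto simp: c_def qpoch_Suc power_choose_2_Suc field_simps)
    have S: "(\<lambda>n. c n * x ^ n) sums f x" "(\<lambda>n. c n * (p * x) ^ n) sums f (p * x)"
      using summ by (simp_all add: f_def summable_sums)
    have "(\<lambda>n. c n * x ^ n - c n * (p * x) ^ n) sums (f x - f (p * x))"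
      by (intro sums_diff S)
    moreover have "c 0 * x ^ 0 - c 0 * (p * x) ^ 0 = 0" by simp
    ultimately have "(\<lambda>n. c (Suc n) * x ^ Suc n - c (Suc n) * (p * x) ^ Suc n) sums (f x - f (p * x))"
      by (subst sums_Suc_iff) simp
    also have "(\<lambda>n. c (Suc n) * x ^ Suc n - c (Suc n) * (p * x) ^ Suc n) = (\<lambda>n. x * (c n * (p * x) ^ n))"
    proof
      fix n
      have "c (Suc n) * x ^ Suc n - c (Suc n) * (p * x) ^ Suc n = (c (Suc n) * (1 - p ^ Suc n)) * x ^ Suc n"
        by (simp add: power_mult_distrib algebra_simps)
      thus "c (Suc n) * x ^ Suc n - c (Suc n) * (p * x) ^ Suc n = x * (c n * (p * x) ^ n)"
        by (simp only: rec) (simp add: power_mult_distrib algebra_simps)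
    qed
    finally have "(\<lambda>n. x * (c n * (p * x) ^ n)) sums (f x - f (p * x))" .
    moreover have "(\<lambda>n. x * (c n * (p * x) ^ n)) sums (x * f (p * x))"
      by (intro sums_mult S)
    ultimately have "f x - f (p * x) = x * f (p * x)"
      by (rule sums_unique2)
    thus ?thesis by (simp add: algebra_simps)
  qed
  have iter: "f z = qpoch (-z) p k * f (p ^ k * z)" for k
  proof (induction k)
    case (Suc k)
    show ?case
      by (subst Suc, subst step) (simp add: qpoch_Suc mult_ac)
  qed simp
  have "(\<lambda>k. f (p ^ k * z)) \<longlonglongrightarrow> c 0"
    unfolding f_def using summ z0 p by (rule powser_at_0_LIMSEQ)
  hence "(\<lambda>k. qpoch (-z) p k * f (p ^ k * z)) \<longlonglongrightarrow> qpoch_inf (-z) p * c 0"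
    by (intro tendsto_intros qpoch_tendsto_qpoch_inf p)
  hence "f z = qpoch_inf (-z) p"
    unfolding iter[symmetric] by (simp add: c_def LIMSEQ_const_iff binomial_eq_0)
  thus ?thesis
    using summable_sums[OF summ[of z]] by (simp add: f_def c_def)
qed

section \<open>Product identities and interchange of double sums\<close>

text \<open>The factors are sorted by their index modulo \<open>k\<close>.\<close>

lemma qpoch_mult_base: "qpoch a p (k * n) = (\<Prod>i<k. qpoch (a * p ^ i) (p ^ k) n)"
  by (induction n)
     (simp_all add: qpoch_Suc qpoch_add prod.distrib add.commute[of k] flip: power_mult,
      simp add: qpoch_def mult_ac power_add flip: power_mult)

lemma qpoch_inf_mult_base:
  assumes "norm p < 1" "k > 0"
  shows "qpoch_inf a p = (\<Prod>i<k. qpoch_inf (a * p ^ i) (p ^ k))"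
proof (rule qpoch_inf_eqI[OF assms(1)])
  have pk: "norm (p ^ k) < 1"
    using assms by (simp add: norm_power power_less_one_iff)
  have "(\<lambda>n. \<Prod>i<k. qpoch (a * p ^ i) (p ^ k) n) \<longlonglongrightarrow> (\<Prod>i<k. qpoch_inf (a * p ^ i) (p ^ k))"
    by (intro tendsto_prod qpoch_tendsto_qpoch_inf pk)
  hence *: "(\<lambda>n. qpoch a p (k * n)) \<longlonglongrightarrow> (\<Prod>i<k. qpoch_inf (a * p ^ i) (p ^ k))"
    by (simp only: qpoch_mult_base)
  have "(\<lambda>n. qpoch a p (k * n)) \<longlonglongrightarrow> qpoch_inf a p"
    using LIMSEQ_subseq_LIMSEQ[OF qpoch_tendsto_qpoch_inf[OF assms(1), of a], of "\<lambda>n. k * n"] assms(2)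
    by (auto simp: o_def strict_mono_def)
  with * have "qpoch_inf a p = (\<Prod>i<k. qpoch_inf (a * p ^ i) (p ^ k))"
    by (rule LIMSEQ_unique[rotated])
  thus "qpoch a p \<longlonglongrightarrow> (\<Prod>i<k. qpoch_inf (a * p ^ i) (p ^ k))"
    using qpoch_tendsto_qpoch_inf[OF assms(1), of a] by simp
qed

lemma qpoch_inf_base2:
  assumes "norm p < 1"
  shows "qpoch_inf a p = qpoch_inf a (p^2) * qpoch_inf (a * p) (p^2)"
  using qpoch_inf_mult_base[OF assms, of 2 a] by (simp add: numeral_2_eq_2)

lemma qpoch_inf_base3:
  assumes "norm p < 1"
  shows "qpoch_inf a p = qpoch_inf a (p^3) * qpoch_inf (a * p) (p^3) * qpoch_inf (a * p^2) (p^3)"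
  using qpoch_inf_mult_base[OF assms, of 3 a] by (simp add: eval_nat_numeral mult.assoc)

lemma qpoch_base2: "qpoch a p (2 * n) = qpoch a (p^2) n * qpoch (a * p) (p^2) n"
  using qpoch_mult_base[of a p 2 n] by (simp add: numeral_2_eq_2)

lemma qpoch_minus_mult: "qpoch a p n * qpoch (- a) p n = qpoch (a^2) (p^2) n"
  unfolding qpoch_def prod.distrib[symmetric]
  by (intro prod.cong refl) (simp add: algebra_simps power2_eq_square flip: power_mult_distrib power_mult)

lemma power_less_1_norm: "norm (p::complex) < 1 \<Longrightarrow> n > 0 \<Longrightarrow> norm (p ^ n) < 1"
  by (simp add: norm_power power_less_one_iff)

lemma qpoch_inf_minus_mult:
  assumes "norm p < 1"
  shows "qpoch_inf a p * qpoch_inf (- a) p = qpoch_inf (a^2) (p^2)"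
proof (rule sym, rule qpoch_inf_eqI)
  show "norm (p^2) < 1" using assms by (rule power_less_1_norm) simp
  show "qpoch (a^2) (p^2) \<longlonglongrightarrow> qpoch_inf a p * qpoch_inf (- a) p"
    unfolding qpoch_minus_mult[symmetric]
    by (intro tendsto_intros qpoch_tendsto_qpoch_inf assms)
qed

lemma qpoch_cube_roots:
  assumes w: "w^2 + w + 1 = (0::complex)"
  shows "qpoch a p n * qpoch (w * a) p n * qpoch (w^2 * a) p n = qpoch (a^3) (p^3) n"
proof -
  have "(1 - x) * (1 - w * x) * (1 - w^2 * x) = 1 - x^3" for x
    using w by algebra
  from this[of "a * p ^ m" for m] show ?thesis
    unfolding qpoch_def prod.distrib[symmetric]
    by (intro prod.cong refl) (simp add: mult.assoc power_mult_distrib mult.commute[of _ 3] flip: power_mult)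
qed

lemma qpoch_inf_cube_roots:
  assumes "norm p < 1" and w: "w^2 + w + 1 = (0::complex)"
  shows "qpoch_inf a p * qpoch_inf (w * a) p * qpoch_inf (w^2 * a) p = qpoch_inf (a^3) (p^3)"
proof (rule sym, rule qpoch_inf_eqI)
  show "norm (p^3) < 1" using assms(1) by (rule power_less_1_norm) simp
  show "qpoch (a^3) (p^3) \<longlonglongrightarrow> qpoch_inf a p * qpoch_inf (w * a) p * qpoch_inf (w^2 * a) p"
    unfolding qpoch_cube_roots[OF w, symmetric]
    by (intro tendsto_intros qpoch_tendsto_qpoch_inf assms(1))
qed

lemma euler_odd_distinct:
  assumes "norm p < 1"
  shows "qpoch_inf (- p) p * qpoch_inf p (p^2) = 1"
proof -
  have p2: "norm (p^2) < 1" using assms by (rule power_less_1_norm) simp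
  have "qpoch_inf p p * qpoch_inf (- p) p = qpoch_inf (p^2) (p^2)"
    by (rule qpoch_inf_minus_mult[OF assms])
  moreover have "qpoch_inf p p = qpoch_inf p (p^2) * qpoch_inf (p^2) (p^2)"
    using qpoch_inf_base2[OF assms, of p] by (simp add: power2_eq_square)
  moreover have "qpoch_inf (p^2) (p^2) \<noteq> 0"
    by (rule qpoch_inf_nonzero'[OF p2 p2])
  ultimately show ?thesis by (simp add: mult_ac)
qed

section \<open>Absolute convergence and rearrangement of double series\<close>

lemma norm_summable_iff_summable_on:
  fixes f :: "nat \<Rightarrow> complex"
  shows "summable (\<lambda>n. norm (f n)) \<longleftrightarrow> f summable_on UNIV"
  by (metis norm_summable_imp_summable_on summable_on_iff_abs_summable_on_complex summable_on_imp_summable)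

lemma sums_imp_has_sum:
  fixes f :: "nat \<Rightarrow> complex"
  shows "f sums S \<Longrightarrow> summable (\<lambda>n. norm (f n)) \<Longrightarrow> (f has_sum S) UNIV"
  by (rule norm_summable_imp_has_sum)

lemma summable_on_product:
  fixes A :: "'a \<Rightarrow> complex" and B :: "'b \<Rightarrow> complex"
  assumes "A summable_on UNIV" "B summable_on UNIV"
  shows "(\<lambda>(l, m). A l * B m) summable_on UNIV \<times> UNIV"
proof -
  have A: "(\<lambda>l. norm (A l)) summable_on UNIV" and B: "(\<lambda>l. norm (B l)) summable_on UNIV"
    using assms by (simp_all add: summable_on_iff_abs_summable_on_complex)
  have "(\<lambda>x. norm (case x of (l, m) \<Rightarrow> A l * B m)) summable_on UNIV \<times> UNIV"
    unfolding Infinite_Sum.abs_summable_on_Sigma_iff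
    using A B by (auto simp: norm_mult infsum_cmult_right' abs_mult
        intro!: summable_on_cmult_right summable_on_cmult_left)
  thus ?thesis by (simp add: summable_on_iff_abs_summable_on_complex)
qed

lemma summable_on_mult_bounded:
  fixes f K :: "'a \<Rightarrow> complex"
  assumes "f summable_on X" "\<And>x. x \<in> X \<Longrightarrow> norm (K x) \<le> C"
  shows "(\<lambda>x. f x * K x) summable_on X"
proof -
  have "(\<lambda>x. norm (f x) * C) summable_on X"
    using assms(1) by (intro summable_on_cmult_left) (simp add: summable_on_iff_abs_summable_on_complex)
  hence "(\<lambda>x. norm (f x * K x)) summable_on X"
    by (rule Infinite_Sum.abs_summable_on_comparison_test')
       (auto simp: norm_mult intro!: mult_left_mono assms)
  thus ?thesis by (simp add: summable_on_iff_abs_summable_on_complex)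
qed

lemma sums_swap:
  fixes f :: "nat \<Rightarrow> nat \<Rightarrow> complex"
  assumes "(\<lambda>(l, m). f l m) summable_on UNIV \<times> UNIV"
    and F: "\<And>l. (\<lambda>m. f l m) sums F l" and G: "\<And>m. (\<lambda>l. f l m) sums G m"
  shows "F sums (\<Sum>m. G m)" "G summable_on UNIV"
proof -
  obtain S where S: "((\<lambda>(l, m). f l m) has_sum S) (UNIV \<times> UNIV)"
    using assms(1) by (auto simp: summable_on_def)
  have 1: "(f l has_sum F l) UNIV" for l
    using F[of l] summable_on_SigmaD1[OF assms(1), of l]
    by (intro sums_imp_has_sum) (auto simp: norm_summable_iff_summable_on)
  have S': "((\<lambda>(m, l). f l m) has_sum S) (UNIV \<times> UNIV)"
    using S has_sum_swap[of "\<lambda>(l, m). f l m" UNIV UNIV S] by simp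
  have 2: "((\<lambda>l. f l m) has_sum G m) UNIV" for m
    using G[of m] summable_on_SigmaD1[of "\<lambda>m l. f l m", of UNIV "\<lambda>_. UNIV" m] S'
    by (intro sums_imp_has_sum) (auto simp: norm_summable_iff_summable_on summable_on_def)
  have "(F has_sum S) UNIV" using has_sum_SigmaD[OF S, of F] 1 by simp
  moreover have 3: "(G has_sum S) UNIV" using has_sum_SigmaD[OF S', of G] 2 by simp
  ultimately show "F sums (\<Sum>m. G m)"
    by (metis has_sum_imp_sums sums_unique)
  show "G summable_on UNIV" using 3 by (auto simp: summable_on_def)
qed

lemma sums_antidiagonal:
  fixes f :: "nat \<Rightarrow> nat \<Rightarrow> complex"
  assumes "(\<lambda>(l, m). f l m) summable_on UNIV \<times> UNIV"
    and F: "\<And>l. (\<lambda>m. f l m) sums F l" and "F sums S"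
  shows "(\<lambda>n. \<Sum>i\<le>n. f i (n - i)) sums S"
proof -
  obtain S' where S': "((\<lambda>(l, m). f l m) has_sum S') (UNIV \<times> UNIV)"
    using assms(1) by (auto simp: summable_on_def)
  have 1: "(f l has_sum F l) UNIV" for l
    using F[of l] summable_on_SigmaD1[OF assms(1), of l]
    by (intro sums_imp_has_sum) (auto simp: norm_summable_iff_summable_on)
  have "(F has_sum S') UNIV" using has_sum_SigmaD[OF S', of F] 1 by simp
  hence "S' = S" using assms(3) has_sum_imp_sums sums_unique2 by blast
  have "((\<lambda>(n, i). f i (n - i)) has_sum S') (SIGMA n:UNIV. {..n})"
    using S'
    by (subst has_sum_reindex_bij_witness[where T = "UNIV \<times> UNIV" and h = "\<lambda>(l, m). f l m"
          and j = "\<lambda>(n, i). (i, n - i)" and i = "\<lambda>(l, m). (l + m, l)"]) auto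
  hence "((\<lambda>n. \<Sum>i\<le>n. f i (n - i)) has_sum S') UNIV"
    by (rule has_sum_SigmaD) (use has_sum_finite in \<open>auto\<close>)
  thus ?thesis unfolding \<open>S' = S\<close> by (rule has_sum_imp_sums)
qed

text \<open>Common engine of the series transformations. In use \<open>K l m\<close> is a power
  \<open>p ^ (l * m)\<close>, so that inner sums are usually known series at a shifted argument;
  boundedness of \<open>K\<close> reduces absolute convergence to that of \<open>A\<close> and
  \<open>B\<close>.\<close>

lemma sums_swap_kernel:
  fixes A B :: "nat \<Rightarrow> complex"
  assumes "summable (\<lambda>l. norm (A l))" "summable (\<lambda>m. norm (B m))" "\<And>l m. norm (K l m) \<le> C"
    and F: "\<And>l. (\<lambda>m. B m * K l m) sums F l" and G: "\<And>m. (\<lambda>l. A l * K l m) sums G m"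
  shows "(\<lambda>l. A l * F l) sums (\<Sum>m. B m * G m)"
    and "summable (\<lambda>m. norm (B m * G m))"
proof -
  have "(\<lambda>(l, m). A l * B m) summable_on UNIV \<times> UNIV"
    by (intro summable_on_product) (use assms in \<open>simp_all add: norm_summable_iff_summable_on\<close>)
  hence "(\<lambda>x. (case x of (l, m) \<Rightarrow> A l * B m) * (case x of (l, m) \<Rightarrow> K l m)) summable_on UNIV \<times> UNIV"
    by (rule summable_on_mult_bounded) (use assms(3) in auto)
  hence *: "(\<lambda>(l, m). A l * B m * K l m) summable_on UNIV \<times> UNIV"
    by (simp add: case_prod_unfold)
  note sw = sums_swap[OF *, of "\<lambda>l. A l * F l" "\<lambda>m. B m * G m"]
  have "(\<lambda>m. A l * B m * K l m) sums (A l * F l)" for l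
    using sums_mult[OF F, of "A l" l] by (simp add: mult_ac)
  moreover have "(\<lambda>l. A l * B m * K l m) sums (B m * G m)" for m
    using sums_mult[OF G, of "B m" m] by (simp add: mult_ac)
  ultimately show "(\<lambda>l. A l * F l) sums (\<Sum>m. B m * G m)" "summable (\<lambda>m. norm (B m * G m))"
    using sw by (simp_all add: norm_summable_iff_summable_on)
qed

lemma norm_power_le_1: "norm (p::complex) < 1 \<Longrightarrow> norm (p ^ n) \<le> 1"
  by (simp add: norm_power power_le_one)

text \<open>Heine's argument: the quotient at \<open>g * p ^ l\<close> is expanded by the q-binomial
  theorem, which introduces the kernel \<open>p ^ (l * m)\<close>, and the sum over \<open>l\<close>
  is then another q-binomial series. Quotients of infinite products avoid any nonvanishing condition
  on \<open>d * g\<close>.\<close>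

theorem heine_swap:
  assumes p: "norm p < 1" and z: "norm z < 1" and g: "norm g < 1"
  shows "(\<lambda>l. qpoch a p l / qpoch p p l * z ^ l * (qpoch_inf (d * g * p ^ l) p / qpoch_inf (g * p ^ l) p))
           sums (\<Sum>m. qpoch d p m / qpoch p p m * g ^ m * (qpoch_inf (a * z * p ^ m) p / qpoch_inf (z * p ^ m) p))"
    and "summable (\<lambda>m. norm (qpoch d p m / qpoch p p m * g ^ m * (qpoch_inf (a * z * p ^ m) p / qpoch_inf (z * p ^ m) p)))"
proof -
  have F: "(\<lambda>m. qpoch d p m / qpoch p p m * g ^ m * p ^ (l * m)) sums
          (qpoch_inf (d * g * p ^ l) p / qpoch_inf (g * p ^ l) p)" for l
    using qbinomial_theorem[of p "g * p ^ l" d] p g norm_mult_power_less_1[of p g l]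
    by (simp add: power_mult_distrib mult_ac flip: power_mult)
  have G: "(\<lambda>l. qpoch a p l / qpoch p p l * z ^ l * p ^ (l * m)) sums
          (qpoch_inf (a * z * p ^ m) p / qpoch_inf (z * p ^ m) p)" for m
    using qbinomial_theorem[of p "z * p ^ m" a] p z norm_mult_power_less_1[of p z m]
    by (simp add: power_mult_distrib mult_ac flip: power_mult)
  show "(\<lambda>l. qpoch a p l / qpoch p p l * z ^ l * (qpoch_inf (d * g * p ^ l) p / qpoch_inf (g * p ^ l) p))
           sums (\<Sum>m. qpoch d p m / qpoch p p m * g ^ m * (qpoch_inf (a * z * p ^ m) p / qpoch_inf (z * p ^ m) p))"
    and "summable (\<lambda>m. norm (qpoch d p m / qpoch p p m * g ^ m * (qpoch_inf (a * z * p ^ m) p / qpoch_inf (z * p ^ m) p)))"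
    using sums_swap_kernel[OF summable_qbinomial[OF p z, of a] summable_qbinomial[OF p g, of d] norm_power_le_1[OF p] F G]
    by simp_all
qed

section \<open>Transformations of basic hypergeometric series\<close>

lemma mult_power_neq_1:
  fixes a p :: complex
  assumes "norm p < 1" "norm a < 1"
  shows "a * p ^ n \<noteq> 1"
  using norm_mult_power_less_1[of p a n] assms by auto

lemma qpoch_inf_shift_nonzero:
  assumes "norm p < 1" "\<And>n. a * p ^ n \<noteq> 1"
  shows "qpoch_inf (a * p ^ k) p \<noteq> 0"
  by (rule qpoch_inf_nonzero) (use assms in \<open>auto simp: mult.assoc simp flip: power_add\<close>)

text \<open>The denominator parameter is changed from \<open>c\<close> to \<open>x\<close> by a
  quotient of infinite products. Thus \<open>x\<close> only has to avoid the poles and may lie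
  outside the unit disc, as it later does with value \<open>1 / q\<close>.\<close>

theorem heine_transform:
  assumes p: "norm p < 1" and z: "norm z < 1" and c: "norm c < 1"
    and x: "\<And>n. x * p ^ n \<noteq> 1"
  shows "(\<lambda>l. qpoch c p l / qpoch p p l * z ^ l * (qpoch_inf (b * c * p ^ l) p / qpoch_inf (x * p ^ l) p))
           sums (qpoch_inf c p / qpoch_inf x p *
             (\<Sum>m. qpoch b p m / qpoch p p m * c ^ m * (qpoch_inf (x * z * p ^ m) p / qpoch_inf (z * p ^ m) p)))"
proof -
  have "qpoch_inf c p / qpoch_inf x p * (qpoch x p l / qpoch p p l * z ^ l * (qpoch_inf (b * c * p ^ l) p / qpoch_inf (c * p ^ l) p))
      = qpoch c p l / qpoch p p l * z ^ l * (qpoch_inf (b * c * p ^ l) p / qpoch_inf (x * p ^ l) p)" for l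
    using qpoch_inf_nonzero[OF p x] qpoch_conv_inf'[OF p c, of l] qpoch_conv_inf[OF p x, of l]
    by (simp add: divide_simps)
  thus ?thesis
    using sums_mult[OF heine_swap(1)[OF p z c, of x b], of "qpoch_inf c p / qpoch_inf x p"] by simp
qed

text \<open>In the second application \<open>b\<close> leads, and \<open>z * x / b\<close> is chosen
  so that its product with \<open>b\<close> is the \<open>x * z\<close> left by the first.\<close>

lemma heine_transform_twice:
  assumes p: "norm p < 1" and z: "norm z < 1" and c: "norm c < 1" and b: "norm b < 1" "b \<noteq> 0"
    and x: "\<And>n. x * p ^ n \<noteq> 1"
  shows "(\<lambda>l. qpoch c p l / qpoch p p l * z ^ l * (qpoch_inf (b * c * p ^ l) p / qpoch_inf (x * p ^ l) p))
           sums (qpoch_inf b p * qpoch_inf c p / (qpoch_inf x p * qpoch_inf z p) *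
             (\<Sum>m. qpoch (z * x / b) p m / qpoch p p m * b ^ m * (qpoch_inf (c * z * p ^ m) p / qpoch_inf (c * p ^ m) p)))"
proof -
  have "(\<lambda>m. qpoch b p m / qpoch p p m * c ^ m * (qpoch_inf (x * z * p ^ m) p / qpoch_inf (z * p ^ m) p))
    sums (qpoch_inf b p / qpoch_inf z p *
      (\<Sum>m. qpoch (z * x / b) p m / qpoch p p m * b ^ m * (qpoch_inf (c * z * p ^ m) p / qpoch_inf (c * p ^ m) p)))"
    using heine_transform[OF p c b(1) mult_power_neq_1[OF p z], of "z * x / b"] b(2) by (simp add: mult_ac)
  note eq = sums_unique[OF this, symmetric]
  show ?thesis
    using heine_transform[OF p z c x, of b] unfolding eq by (simp add: mult_ac)
qed

text \<open>Replacing \<open>b\<close> and \<open>x\<close> by \<open>b * p ^ k\<close> and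
  \<open>x * p ^ k\<close> leaves \<open>z * x / b\<close> unchanged. After the twofold
  transformation of the inner sum, \<open>k\<close> therefore survives only in prefactors and in
  \<open>p ^ (k * m)\<close>, and the sum over \<open>k\<close> is a q-binomial series.\<close>

lemma double_heine_sum:
  assumes p: "norm p < 1" "p \<noteq> 0" and z: "norm z < 1" and y: "norm y < 1" and c: "norm c < 1"
    and b: "norm b < 1" "b \<noteq> 0" and x: "\<And>n. x * p ^ n \<noteq> 1"
  shows "(\<lambda>k. qpoch b p k / qpoch p p k * y ^ k *
             (\<Sum>l. qpoch c p l / qpoch p p l * z ^ l * (qpoch_inf (b * c * p ^ (k + l)) p / qpoch_inf (x * p ^ (k + l)) p)))
           sums (qpoch_inf b p * qpoch_inf c p / (qpoch_inf x p * qpoch_inf z p) *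
             (\<Sum>m. qpoch (z * x / b) p m / qpoch p p m * b ^ m *
                (qpoch_inf (c * z * p ^ m) p / qpoch_inf (c * p ^ m) p) *
                (qpoch_inf (x * y * p ^ m) p / qpoch_inf (y * p ^ m) p)))"
proof -
  define B where "B = (\<lambda>m. qpoch (z * x / b) p m / qpoch p p m * b ^ m * (qpoch_inf (z * c * p ^ m) p / qpoch_inf (c * p ^ m) p))"
  define F where "F = (\<lambda>k. \<Sum>m. B m * p ^ (k * m))"
  define D where "D = (\<lambda>k. \<Sum>l. qpoch c p l / qpoch p p l * z ^ l * (qpoch_inf (b * c * p ^ (k + l)) p / qpoch_inf (x * p ^ (k + l)) p))"
  have sB: "summable (\<lambda>m. norm (B m))"
    unfolding B_def by (rule heine_swap(2)[OF p(1) c b(1)])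
  have FB: "(\<lambda>m. B m * p ^ (k * m)) sums F k" for k
    unfolding F_def
  proof (rule summable_sums, rule summable_norm_cancel, rule summable_comparison_test'[OF sB])
    show "norm (norm (B n * p ^ (k * n))) \<le> norm (B n)" for n
      using norm_power_le_1[OF p(1), of "k * n"] by (simp add: norm_mult mult_left_le)
  qed
  have D: "D k = qpoch_inf (b * p ^ k) p * qpoch_inf c p / (qpoch_inf (x * p ^ k) p * qpoch_inf z p) * F k" for k
  proof -
    have "norm (b * p ^ k) < 1" "b * p ^ k \<noteq> 0" "x * p ^ k * p ^ n \<noteq> 1" for n
      using norm_mult_power_less_1[of p b k] b p x[of "k + n"] by (simp_all add: power_add mult_ac)
    from heine_transform_twice[OF p(1) z c this] show ?thesis
      unfolding D_def F_def B_def using b p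
      by (simp add: sums_iff power_add power_mult_distrib mult_ac flip: power_mult)
  qed
  have A: "summable (\<lambda>k. norm (qpoch x p k / qpoch p p k * y ^ k))"
    by (rule summable_qbinomial[OF p(1) y])
  have "(\<lambda>k. qpoch x p k / qpoch p p k * y ^ k * p ^ (k * m)) sums (qpoch_inf (x * y * p ^ m) p / qpoch_inf (y * p ^ m) p)" for m
    using qbinomial_theorem[of p "y * p ^ m" x] p y norm_mult_power_less_1[of p y m]
    by (simp add: power_mult_distrib mult_ac flip: power_mult)
  from sums_swap_kernel(1)[OF A sB norm_power_le_1[OF p(1)] FB this]
  have "(\<lambda>k. qpoch x p k / qpoch p p k * y ^ k * F k) sums (\<Sum>m. B m * (qpoch_inf (x * y * p ^ m) p / qpoch_inf (y * p ^ m) p))" .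
  from sums_mult[OF this, of "qpoch_inf b p * qpoch_inf c p / (qpoch_inf x p * qpoch_inf z p)"]
  have *: "(\<lambda>k. qpoch_inf b p * qpoch_inf c p / (qpoch_inf x p * qpoch_inf z p) * (qpoch x p k / qpoch p p k * y ^ k * F k)) sums
     (qpoch_inf b p * qpoch_inf c p / (qpoch_inf x p * qpoch_inf z p) * (\<Sum>m. B m * (qpoch_inf (x * y * p ^ m) p / qpoch_inf (y * p ^ m) p)))" .
  have "qpoch_inf b p * qpoch_inf c p / (qpoch_inf x p * qpoch_inf z p) * (qpoch x p k / qpoch p p k * y ^ k * F k) =
        qpoch b p k / qpoch p p k * y ^ k * D k" for k
    unfolding D using qpoch_inf_nonzero[OF p(1) x] qpoch_inf_shift_nonzero[OF p(1) x, of k]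
      qpoch_conv_inf'[OF p(1) b(1), of k] qpoch_conv_inf[OF p(1) x, of k]
      qpoch_inf_shift_nonzero[OF p(1) mult_power_neq_1[OF p(1) b(1)], of k]
    by (simp add: divide_simps)
  with * show ?thesis
    by (simp add: D_def B_def mult_ac)
qed

text \<open>The quotient with \<open>y\<close> is expanded by the q-binomial theorem and
  \<open>heine_swap\<close> is applied at \<open>x * p ^ k\<close>. The aim is a double series of
  the shape treated in \<open>double_heine_sum\<close>.\<close>

lemma triple_swap:
  assumes p: "norm p < 1" and x: "norm x < 1" and y: "norm y < 1" and z: "norm z < 1"
  shows "(\<lambda>m. qpoch a p m / qpoch p p m * x ^ m *
            (qpoch_inf (c * z * p ^ m) p / qpoch_inf (z * p ^ m) p) *
            (qpoch_inf (b * y * p ^ m) p / qpoch_inf (y * p ^ m) p))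
    sums (\<Sum>k. qpoch b p k / qpoch p p k * y ^ k *
             (\<Sum>l. qpoch c p l / qpoch p p l * z ^ l * (qpoch_inf (a * x * p ^ (k + l)) p / qpoch_inf (x * p ^ (k + l)) p)))"
proof -
  have sA: "summable (\<lambda>m. norm (qpoch a p m / qpoch p p m * x ^ m * (qpoch_inf (c * z * p ^ m) p / qpoch_inf (z * p ^ m) p)))"
    by (rule heine_swap(2)[OF p z x])
  have sB: "summable (\<lambda>k. norm (qpoch b p k / qpoch p p k * y ^ k))"
    by (rule summable_qbinomial[OF p y])
  have F: "(\<lambda>k. qpoch b p k / qpoch p p k * y ^ k * p ^ (m * k)) sums
          (qpoch_inf (b * y * p ^ m) p / qpoch_inf (y * p ^ m) p)" for m
    using qbinomial_theorem[of p "y * p ^ m" b] p y norm_mult_power_less_1[of p y m]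
    by (simp add: power_mult_distrib mult_ac flip: power_mult)
  have G: "(\<lambda>m. qpoch a p m / qpoch p p m * x ^ m * (qpoch_inf (c * z * p ^ m) p / qpoch_inf (z * p ^ m) p) * p ^ (m * k)) sums
     (\<Sum>l. qpoch c p l / qpoch p p l * z ^ l * (qpoch_inf (a * x * p ^ (k + l)) p / qpoch_inf (x * p ^ (k + l)) p))" for k
    using heine_swap(1)[OF p _ z, of "x * p ^ k" a c] norm_mult_power_less_1[of p x k] p x
    by (simp add: power_mult_distrib power_add mult_ac flip: power_mult)
  show ?thesis
    using sums_swap_kernel(1)[OF sA sB norm_power_le_1[OF p] F G] .
qed

text \<open>Two evaluations of one double series; \<open>a * x = b * c\<close> makes their
  numerators agree.\<close>

theorem three_phi_two_transform:
  assumes p: "norm p < 1" "p \<noteq> 0" and x: "norm x < 1" and y: "norm y < 1" and z: "norm z < 1"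
    and c: "norm c < 1" and b: "norm b < 1" "b \<noteq> 0" and ax: "a * x = b * c"
  shows "(\<lambda>m. qpoch a p m / qpoch p p m * x ^ m *
            (qpoch_inf (c * z * p ^ m) p / qpoch_inf (z * p ^ m) p) *
            (qpoch_inf (b * y * p ^ m) p / qpoch_inf (y * p ^ m) p))
    sums (qpoch_inf b p * qpoch_inf c p / (qpoch_inf x p * qpoch_inf z p) *
             (\<Sum>m. qpoch (z * x / b) p m / qpoch p p m * b ^ m *
                (qpoch_inf (c * z * p ^ m) p / qpoch_inf (c * p ^ m) p) *
                (qpoch_inf (x * y * p ^ m) p / qpoch_inf (y * p ^ m) p)))"
  using triple_swap[OF p(1) x y z, of a c b]
        double_heine_sum[OF p z y c b mult_power_neq_1[OF p(1) x]]
  by (simp add: ax sums_iff)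

section \<open>A cubic summation\<close>

text \<open>A further evaluation of the double series, grouped along \<open>k + l = n\<close>. The
  weights have generating function \<open>G\<close>, and the factor depending on \<open>n\<close> is
  expanded by the q-binomial theorem in \<open>x * p ^ n\<close>. As only
  \<open>norm (x * p) < 1\<close> is available, the term \<open>n = 0\<close> is set aside, which is
  the origin of \<open>G m - 1\<close>.\<close>

lemma double_heine_antidiagonal:
  assumes p: "norm p < 1" "p \<noteq> 0" and z: "norm z < 1" and y: "norm y < 1" and c: "norm c < 1"
    and b: "norm b < 1" "b \<noteq> 0" and x: "\<And>n. x * p ^ n \<noteq> 1" and xp: "norm (x * p) < 1"
    and t: "t * x = b * c"
  defines "G \<equiv> (\<lambda>m. qpoch_inf (b * y * p ^ m) p / qpoch_inf (y * p ^ m) p *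
                   (qpoch_inf (c * z * p ^ m) p / qpoch_inf (z * p ^ m) p))"
  defines "DD \<equiv> (\<Sum>k. qpoch b p k / qpoch p p k * y ^ k *
             (\<Sum>l. qpoch c p l / qpoch p p l * z ^ l * (qpoch_inf (b * c * p ^ (k + l)) p / qpoch_inf (x * p ^ (k + l)) p)))"
  shows "(\<lambda>m. qpoch t p m / qpoch p p m * (G m - 1) * x ^ m)
            sums (DD - qpoch_inf (b * c) p / qpoch_inf x p)"
proof -
  define B where "B = (\<lambda>k. qpoch b p k / qpoch p p k * y ^ k)"
  define C where "C = (\<lambda>l. qpoch c p l / qpoch p p l * z ^ l)"
  define R where "R = (\<lambda>n. qpoch_inf (b * c * p ^ n) p / qpoch_inf (x * p ^ n) p)"
  define w where "w = (\<lambda>n. \<Sum>i\<le>n. B i * C (n - i))"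
  have sB: "summable (\<lambda>k. norm (B k))" and sC: "summable (\<lambda>k. norm (C k))"
    unfolding B_def C_def by (intro summable_qbinomial p y z)+
  have R_eq: "R n = (qpoch_inf (b * c) p / qpoch_inf x p) * (qpoch x p n * inverse (qpoch (b * c) p n))"
    if "\<forall>n. b * c * p ^ n \<noteq> 1" for n
    unfolding R_def
    using that x qpoch_inf_split[OF p(1), of "b * c" n] qpoch_inf_split[OF p(1), of x n]
      qpoch_inf_nonzero[OF p(1), of x] qpoch_inf_nonzero[OF p(1), of "b * c"]
      qpoch_inf_shift_nonzero[OF p(1), of "b * c" n] qpoch_inf_shift_nonzero[OF p(1), of x n]
    by (simp add: divide_simps)
  have bc: "norm (b * c) < 1"
    using norm_mult_less[OF b(1) c] by simp
  have "Bseq R"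
  proof -
    have "R = (\<lambda>n. (qpoch_inf (b * c) p / qpoch_inf x p) * (qpoch x p n * inverse (qpoch (b * c) p n)))"
      using R_eq mult_power_neq_1[OF p(1) bc] by auto
    thus ?thesis
      by (simp only:) (intro Bseq_mult convergent_imp_Bseq[OF convergent_const] Bseq_qpoch Bseq_inverse_qpoch' p(1) bc)
  qed
  then obtain K where K: "\<And>n. norm (R n) \<le> K" by (auto simp: Bseq_def)
  have "(\<lambda>(k, l). B k * C l) summable_on UNIV \<times> UNIV"
    by (intro summable_on_product) (use sB sC in \<open>simp_all add: norm_summable_iff_summable_on\<close>)
  hence "(\<lambda>x. (case x of (k, l) \<Rightarrow> B k * C l) * (case x of (k, l) \<Rightarrow> R (k + l))) summable_on UNIV \<times> UNIV"
    by (rule summable_on_mult_bounded) (use K in auto)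
  hence *: "(\<lambda>(k, l). B k * C l * R (k + l)) summable_on UNIV \<times> UNIV"
    by (simp add: case_prod_unfold)
  have sCR: "summable (\<lambda>l. C l * R (k + l))" for k
  proof (rule summable_norm_cancel, rule summable_comparison_test'[OF summable_mult[OF sC, of K]])
    show "norm (norm (C n * R (k + n))) \<le> K * norm (C n)" for n
      using mult_right_mono[OF K[of "k + n"], of "norm (C n)"] by (simp add: norm_mult mult.commute)
  qed
  define F where "F = (\<lambda>k. B k * (\<Sum>l. C l * R (k + l)))"
  have F: "(\<lambda>l. B k * C l * R (k + l)) sums F k" for k
    unfolding F_def using sums_mult[OF summable_sums[OF sCR[of k]], of "B k"] by (simp add: mult.assoc)
  have "F sums DD"
    unfolding F_def DD_def B_def C_def R_def
    by (rule sums_summable[OF double_heine_sum[OF p z y c b x], THEN summable_sums])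
  from sums_antidiagonal[OF * F this]
  have "(\<lambda>n. \<Sum>i\<le>n. B i * C (n - i) * R (i + (n - i))) sums DD" .
  also have "(\<lambda>n. \<Sum>i\<le>n. B i * C (n - i) * R (i + (n - i))) = (\<lambda>n. w n * R n)"
    by (auto simp: w_def sum_distrib_right fun_eq_iff intro!: sum.cong)
  finally have "(\<lambda>n. w n * R n) sums DD" .
  hence wR: "(\<lambda>n. w (Suc n) * R (Suc n)) sums (DD - R 0)"
    by (subst sums_Suc_iff) (simp add: w_def B_def C_def)
  have sw: "summable (\<lambda>n. norm (w (Suc n)))"
  proof (subst summable_Suc_iff, rule summable_comparison_test')
    show "summable (\<lambda>n. \<Sum>i\<le>n. norm (B i) * norm (C (n - i)))"
      by (rule summable_Cauchy_product) (use sB sC in auto)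
    show "norm (norm (w n)) \<le> (\<Sum>i\<le>n. norm (B i) * norm (C (n - i)))" for n
      unfolding w_def using norm_sum[of "\<lambda>i. B i * C (n - i)" "{..n}"] by (simp add: norm_mult)
  qed
  have sA: "summable (\<lambda>m. norm (qpoch t p m / qpoch p p m * (x * p) ^ m))"
    by (rule summable_qbinomial[OF p(1) xp])
  have RS: "(\<lambda>m. qpoch t p m / qpoch p p m * (x * p) ^ m * p ^ (n * m)) sums R (Suc n)" for n
    using qbinomial_theorem[of p "x * p * p ^ n" t] p norm_mult_power_less_1[of p "x * p" n] xp t
    by (simp add: R_def power_mult_distrib mult_ac flip: power_mult)
       (metis (no_types, lifting) mult.assoc mult.commute)
  \<comment> \<open>Shifting \<open>n\<close> by one removes the constant term 1 of the generating
    function and one factor \<open>p ^ m\<close>; the latter finally turns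
    \<open>(x * p) ^ m\<close> back into \<open>x ^ m\<close>.\<close>
  have G: "(\<lambda>n. w (Suc n) * p ^ (n * m)) sums ((G m - 1) / p ^ m)" for m
  proof -
    have b': "(\<lambda>k. B k * p ^ (m * k)) sums (qpoch_inf (b * y * p ^ m) p / qpoch_inf (y * p ^ m) p)"
      using qbinomial_theorem[of p "y * p ^ m" b] p y norm_mult_power_less_1[of p y m]
      by (simp add: B_def power_mult_distrib mult_ac flip: power_mult)
    have c': "(\<lambda>k. C k * p ^ (m * k)) sums (qpoch_inf (c * z * p ^ m) p / qpoch_inf (z * p ^ m) p)"
      using qbinomial_theorem[of p "z * p ^ m" c] p z norm_mult_power_less_1[of p z m]
      by (simp add: C_def power_mult_distrib mult_ac flip: power_mult)
    have nb: "summable (\<lambda>k. norm (B k * p ^ (m * k)))"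
      by (rule summable_comparison_test'[OF sB])
         (use norm_power_le_1[OF p(1)] in \<open>simp add: norm_mult mult_left_le\<close>)
    have nc: "summable (\<lambda>k. norm (C k * p ^ (m * k)))"
      by (rule summable_comparison_test'[OF sC])
         (use norm_power_le_1[OF p(1)] in \<open>simp add: norm_mult mult_left_le\<close>)
    have "(\<lambda>n. \<Sum>i\<le>n. (B i * p ^ (m * i)) * (C (n - i) * p ^ (m * (n - i)))) sums G m"
      unfolding G_def using Cauchy_product_sums[OF nb nc] b' c' by (simp add: sums_iff)
    also have "(\<lambda>n. \<Sum>i\<le>n. (B i * p ^ (m * i)) * (C (n - i) * p ^ (m * (n - i)))) = (\<lambda>n. w n * p ^ (n * m))"
    proof
      fix n
      have "(B i * p ^ (m * i)) * (C (n - i) * p ^ (m * (n - i))) = B i * C (n - i) * p ^ (n * m)" if "i \<le> n" for i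
        using that power_add[of p "m * i" "m * (n - i)"] by (simp add: diff_mult_distrib2 mult_ac)
      thus "(\<Sum>i\<le>n. (B i * p ^ (m * i)) * (C (n - i) * p ^ (m * (n - i)))) = w n * p ^ (n * m)"
        unfolding w_def sum_distrib_right by (intro sum.cong) auto
    qed
    finally have "(\<lambda>n. w (Suc n) * p ^ (Suc n * m)) sums (G m - 1)"
      by (subst sums_Suc_iff) (simp add: w_def B_def C_def)
    from sums_divide[OF this, of "p ^ m"] show ?thesis
      using p(2) by (simp add: power_add mult_ac)
  qed
  have "(\<lambda>n. w (Suc n) * R (Suc n)) sums (\<Sum>m. qpoch t p m / qpoch p p m * (x * p) ^ m * ((G m - 1) / p ^ m))"
    by (rule sums_swap_kernel(1)[OF sw sA norm_power_le_1[OF p(1)] RS G])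
  with wR have eq: "DD - R 0 = (\<Sum>m. qpoch t p m / qpoch p p m * (x * p) ^ m * ((G m - 1) / p ^ m))"
    by (simp add: sums_iff)
  have "(\<lambda>m. qpoch t p m / qpoch p p m * (x * p) ^ m * ((G m - 1) / p ^ m)) sums (DD - R 0)"
    unfolding eq
    by (rule summable_sums, rule summable_norm_cancel) (rule sums_swap_kernel(2)[OF sw sA norm_power_le_1[OF p(1)] RS G])
  also have "(\<lambda>m. qpoch t p m / qpoch p p m * (x * p) ^ m * ((G m - 1) / p ^ m)) = (\<lambda>m. qpoch t p m / qpoch p p m * (G m - 1) * x ^ m)"
    using p(2) by (simp add: power_mult_distrib fun_eq_iff mult_ac)
  finally show ?thesis by (simp add: R_def)
qed

lemma abel_sums_geometric:
  fixes D :: "nat \<Rightarrow> complex"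
  assumes "(\<lambda>m. D m * x ^ m) sums s"
  shows "(\<lambda>m. (D (Suc m) - D m) * x ^ Suc m) sums ((1 - x) * s - D 0)"
proof -
  have "(\<lambda>m. D (Suc m) * x ^ Suc m) sums (s - D 0)"
    using assms by (subst sums_Suc_iff) simp
  from sums_diff[OF this sums_mult[OF assms, of x]] show ?thesis
    by (simp add: algebra_simps)
qed

text \<open>The difference \<open>(1 - t * p ^ m) - (1 - p ^ Suc m)\<close> equals
  \<open>p ^ Suc m * (1 - t / p)\<close>. The gained factor \<open>p ^ Suc m\<close> lets the
  differenced series converge as soon as \<open>norm (x * p) < 1\<close>.\<close>

lemma qpoch_quotient_diff:
  assumes "norm p < 1" "p \<noteq> 0"
  shows "qpoch t p (Suc m) / qpoch p p (Suc m) - qpoch t p m / qpoch p p m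
       = qpoch (t / p) p (Suc m) / qpoch p p (Suc m) * p ^ Suc m"
proof -
  have nz: "qpoch p p m \<noteq> 0" "1 - p * p ^ m \<noteq> 0"
    using qpoch_nonzero'[of p p m] mult_power_neq_1[of p p m] assms by auto
  have 1: "qpoch t p (Suc m) = qpoch t p m * (1 - t * p ^ m)" by (rule qpoch_Suc)
  have 2: "qpoch p p (Suc m) = qpoch p p m * (1 - p * p ^ m)" by (rule qpoch_Suc)
  have 3: "qpoch (t / p) p (Suc m) = (1 - t / p) * qpoch t p m"
    using assms by (simp add: qpoch_Suc')
  show ?thesis
    unfolding 1 2 3 using nz assms by (simp add: field_simps)
qed

lemma qpoch_quotient_diff_sums:
  assumes p: "norm p < 1" "p \<noteq> 0" and xp: "norm (x * p) < 1"
  shows "(\<lambda>m. (qpoch t p (Suc m) / qpoch p p (Suc m) - qpoch t p m / qpoch p p m) * x ^ Suc m)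
           sums (qpoch_inf (t * x) p / qpoch_inf (x * p) p - 1)"
proof -
  have "(\<lambda>m. qpoch (t / p) p (Suc m) / qpoch p p (Suc m) * (x * p) ^ Suc m) sums
          (qpoch_inf (t / p * (x * p)) p / qpoch_inf (x * p) p - 1)"
    using qbinomial_theorem[OF p(1) xp, of "t / p"] by (subst sums_Suc_iff) simp
  thus ?thesis
    unfolding qpoch_quotient_diff[OF p] using p(2) by (simp add: power_mult_distrib mult_ac)
qed

text \<open>
  After the antidiagonal split only a single sum over $m$ of a difference of two terms is left, but
  $|\lambda| \ge 1$ is possible and the two parts then diverge separately. Multiplying by
  $1 - \lambda$ and summing by parts makes both converge by the q-binomial theorem; the cube roots
  of unity combine the products in base $p$ into products in base $p^3$.
\<close>

lemma cubic_sum: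
  assumes p: "norm p < 1" "p \<noteq> 0" and w: "w^2 + w + 1 = (0::complex)" "norm w = 1"
    and be: "norm be < 1" and t: "norm t < 1" "t * be = p"
    and la: "la * p = be ^ 3" "\<And>n. la * p ^ n \<noteq> 1"
  shows "(1 - la) * (\<Sum>k. qpoch (be * w) p k / qpoch p p k * (t * w) ^ k *
             (\<Sum>l. qpoch (be * w^2) p l / qpoch p p l * (t * w^2) ^ l *
                (qpoch_inf (be^2 * p ^ (k + l)) p / qpoch_inf (la * p ^ (k + l)) p)))
       = qpoch_inf (p^3) (p^3) * qpoch_inf (p^2) (p^3) /
         (qpoch_inf p p * qpoch_inf (t * w) p * qpoch_inf (t * w^2) p * qpoch_inf (la * p^3) (p^3))"
    (is "(1 - la) * ?DD = ?rhs")
proof -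
  have w3: "w * w^2 = 1" "w^2 * w^2 = w" using w(1) by algebra+
  have w0: "w \<noteq> 0" using w(1) by auto
  have be0: "be \<noteq> 0" and t0: "t \<noteq> 0" using p(2) t by auto
  have nbe: "norm (be * w) < 1" "norm (be * w^2) < 1" "norm (t * w) < 1" "norm (t * w^2) < 1"
    using be t w(2) by (simp_all add: norm_mult norm_power)
  have xp: "norm (la * p) < 1" using be unfolding la(1) by (rule power_less_1_norm) simp
  have bc: "be * w * (be * w^2) = be^2" using w3 by algebra
  have tla: "t * la = be^2"
  proof -
    have "t * la * p = t * (la * p)" by simp
    also have "\<dots> = (t * be) * be^2" unfolding la(1) by (simp add: eval_nat_numeral)
    finally have "t * la * p = be^2 * p" by (simp add: t(2))
    thus ?thesis using p(2) by simp
  qed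
  have by1: "be * w * (t * w) = p * w^2" "be * w^2 * (t * w^2) = p * w"
    subgoal using w3 t(2) by algebra
    subgoal using w3 t(2) by algebra
    done
  have p3: "norm (p^3) < 1" "p^3 \<noteq> 0" using p by (auto intro: power_less_1_norm)
  define G where "G = (\<lambda>m. qpoch_inf (p * w^2 * p ^ m) p / qpoch_inf (t * w * p ^ m) p *
                   (qpoch_inf (p * w * p ^ m) p / qpoch_inf (t * w^2 * p ^ m) p))"
  have tx: "t * la = be * w * (be * w^2)" using tla bc by simp
  have S: "(\<lambda>m. qpoch t p m / qpoch p p m * (G m - 1) * la ^ m) sums (?DD - qpoch_inf (be^2) p / qpoch_inf la p)"
    using double_heine_antidiagonal[OF p nbe(4) nbe(3) nbe(2) nbe(1) _ la(2) xp tx] be0 w0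
    unfolding bc by1 G_def by simp
  define E where "E = (\<lambda>m. qpoch t p m / qpoch p p m)"
  define H where "H = (\<lambda>m. qpoch (t^3) (p^3) m / qpoch (p^3) (p^3) m)"
  define ka where "ka = qpoch_inf (p * w) p * qpoch_inf (p * w^2) p / (qpoch_inf (t * w) p * qpoch_inf (t * w^2) p)"
  have pw: "norm (p * w) < 1" "norm (p * w^2) < 1"
    using p w(2) by (simp_all add: norm_mult norm_power)
  have EG: "E m * G m = ka * H m" for m
  proof -
    have 1: "qpoch t p m * qpoch (t * w) p m * qpoch (t * w^2) p m = qpoch (t^3) (p^3) m"
            "qpoch p p m * qpoch (p * w) p m * qpoch (p * w^2) p m = qpoch (p^3) (p^3) m"
      using qpoch_cube_roots[OF w(1), of t p m] qpoch_cube_roots[OF w(1), of p p m] by (simp_all add: mult_ac)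
    show ?thesis
      unfolding E_def H_def 1[symmetric] ka_def G_def
      using qpoch_inf_split[OF p(1), of "p * w" m] qpoch_inf_split[OF p(1), of "p * w^2" m]
        qpoch_inf_split[OF p(1), of "t * w" m] qpoch_inf_split[OF p(1), of "t * w^2" m]
        qpoch_inf_shift_nonzero[OF p(1) mult_power_neq_1[OF p(1) nbe(3)], of m]
        qpoch_inf_shift_nonzero[OF p(1) mult_power_neq_1[OF p(1) nbe(4)], of m]
        qpoch_nonzero'[OF p(1) pw(1), of m] qpoch_nonzero'[OF p(1) pw(2), of m]
        qpoch_nonzero'[OF p(1) nbe(3), of m] qpoch_nonzero'[OF p(1) nbe(4), of m]
        qpoch_inf_nonzero'[OF p(1) pw(1)] qpoch_inf_nonzero'[OF p(1) pw(2)]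
        qpoch_inf_nonzero'[OF p(1) nbe(3)] qpoch_inf_nonzero'[OF p(1) nbe(4)]
        qpoch_nonzero'[OF p(1) p(1), of m]
      by (simp add: divide_simps)
  qed
  have E0: "E 0 = 1" "H 0 = 1" by (simp_all add: E_def H_def)
  define D where "D = (\<lambda>m. ka * H m - E m)"
  have "(\<lambda>m. D m * la ^ m) sums (?DD - qpoch_inf (be^2) p / qpoch_inf la p)"
  proof -
    have "(\<lambda>m. D m * la ^ m) = (\<lambda>m. E m * (G m - 1) * la ^ m)"
      by (simp add: D_def fun_eq_iff algebra_simps flip: EG)
    thus ?thesis using S by (simp only: E_def)
  qed
  from abel_sums_geometric[OF this]
  have A1: "(\<lambda>m. (D (Suc m) - D m) * la ^ Suc m) sums ((1 - la) * (?DD - qpoch_inf (be^2) p / qpoch_inf la p) - D 0)" .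
  have lap3: "norm (la * p^3) < 1"
    using norm_mult_power_less_1[of p "la * p" 2] xp p by (simp add: eval_nat_numeral mult_ac)
  have A2: "(\<lambda>m. (E (Suc m) - E m) * la ^ Suc m) sums (qpoch_inf (t * la) p / qpoch_inf (la * p) p - 1)"
    unfolding E_def by (rule qpoch_quotient_diff_sums[OF p xp])
  have A3: "(\<lambda>m. (H (Suc m) - H m) * la ^ Suc m) sums (qpoch_inf (t^3 * la) (p^3) / qpoch_inf (la * p^3) (p^3) - 1)"
    unfolding H_def by (rule qpoch_quotient_diff_sums[OF p3 lap3])
  have "(\<lambda>m. ka * ((H (Suc m) - H m) * la ^ Suc m) - (E (Suc m) - E m) * la ^ Suc m) sums
     (ka * (qpoch_inf (t^3 * la) (p^3) / qpoch_inf (la * p^3) (p^3) - 1) - (qpoch_inf (t * la) p / qpoch_inf (la * p) p - 1))"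
    by (intro sums_diff sums_mult A2 A3)
  also have "(\<lambda>m. ka * ((H (Suc m) - H m) * la ^ Suc m) - (E (Suc m) - E m) * la ^ Suc m) = (\<lambda>m. (D (Suc m) - D m) * la ^ Suc m)"
    by (simp add: D_def fun_eq_iff algebra_simps)
  finally have eq: "(1 - la) * (?DD - qpoch_inf (be^2) p / qpoch_inf la p) - D 0 =
     ka * (qpoch_inf (t^3 * la) (p^3) / qpoch_inf (la * p^3) (p^3) - 1) - (qpoch_inf (t * la) p / qpoch_inf (la * p) p - 1)"
    by (rule sums_unique2[OF A1])
  have t3la: "t^3 * la = p^2"
  proof -
    have "t^3 * la * p = t^3 * (la * p)" by simp
    also have "\<dots> = (t * be)^3" unfolding la(1) by (simp add: power_mult_distrib)
    also have "\<dots> = p^2 * p" by (simp add: t(2) eval_nat_numeral)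
    finally show ?thesis using p(2) mult_cancel_right by blast
  qed
  have la1: "la \<noteq> 1" using la(2)[of 0] by simp
  have lainf: "qpoch_inf la p = (1 - la) * qpoch_inf (la * p) p" by (rule qpoch_inf_Suc[OF p(1)])
  have "(1 - la) * (qpoch_inf (be^2) p / qpoch_inf la p) = qpoch_inf (be^2) p / qpoch_inf (la * p) p"
    unfolding lainf using la1 by simp
  note r1 = this
  have D0: "D 0 = ka - 1" by (simp add: D_def E0)
  \<comment> \<open>The bookkeeping in abstract form: the boundary terms, \<open>D 0\<close> and the
    split-off term \<open>n = 0\<close> cancel, and only the product in base \<open>p ^ 3\<close> is
    left.\<close>
  have *: "(1 - l) * d = k * x" if "(1 - l) * (d - r) - d0 = k * (x - 1) - (y - 1)" "(1 - l) * r = y" "d0 = k - 1"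
    for l d r d0 k x y :: complex using that by algebra
  have "(1 - la) * ?DD = ka * (qpoch_inf (p^2) (p^3) / qpoch_inf (la * p^3) (p^3))"
    by (rule *[OF eq[unfolded t3la tla] r1 D0])
  also have "\<dots> = ?rhs"
    using qpoch_inf_cube_roots[OF p(1) w(1), of p] qpoch_inf_nonzero'[OF p(1) p(1)]
    by (simp add: ka_def divide_simps mult_ac)
  finally show ?thesis .
qed

text \<open>Three relations are chained: \<open>three_phi_two_transform\<close> sends the series to
  \<open>s1\<close>, the terms of \<open>s1\<close> and \<open>s2\<close> are proportional, and
  \<open>double_heine_sum\<close> ties \<open>s2\<close> to the double series evaluated by
  \<open>cubic_sum\<close>. The parameters fit because \<open>t * be = p\<close> and
  \<open>la * p = be ^ 3\<close> give \<open>t * la = be ^ 2\<close>.\<close>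

theorem cubic_summation:
  assumes p: "norm p < 1" "p \<noteq> 0" and w: "w^2 + w + 1 = (0::complex)" "norm w = 1"
    and be: "norm be < 1" and t: "norm t < 1" "t * be = p"
    and la: "la * p = be ^ 3" "\<And>n. la * p ^ n \<noteq> 1"
  shows "(\<lambda>n. qpoch la p n * qpoch be p n / (qpoch p p n * qpoch (be^2) p n) * (t * w^2) ^ n *
            (qpoch_inf (be^2 * w * p ^ n) p / qpoch_inf (be * w^2 * p ^ n) p))
     sums (qpoch_inf (la * p) (p^3) * qpoch_inf (la * p^2) (p^3) /
        (qpoch_inf p (p^3) * qpoch_inf (be^2) p * qpoch_inf (be * w^2) p * qpoch_inf (t * w^2) p))"
proof -
  have w3: "w * w^2 = 1" "w^2 * w^2 = w" using w(1) by algebra+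
  have w0: "w \<noteq> 0" using w(1) by auto
  have be0: "be \<noteq> 0" and t0: "t \<noteq> 0" using p(2) t by auto
  have nbe: "norm (be * w) < 1" "norm (be * w^2) < 1" "norm (t * w) < 1" "norm (t * w^2) < 1"
    using be t w(2) by (simp_all add: norm_mult norm_power)
  have tla: "t * la = be^2"
  proof -
    have "t * la * p = t * (la * p)" by simp
    also have "\<dots> = (t * be) * be^2" unfolding la(1) by (simp add: eval_nat_numeral)
    finally have "t * la * p = be^2 * p" by (simp add: t(2))
    thus ?thesis using p(2) by simp
  qed
  have be2: "norm (be^2) < 1" using be by (rule power_less_1_norm) simp
  define s2 where "s2 = (\<Sum>m. qpoch (be * w) p m / qpoch p p m * (be * w) ^ m *
     (qpoch_inf (p * w * p ^ m) p / qpoch_inf (be * w^2 * p ^ m) p) * (qpoch_inf (be^2 * w * p ^ m) p / qpoch_inf (t * w * p ^ m) p))"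
  have e1: "be * w * (be * w^2) = be^2" "be * w^2 * (t * w^2) = p * w" "la * (t * w) = be^2 * w"
    "t * w^2 * la / (be * w) = be * w"
    subgoal using w3 by algebra
    subgoal using w3 t(2) by algebra
    subgoal using tla by algebra
    subgoal using w3 tla be0 w0 by (simp add: field_simps power2_eq_square)
    done
  have DD: "(\<Sum>k. qpoch (be * w) p k / qpoch p p k * (t * w) ^ k *
             (\<Sum>l. qpoch (be * w^2) p l / qpoch p p l * (t * w^2) ^ l *
                (qpoch_inf (be^2 * p ^ (k + l)) p / qpoch_inf (la * p ^ (k + l)) p)))
     = qpoch_inf (be * w) p * qpoch_inf (be * w^2) p / (qpoch_inf la p * qpoch_inf (t * w^2) p) * s2" (is "?DD = _")
    using double_heine_sum[OF p nbe(4) nbe(3) nbe(2) nbe(1) _ la(2)] be0 w0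
    unfolding e1 s2_def by (simp add: sums_iff)
  have e2: "be * w * (be * w^2) = be^2" "be * w * be = be^2 * w" "t * w^2 * (be * w^2) = p * w"
    "be * (t * w^2) / (be * w) = t * w" "la * (t * w^2) = be * w * (be * w)"
    subgoal using w3 by algebra
    subgoal by algebra
    subgoal using w3 t(2) by algebra
    subgoal using be0 w0 by (simp add: field_simps power2_eq_square)
    subgoal using tla by algebra
    done
  define s1 where "s1 = (\<Sum>m. qpoch (t * w) p m / qpoch p p m * (be * w) ^ m *
     (qpoch_inf (be^2 * w * p ^ m) p / qpoch_inf (be * w * p ^ m) p) * (qpoch_inf (p * w * p ^ m) p / qpoch_inf (be * w^2 * p ^ m) p))"
  have "(\<lambda>m. qpoch la p m / qpoch p p m * (t * w^2) ^ m *
            (qpoch_inf (be^2 * w * p ^ m) p / qpoch_inf (be * p ^ m) p) *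
            (qpoch_inf (be^2 * p ^ m) p / qpoch_inf (be * w^2 * p ^ m) p))
    sums (qpoch_inf (be * w) p * qpoch_inf (be * w) p / (qpoch_inf (t * w^2) p * qpoch_inf be p) * s1)"
    using three_phi_two_transform[OF p nbe(4) nbe(2) be nbe(1) nbe(1) _ e2(5)] be0 w0
    unfolding e2 s1_def by simp
  from sums_mult[OF this, of "qpoch_inf be p / qpoch_inf (be^2) p"]
  have X: "(\<lambda>n. qpoch la p n * qpoch be p n / (qpoch p p n * qpoch (be^2) p n) * (t * w^2) ^ n *
            (qpoch_inf (be^2 * w * p ^ n) p / qpoch_inf (be * w^2 * p ^ n) p)) sums
       (qpoch_inf be p / qpoch_inf (be^2) p * (qpoch_inf (be * w) p * qpoch_inf (be * w) p / (qpoch_inf (t * w^2) p * qpoch_inf be p) * s1))"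
  proof (rule sums_cong[THEN iffD1, rotated])
    fix m
    show "qpoch_inf be p / qpoch_inf (be^2) p * (qpoch la p m / qpoch p p m * (t * w^2) ^ m *
            (qpoch_inf (be^2 * w * p ^ m) p / qpoch_inf (be * p ^ m) p) *
            (qpoch_inf (be^2 * p ^ m) p / qpoch_inf (be * w^2 * p ^ m) p)) =
        qpoch la p m * qpoch be p m / (qpoch p p m * qpoch (be^2) p m) * (t * w^2) ^ m *
            (qpoch_inf (be^2 * w * p ^ m) p / qpoch_inf (be * w^2 * p ^ m) p)"
      using qpoch_inf_split[OF p(1), of be m] qpoch_inf_split[OF p(1), of "be^2" m]
        qpoch_nonzero'[OF p(1) be2, of m] qpoch_nonzero'[OF p(1) p(1), of m]
        qpoch_inf_shift_nonzero[OF p(1) mult_power_neq_1[OF p(1) be], of m]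
        qpoch_inf_shift_nonzero[OF p(1) mult_power_neq_1[OF p(1) nbe(2)], of m]
        qpoch_inf_nonzero'[OF p(1) be2] qpoch_inf_shift_nonzero[OF p(1) mult_power_neq_1[OF p(1) be2], of m]
      by (simp add: divide_simps)
  qed
  \<comment> \<open>Termwise the sums differ by the ratio of
    \<open>qpoch a p m * qpoch_inf (a * p ^ m) p\<close> for \<open>a = t * w\<close> and
    \<open>a = be * w\<close>, which does not depend on \<open>m\<close>.\<close>
  have s12: "s1 = qpoch_inf (t * w) p / qpoch_inf (be * w) p * s2"
    unfolding s1_def s2_def
  proof (rule sums_unique[symmetric], rule sums_cong[THEN iffD1, rotated], rule sums_mult, rule summable_sums)
    show "summable (\<lambda>m. qpoch (be * w) p m / qpoch p p m * (be * w) ^ m *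
     (qpoch_inf (p * w * p ^ m) p / qpoch_inf (be * w^2 * p ^ m) p) * (qpoch_inf (be^2 * w * p ^ m) p / qpoch_inf (t * w * p ^ m) p))"
      using sums_summable[OF triple_swap[OF p(1) nbe(1) nbe(3) nbe(2), of "be * w" "t * w^2" la]] unfolding e1 e2 .
    fix m
    show "qpoch_inf (t * w) p / qpoch_inf (be * w) p * (qpoch (be * w) p m / qpoch p p m * (be * w) ^ m *
     (qpoch_inf (p * w * p ^ m) p / qpoch_inf (be * w^2 * p ^ m) p) * (qpoch_inf (be^2 * w * p ^ m) p / qpoch_inf (t * w * p ^ m) p))
     = qpoch (t * w) p m / qpoch p p m * (be * w) ^ m *
     (qpoch_inf (be^2 * w * p ^ m) p / qpoch_inf (be * w * p ^ m) p) * (qpoch_inf (p * w * p ^ m) p / qpoch_inf (be * w^2 * p ^ m) p)"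
      using qpoch_inf_split[OF p(1), of "be * w" m] qpoch_inf_split[OF p(1), of "t * w" m]
        qpoch_inf_shift_nonzero[OF p(1) mult_power_neq_1[OF p(1) nbe(3)], of m]
        qpoch_inf_shift_nonzero[OF p(1) mult_power_neq_1[OF p(1) nbe(2)], of m]
        qpoch_nonzero'[OF p(1) p(1), of m]
        qpoch_inf_nonzero'[OF p(1) nbe(1)] qpoch_inf_shift_nonzero[OF p(1) mult_power_neq_1[OF p(1) nbe(1)], of m]
      by (simp add: divide_simps)
  qed
  have la1: "la \<noteq> 1" using la(2)[of 0] by simp
  have lap: "norm (la * p) < 1" using be unfolding la(1) by (rule power_less_1_norm) simp
  have p3: "norm (p^3) < 1" using p by (auto intro: power_less_1_norm)
  have lap3: "norm (la * p^3) < 1"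
    using norm_mult_power_less_1[of p "la * p" 2] lap p by (simp add: eval_nat_numeral mult_ac)
  \<comment> \<open>The factor \<open>1 - la\<close> is separated because it cancels the one in
    \<open>cubic_sum\<close>; the rest starts at \<open>la * p\<close>, inside the unit
    disc.\<close>
  have lainf: "qpoch_inf la p = (1 - la) * (qpoch_inf (la * p) (p^3) * qpoch_inf (la * p^2) (p^3) * qpoch_inf (la * p^3) (p^3))"
    using qpoch_inf_Suc[OF p(1), of la] qpoch_inf_base3[OF p(1), of "la * p"] by (simp add: eval_nat_numeral mult.assoc)
  have pinf: "qpoch_inf p p = qpoch_inf p (p^3) * qpoch_inf (p^2) (p^3) * qpoch_inf (p^3) (p^3)"
    using qpoch_inf_base3[OF p(1), of p] by (simp add: eval_nat_numeral mult.assoc)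
  have p2: "norm (p^2) < 1" using p by (auto intro: power_less_1_norm)
  have nz: "qpoch_inf be p \<noteq> 0" "qpoch_inf (be * w) p \<noteq> 0" "qpoch_inf (be * w^2) p \<noteq> 0" "qpoch_inf (be^2) p \<noteq> 0"
    "qpoch_inf (t * w) p \<noteq> 0" "qpoch_inf (t * w^2) p \<noteq> 0" "qpoch_inf (la * p^3) (p^3) \<noteq> 0"
    "qpoch_inf p (p^3) \<noteq> 0" "qpoch_inf (p^2) (p^3) \<noteq> 0" "qpoch_inf (p^3) (p^3) \<noteq> 0"
    by (rule qpoch_inf_nonzero'; rule p be nbe be2 lap3 p2 p3)+
  have "qpoch_inf la p \<noteq> 0" by (rule qpoch_inf_nonzero[OF p(1) la(2)])
  note nz = nz this
  define V where "V = qpoch_inf (p^3) (p^3) * qpoch_inf (p^2) (p^3) /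
         (qpoch_inf p p * qpoch_inf (t * w) p * qpoch_inf (t * w^2) p * qpoch_inf (la * p^3) (p^3))"
  have "(1 - la) * (qpoch_inf (be * w) p * qpoch_inf (be * w^2) p / (qpoch_inf la p * qpoch_inf (t * w^2) p) * s2) = V"
    using cubic_sum[OF p w be t la] unfolding DD V_def .
  hence s2: "s2 = V * (qpoch_inf la p * qpoch_inf (t * w^2) p) / ((1 - la) * qpoch_inf (be * w) p * qpoch_inf (be * w^2) p)"
    using nz la1 by (simp add: field_simps)
  have "qpoch_inf be p / qpoch_inf (be^2) p * (qpoch_inf (be * w) p * qpoch_inf (be * w) p / (qpoch_inf (t * w^2) p * qpoch_inf be p) * s1)
    = qpoch_inf (la * p) (p^3) * qpoch_inf (la * p^2) (p^3) /
        (qpoch_inf p (p^3) * qpoch_inf (be^2) p * qpoch_inf (be * w^2) p * qpoch_inf (t * w^2) p)"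
    unfolding s12 s2 V_def using nz la1 unfolding lainf pinf by (simp add: divide_simps)
  with X show ?thesis by simp
qed

section \<open>A quadratic transformation\<close>

text \<open>The bases can be mixed because the kernel \<open>p ^ (n * m)\<close> shifts the argument
  \<open>v\<close> in base \<open>p ^ 2\<close> and the argument \<open>g\<close> in base
  \<open>p\<close> alike; both inner sums are q-binomial series.\<close>

lemma quadratic_base_swap:
  assumes p: "norm p < 1" and v: "norm v < 1" and g: "norm g < 1"
  shows "(\<lambda>n. qpoch a (p^2) n / qpoch (p^2) (p^2) n * v ^ n * (qpoch_inf (d * g * p ^ n) p / qpoch_inf (g * p ^ n) p))
           sums (\<Sum>m. qpoch d p m / qpoch p p m * g ^ m * (qpoch_inf (a * v * p ^ m) (p^2) / qpoch_inf (v * p ^ m) (p^2)))"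
    and "summable (\<lambda>m. norm (qpoch d p m / qpoch p p m * g ^ m * (qpoch_inf (a * v * p ^ m) (p^2) / qpoch_inf (v * p ^ m) (p^2))))"
proof -
  have p2: "norm (p^2) < 1" using p by (rule power_less_1_norm) simp
  have F: "(\<lambda>m. qpoch d p m / qpoch p p m * g ^ m * p ^ (n * m)) sums
          (qpoch_inf (d * g * p ^ n) p / qpoch_inf (g * p ^ n) p)" for n
    using qbinomial_theorem[of p "g * p ^ n" d] p g norm_mult_power_less_1[of p g n]
    by (simp add: power_mult_distrib mult_ac flip: power_mult)
  have G: "(\<lambda>n. qpoch a (p^2) n / qpoch (p^2) (p^2) n * v ^ n * p ^ (n * m)) sums
          (qpoch_inf (a * v * p ^ m) (p^2) / qpoch_inf (v * p ^ m) (p^2))" for m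
    using qbinomial_theorem[OF p2, of "v * p ^ m" a] p v norm_mult_power_less_1[of p v m]
    by (simp add: power_mult_distrib mult_ac flip: power_mult)
  show "(\<lambda>n. qpoch a (p^2) n / qpoch (p^2) (p^2) n * v ^ n * (qpoch_inf (d * g * p ^ n) p / qpoch_inf (g * p ^ n) p))
           sums (\<Sum>m. qpoch d p m / qpoch p p m * g ^ m * (qpoch_inf (a * v * p ^ m) (p^2) / qpoch_inf (v * p ^ m) (p^2)))"
    and "summable (\<lambda>m. norm (qpoch d p m / qpoch p p m * g ^ m * (qpoch_inf (a * v * p ^ m) (p^2) / qpoch_inf (v * p ^ m) (p^2))))"
    using sums_swap_kernel[OF summable_qbinomial[OF p2 v, of a] summable_qbinomial[OF p g, of d] norm_power_le_1[OF p] F G]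
    by simp_all
qed

lemma sums_even_part:
  fixes c :: "nat \<Rightarrow> complex"
  assumes "(\<lambda>m. c m * x ^ m) sums s" "(\<lambda>m. c m * (- x) ^ m) sums t"
  shows "(\<lambda>n. c (2 * n) * x ^ (2 * n)) sums ((s + t) / 2)"
proof -
  have "(\<lambda>m. (c m * x ^ m + c m * (- x) ^ m) / 2) sums ((s + t) / 2)"
    by (intro sums_divide sums_add assms)
  hence "(\<lambda>n. (c (2 * n) * x ^ (2 * n) + c (2 * n) * (- x) ^ (2 * n)) / 2) sums ((s + t) / 2)"
  proof (subst (asm) sums_mono_reindex[of "\<lambda>n. 2 * n", symmetric])
    fix n :: nat assume "n \<notin> range (\<lambda>n. 2 * n)"
    hence "odd n" by (metis evenE rangeI)
    thus "(c n * x ^ n + c n * (- x) ^ n) / 2 = 0" by simp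
  qed (auto simp: strict_mono_def)
  thus ?thesis by simp
qed

lemma sums_odd_part:
  fixes c :: "nat \<Rightarrow> complex"
  assumes "(\<lambda>m. c m * x ^ m) sums s" "(\<lambda>m. c m * (- x) ^ m) sums t"
  shows "(\<lambda>n. c (Suc (2 * n)) * x ^ Suc (2 * n)) sums ((s - t) / 2)"
proof -
  have "(\<lambda>m. (c m * x ^ m - c m * (- x) ^ m) / 2) sums ((s - t) / 2)"
    by (intro sums_divide sums_diff assms)
  hence "(\<lambda>n. (c (Suc (2 * n)) * x ^ (Suc (2 * n)) - c (Suc (2 * n)) * (- x) ^ (Suc (2 * n))) / 2) sums ((s - t) / 2)"
  proof (subst (asm) sums_mono_reindex[of "\<lambda>n. Suc (2 * n)", symmetric])
    fix n :: nat assume "n \<notin> range (\<lambda>n. Suc (2 * n))"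
    hence "even n" by (metis oddE rangeI Suc_eq_plus1)
    thus "(c n * x ^ n - c n * (- x) ^ n) / 2 = 0" by simp
  qed (auto simp: strict_mono_def)
  thus ?thesis by (simp add: mult_ac)
qed

text \<open>This is \<open>quadratic_base_swap\<close> in base \<open>q ^ 2\<close> with
  \<open>a = u ^ 2\<close> and \<open>d = 1 / q\<close>. In (u^2; q^4)_n = (u, -u; q^2)_n the
  quotient of infinite products trades (-u; q^2)_n for (-uq; q^2)_n, and (u, -uq; q^2)_n is
  \<open>qpoch u (- q) (2 * n)\<close>.\<close>

lemma quadratic_sum_first:
  assumes q: "norm q < 1" "q \<noteq> 0" and u: "norm u < 1"
  defines "c \<equiv> (\<lambda>m. qpoch (1 / q) (q^2) m / qpoch (q^2) (q^2) m *
     (qpoch_inf (u^4 * (q^2) ^ m) (q^4) / qpoch_inf (u^2 * (q^2) ^ m) (q^4)))"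
  shows "(\<lambda>m. c m * (- (q * u)) ^ m) sums
           (qpoch_inf (- u) (q^2) / qpoch_inf (- (u * q)) (q^2) *
            (\<Sum>n. qpoch u (- q) (2 * n) / qpoch (q^4) (q^4) n * u ^ (2 * n)))"
    (is "_ sums (?r * ?S)")
    and "summable (\<lambda>n. qpoch u (- q) (2 * n) / qpoch (q^4) (q^4) n * u ^ (2 * n))"
proof -
  have q2: "norm (q^2) < 1" using q(1) by (rule power_less_1_norm) simp
  have u2: "norm (u^2) < 1" using u by (rule power_less_1_norm) simp
  have g: "norm (- (u * q)) < 1" using norm_mult_less[OF u q(1)] by simp
  have mu: "norm (- u) < 1" using u by simp
  have q4: "(q^2)^2 = q^4" by (simp flip: power_mult)
  have eq: "1 / q * (- (u * q)) = - u" "1 / q * (- (q * u)) = - u" "u^2 * u^2 = u^4" "- (u * q) = - (q * u)"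
    using q(2) by (simp_all add: field_simps flip: power_add)
  note sw = quadratic_base_swap[OF q2 u2 g, where a = "u^2" and d = "1 / q", unfolded q4, unfolded eq]
  have C: "(\<lambda>m. c m * (- (q * u)) ^ m) sums
     (\<Sum>m. qpoch (1 / q) (q^2) m / qpoch (q^2) (q^2) m * (- (q * u)) ^ m *
        (qpoch_inf (u^4 * (q^2) ^ m) (q^4) / qpoch_inf (u^2 * (q^2) ^ m) (q^4)))"
    using summable_sums[OF summable_norm_cancel[OF sw(2)]] by (simp add: c_def mult_ac)
  have "?r * (qpoch u (- q) (2 * n) / qpoch (q^4) (q^4) n * u ^ (2 * n)) =
     qpoch (u^2) (q^4) n / qpoch (q^4) (q^4) n * (u^2) ^ n * (qpoch_inf (- u * (q^2) ^ n) (q^2) / qpoch_inf (- (q * u) * (q^2) ^ n) (q^2))" for n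
  proof -
    have 1: "qpoch u (- q) (2 * n) = qpoch u (q^2) n * qpoch (- (u * q)) (q^2) n"
      using qpoch_base2[of u "- q" n] by simp
    have 2: "qpoch (u^2) (q^4) n = qpoch u (q^2) n * qpoch (- u) (q^2) n"
      using qpoch_minus_mult[of u "q^2" n] by (simp flip: power_mult)
    show ?thesis
      unfolding 1 2 eq(4)
      using qpoch_inf_split[OF q2, of "- u" n] qpoch_inf_split[OF q2, of "- (q * u)" n]
        qpoch_inf_nonzero'[OF q2 g] qpoch_inf_shift_nonzero[OF q2 mult_power_neq_1[OF q2 g], of n]
      unfolding eq(4)
      by (simp add: divide_simps power_mult)
  qed
  with sw(1) have S: "(\<lambda>n. ?r * (qpoch u (- q) (2 * n) / qpoch (q^4) (q^4) n * u ^ (2 * n))) sums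
     (\<Sum>m. qpoch (1 / q) (q^2) m / qpoch (q^2) (q^2) m * (- (q * u)) ^ m *
        (qpoch_inf (u^4 * (q^2) ^ m) (q^4) / qpoch_inf (u^2 * (q^2) ^ m) (q^4)))" (is "_ sums ?C")
    by simp
  have r0: "?r \<noteq> 0" using qpoch_inf_nonzero'[OF q2 g] qpoch_inf_nonzero'[OF q2 mu] by simp
  have "(\<lambda>n. qpoch u (- q) (2 * n) / qpoch (q^4) (q^4) n * u ^ (2 * n)) sums (?C / ?r)"
    using sums_divide[OF S, of ?r] r0 by simp
  moreover from this have "?r * ?S = ?C" using r0 by (simp add: sums_iff)
  ultimately show "(\<lambda>m. c m * (- (q * u)) ^ m) sums (?r * ?S)"
    "summable (\<lambda>n. qpoch u (- q) (2 * n) / qpoch (q^4) (q^4) n * u ^ (2 * n))"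
    using C by (simp_all only: sums_iff)
qed

text \<open>Companion expansion with \<open>a = u ^ 2 * q ^ 2\<close> and \<open>d = q\<close>: now
  (uq; q^2)_n is traded for (u; q^2)_n.\<close>

lemma quadratic_sum_second:
  assumes q: "norm q < 1" "q \<noteq> 0" and u: "norm u < 1"
  defines "c \<equiv> (\<lambda>m. qpoch q (q^2) m / qpoch (q^2) (q^2) m *
     (qpoch_inf (u^4 * q^2 * (q^2) ^ m) (q^4) / qpoch_inf (u^2 * (q^2) ^ m) (q^4)))"
  shows "(\<lambda>m. c m * u ^ m) sums
           (qpoch_inf (u * q) (q^2) / qpoch_inf u (q^2) *
            (\<Sum>n. qpoch u (- q) (2 * n) / qpoch (q^4) (q^4) n * u ^ (2 * n)))"
    (is "_ sums (?r * ?S)")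
proof -
  have q2: "norm (q^2) < 1" using q(1) by (rule power_less_1_norm) simp
  have u2: "norm (u^2) < 1" using u by (rule power_less_1_norm) simp
  have g: "norm (u * q) < 1" using norm_mult_less[OF u q(1)] by simp
  have q4: "(q^2)^2 = q^4" by (simp flip: power_mult)
  have eq: "q * u = u * q" "u^2 * q^2 * u^2 = u^4 * q^2"
    by (simp_all add: mult_ac flip: power_add)
  note sw = quadratic_base_swap[OF q2 u2 u, where a = "u^2 * q^2" and d = q, unfolded q4, unfolded eq]
  have C: "(\<lambda>m. c m * u ^ m) sums
     (\<Sum>m. qpoch q (q^2) m / qpoch (q^2) (q^2) m * u ^ m *
        (qpoch_inf (u^4 * q^2 * (q^2) ^ m) (q^4) / qpoch_inf (u^2 * (q^2) ^ m) (q^4)))"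
    using summable_sums[OF summable_norm_cancel[OF sw(2)]] by (simp add: c_def mult_ac)
  have "?r * (qpoch u (- q) (2 * n) / qpoch (q^4) (q^4) n * u ^ (2 * n)) =
     qpoch (u^2 * q^2) (q^4) n / qpoch (q^4) (q^4) n * (u^2) ^ n * (qpoch_inf (u * q * (q^2) ^ n) (q^2) / qpoch_inf (u * (q^2) ^ n) (q^2))" for n
  proof -
    have 1: "qpoch u (- q) (2 * n) = qpoch u (q^2) n * qpoch (- (u * q)) (q^2) n"
      using qpoch_base2[of u "- q" n] by simp
    have 2: "qpoch (u^2 * q^2) (q^4) n = qpoch (u * q) (q^2) n * qpoch (- (u * q)) (q^2) n"
      using qpoch_minus_mult[of "u * q" "q^2" n] by (simp add: power_mult_distrib flip: power_mult)
    show ?thesis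
      unfolding 1 2
      using qpoch_inf_split[OF q2, of u n] qpoch_inf_split[OF q2, of "u * q" n]
        qpoch_inf_nonzero'[OF q2 u] qpoch_inf_shift_nonzero[OF q2 mult_power_neq_1[OF q2 u], of n]
      by (simp add: divide_simps power_mult)
  qed
  with sw(1) have S: "(\<lambda>n. ?r * (qpoch u (- q) (2 * n) / qpoch (q^4) (q^4) n * u ^ (2 * n))) sums
     (\<Sum>m. qpoch q (q^2) m / qpoch (q^2) (q^2) m * u ^ m *
        (qpoch_inf (u^4 * q^2 * (q^2) ^ m) (q^4) / qpoch_inf (u^2 * (q^2) ^ m) (q^4)))" (is "_ sums ?C")
    by simp
  have r0: "?r \<noteq> 0" using qpoch_inf_nonzero'[OF q2 g] qpoch_inf_nonzero'[OF q2 u] by simp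
  have "(\<lambda>n. qpoch u (- q) (2 * n) / qpoch (q^4) (q^4) n * u ^ (2 * n)) sums (?C / ?r)"
    using sums_divide[OF S, of ?r] r0 by simp
  hence "?r * ?S = ?C" using r0 by (simp add: sums_iff)
  with C show "(\<lambda>m. c m * u ^ m) sums (?r * ?S)" by simp
qed

text \<open>
  The sum has two expansions in powers of $u$ whose coefficients depend on $u^2$ only. Comparing both
  at $u$ and $-u$ recovers the sum from the even part of the first expansion and the odd part of the
  second, and for $u^2 = \omega^2 q$ these two parts are instances of the cubic summation.
\<close>

theorem quadratic_sum:
  assumes q: "norm q < 1" "q \<noteq> 0" and w: "w^2 + w + 1 = (0::complex)" "norm w = 1" and uw: "u^2 = w^2 * q"
  shows "(\<lambda>n. qpoch u (- q) (2 * n) / qpoch (q^4) (q^4) n * u ^ (2 * n)) sums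
    ((qpoch_inf (- (u * q)) (q^2) / qpoch_inf (- u) (q^2) * (qpoch_inf (q^3) (q^12) * qpoch_inf (q^7) (q^12))
      + u * (qpoch_inf u (q^2) / qpoch_inf (u * q) (q^2)) * (qpoch_inf q (q^12) * qpoch_inf (q^9) (q^12)))
     / (qpoch_inf (q^4) (q^12) * qpoch_inf (q^2) (q^4) * qpoch_inf (w^2 * q) (q^2)))"
proof -
  have w3: "w^2 * w^2 = w" "w \<noteq> 0" using w(1) by (algebra, auto)
  have nu: "norm u < 1"
  proof -
    have "norm (u^2) < 1" unfolding uw using q(1) w(2) by (simp add: norm_mult norm_power)
    hence "norm u ^ 2 < 1" by (simp add: norm_power)
    thus ?thesis by (simp add: power_less_one_iff)
  qed
  have u4: "u^4 = w * q^2"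
  proof -
    have "u^4 = (u^2)^2" by (simp flip: power_mult)
    also have "\<dots> = w * q^2" unfolding uw using w3(1) by (simp add: power2_eq_square mult_ac)
    finally show ?thesis .
  qed
  have q2: "norm (q^2) < 1" and q4: "norm (q^4) < 1" and q12: "norm (q^12) < 1" and q3: "norm (q^3) < 1"
    using q(1) by (auto intro: power_less_1_norm simp del: norm_power)
  have q40: "q^4 \<noteq> 0" using q by simp
  have neq1: "q ^ n \<noteq> 1" if "n > 0" for n
    using power_less_1_norm[OF q(1) that] by auto
  define S where "S = (\<lambda>u. \<Sum>n. qpoch u (- q) (2 * n) / qpoch (q^4) (q^4) n * u ^ (2 * n))"
  define r where "r = (\<lambda>u. qpoch_inf (- u) (q^2) / qpoch_inf (- (u * q)) (q^2))"
  define X where "X = (\<lambda>m. qpoch (1 / q) (q^2) m / qpoch (q^2) (q^2) m *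
     (qpoch_inf (u^4 * (q^2) ^ m) (q^4) / qpoch_inf (u^2 * (q^2) ^ m) (q^4)))"
  define Y where "Y = (\<lambda>m. qpoch q (q^2) m / qpoch (q^2) (q^2) m *
     (qpoch_inf (u^4 * q^2 * (q^2) ^ m) (q^4) / qpoch_inf (u^2 * (q^2) ^ m) (q^4)))"
  have nu': "norm (- u) < 1" using nu by simp
  have X1: "(\<lambda>m. X m * (- (q * u)) ^ m) sums (r u * S u)" "(\<lambda>m. X m * (- (- (q * u))) ^ m) sums (r (- u) * S (- u))"
    using quadratic_sum_first(1)[OF q nu] quadratic_sum_first(1)[OF q nu']
    unfolding X_def r_def S_def by simp_all
  have Y1: "(\<lambda>m. Y m * u ^ m) sums (1 / r (- u) * S u)" "(\<lambda>m. Y m * (- u) ^ m) sums (1 / r u * S (- u))"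
    using quadratic_sum_second[OF q nu] quadratic_sum_second[OF q nu']
    unfolding Y_def r_def S_def by simp_all
  have r0: "r u \<noteq> 0" "r (- u) \<noteq> 0"
    using qpoch_inf_nonzero'[OF q2 nu] qpoch_inf_nonzero'[OF q2 nu']
      qpoch_inf_nonzero'[OF q2, of "u * q"] qpoch_inf_nonzero'[OF q2, of "- (u * q)"] norm_mult_less[OF nu q(1)]
    by (auto simp: r_def)
  define XE where "XE = qpoch_inf (q^3) (q^12) * qpoch_inf (q^7) (q^12) /
     (qpoch_inf (q^4) (q^12) * qpoch_inf (q^2) (q^4) * qpoch_inf (w^2 * q) (q^4) * qpoch_inf (w^2 * q^3) (q^4))"
  define YO where "YO = u * (qpoch_inf q (q^12) * qpoch_inf (q^9) (q^12)) /
     (qpoch_inf (q^4) (q^12) * qpoch_inf (q^2) (q^4) * qpoch_inf (w^2 * q) (q^4) * qpoch_inf (w^2 * q^3) (q^4))"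
  have P3: "(q^4)^3 = q^12" "(q^2)^2 = q^4" "(q^4)^2 = q^8" "(q^3)^2 = q^6" "(q^3)^3 = q^9" by (simp_all flip: power_mult)
  \<comment> \<open>Even part: \<open>cubic_summation\<close> in base \<open>q ^ 4\<close> with
    \<open>be = q\<close>, \<open>t = q ^ 3\<close> and \<open>la = 1 / q\<close>, so
    \<open>la\<close> lies outside the unit disc.\<close>
  have "(\<lambda>n. X (2 * n) * (- (q * u)) ^ (2 * n)) sums XE"
  proof -
    have la: "1 / q * q^4 = q^3" "1 / q * q^8 = q^7" using q(2) by (simp_all add: eval_nat_numeral)
    have la': "1 / q * (q^4) ^ n \<noteq> 1" for n
    proof (cases n)
      case (Suc k)
      have "q^4 = q * q^3" by (simp flip: power_Suc)
      hence "1 / q * (q^4) ^ n = q^3 * (q^4) ^ k"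
        using q(2) unfolding Suc power_Suc[of "q^4"] by simp
      also have "\<dots> = q ^ (4 * k + 3)"
        unfolding power_add power_mult by simp
      finally have "1 / q * (q^4) ^ n = q ^ (4 * k + 3)" .
      thus ?thesis using neq1[of "4 * k + 3"] by simp
    qed (use neq1[of 1] q(2) in auto)
    have "(\<lambda>n. qpoch (1 / q) (q^4) n * qpoch q (q^4) n / (qpoch (q^4) (q^4) n * qpoch (q^2) (q^4) n) * (q^3 * w^2) ^ n *
            (qpoch_inf (q^2 * w * (q^4) ^ n) (q^4) / qpoch_inf (q * w^2 * (q^4) ^ n) (q^4)))
      sums (qpoch_inf (q^3) (q^12) * qpoch_inf (q^7) (q^12) /
        (qpoch_inf (q^4) (q^12) * qpoch_inf (q^2) (q^4) * qpoch_inf (q * w^2) (q^4) * qpoch_inf (q^3 * w^2) (q^4)))"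
      using cubic_summation[OF q4 q40 w q(1) q3 _ _ la', unfolded la P3] by (simp flip: power_Suc2)
    also have "(\<lambda>n. qpoch (1 / q) (q^4) n * qpoch q (q^4) n / (qpoch (q^4) (q^4) n * qpoch (q^2) (q^4) n) * (q^3 * w^2) ^ n *
            (qpoch_inf (q^2 * w * (q^4) ^ n) (q^4) / qpoch_inf (q * w^2 * (q^4) ^ n) (q^4)))
       = (\<lambda>n. X (2 * n) * (- (q * u)) ^ (2 * n))"
    proof
      fix n
      have 1: "qpoch (1 / q) (q^2) (2 * n) = qpoch (1 / q) (q^4) n * qpoch q (q^4) n"
        using qpoch_base2[of "1 / q" "q^2" n] q(2) unfolding P3 by (simp add: power2_eq_square)
      have 2: "qpoch (q^2) (q^2) (2 * n) = qpoch (q^2) (q^4) n * qpoch (q^4) (q^4) n"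
        using qpoch_base2[of "q^2" "q^2" n] unfolding P3 by (simp flip: power_add)
      have 3: "(- (q * u)) ^ (2 * n) = (q^3 * w^2) ^ n"
      proof -
        have "(- (q * u)) ^ (2 * n) = (q^2 * u^2) ^ n" by (simp add: power_mult power_mult_distrib)
        also have "q^2 * u^2 = q^3 * w^2" unfolding uw by (simp add: eval_nat_numeral)
        finally show ?thesis .
      qed
      have 4: "(q^2) ^ (2 * n) = (q^4) ^ n" by (simp flip: power_mult)
      show "qpoch (1 / q) (q^4) n * qpoch q (q^4) n / (qpoch (q^4) (q^4) n * qpoch (q^2) (q^4) n) * (q^3 * w^2) ^ n *
            (qpoch_inf (q^2 * w * (q^4) ^ n) (q^4) / qpoch_inf (q * w^2 * (q^4) ^ n) (q^4)) = X (2 * n) * (- (q * u)) ^ (2 * n)"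
        unfolding X_def 1 2 3 4 uw u4 by (simp add: mult_ac)
    qed
    finally show ?thesis unfolding XE_def by (simp add: mult_ac)
  qed
  from sums_unique2[OF this sums_even_part[OF X1]] have XE: "XE = (r u * S u + r (- u) * S (- u)) / 2" .
  \<comment> \<open>Odd part: \<open>cubic_summation\<close> in base \<open>q ^ 4\<close> with
    \<open>be = q ^ 3\<close>, \<open>t = q\<close> and \<open>la = q ^ 5\<close>.\<close>
  have "(\<lambda>n. Y (Suc (2 * n)) * u ^ Suc (2 * n)) sums YO"
  proof -
    have la: "q^5 * q^4 = q^9" "q^5 * q^8 = q^13" by (simp_all flip: power_mult power_add)
    have la': "q^5 * (q^4) ^ n \<noteq> 1" for n
      using neq1[of "5 + 4 * n"] by (simp add: power_add power_mult)
    have "(\<lambda>n. qpoch (q^5) (q^4) n * qpoch (q^3) (q^4) n / (qpoch (q^4) (q^4) n * qpoch (q^6) (q^4) n) * (q * w^2) ^ n *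
            (qpoch_inf (q^6 * w * (q^4) ^ n) (q^4) / qpoch_inf (q^3 * w^2 * (q^4) ^ n) (q^4)))
      sums (qpoch_inf (q^9) (q^12) * qpoch_inf (q^13) (q^12) /
        (qpoch_inf (q^4) (q^12) * qpoch_inf (q^6) (q^4) * qpoch_inf (q^3 * w^2) (q^4) * qpoch_inf (q * w^2) (q^4)))"
      using cubic_summation[OF q4 q40 w q3 q(1) _ _ la', unfolded la P3] by (simp flip: power_Suc)
    \<comment> \<open>The scale is what the first odd term carries outside the infinite products,
      since \<open>(1 - q) / (1 - q ^ 2) = 1 / (1 + q)\<close>.\<close>
    from sums_mult[OF this, of "u / (1 + q)"]
    have *: "(\<lambda>n. u / (1 + q) * (qpoch (q^5) (q^4) n * qpoch (q^3) (q^4) n / (qpoch (q^4) (q^4) n * qpoch (q^6) (q^4) n) * (q * w^2) ^ n *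
            (qpoch_inf (q^6 * w * (q^4) ^ n) (q^4) / qpoch_inf (q^3 * w^2 * (q^4) ^ n) (q^4))))
       sums (u / (1 + q) * (qpoch_inf (q^9) (q^12) * qpoch_inf (q^13) (q^12) /
        (qpoch_inf (q^4) (q^12) * qpoch_inf (q^6) (q^4) * qpoch_inf (q^3 * w^2) (q^4) * qpoch_inf (q * w^2) (q^4))))" .
    have q1: "1 - q \<noteq> 0" "1 + q \<noteq> 0" "1 - q^2 = (1 - q) * (1 + q)" "1 - q^2 \<noteq> 0"
      using neq1[of 1] neq1[of 2] by (auto simp: algebra_simps power2_eq_square add_eq_0_iff)
    have e1: "qpoch_inf q (q^12) = (1 - q) * qpoch_inf (q^13) (q^12)"
      using qpoch_inf_Suc[OF q12, of q] by (simp flip: power_Suc)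
    have e2: "qpoch_inf (q^2) (q^4) = (1 - q^2) * qpoch_inf (q^6) (q^4)"
      using qpoch_inf_Suc[OF q4, of "q^2"] by (simp flip: power_add)
    have val: "u / (1 + q) * (qpoch_inf (q^9) (q^12) * qpoch_inf (q^13) (q^12) /
        (qpoch_inf (q^4) (q^12) * qpoch_inf (q^6) (q^4) * qpoch_inf (q^3 * w^2) (q^4) * qpoch_inf (q * w^2) (q^4))) = YO"
      unfolding YO_def e1 e2 q1(3) using q1(1,2) by (simp add: mult_ac)
    have "(\<lambda>n. u / (1 + q) * (qpoch (q^5) (q^4) n * qpoch (q^3) (q^4) n / (qpoch (q^4) (q^4) n * qpoch (q^6) (q^4) n) * (q * w^2) ^ n *
            (qpoch_inf (q^6 * w * (q^4) ^ n) (q^4) / qpoch_inf (q^3 * w^2 * (q^4) ^ n) (q^4)))) = (\<lambda>n. Y (Suc (2 * n)) * u ^ Suc (2 * n))"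
    proof
      fix n
      have 1: "qpoch q (q^2) (Suc (2 * n)) = (1 - q) * (qpoch (q^3) (q^4) n * qpoch (q^5) (q^4) n)"
        using qpoch_base2[of "q^3" "q^2" n] unfolding P3 qpoch_Suc' by (simp flip: power_add power_Suc)
      have 2: "qpoch (q^2) (q^2) (Suc (2 * n)) = (1 - q) * (1 + q) * (qpoch (q^4) (q^4) n * qpoch (q^6) (q^4) n)"
        using qpoch_base2[of "q^4" "q^2" n] unfolding P3 qpoch_Suc' q1(3)[symmetric] by (simp flip: power_add power_Suc)
      have 3: "u ^ Suc (2 * n) = u * (q * w^2) ^ n"
        unfolding power_Suc power_mult uw by (simp add: mult.commute)
      have 4: "u^4 * q^2 * (q^2) ^ Suc (2 * n) = q^6 * w * (q^4) ^ n" 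
        unfolding u4 power_Suc power_mult P3 by (simp add: mult_ac flip: power_add)
      have 5: "u^2 * (q^2) ^ Suc (2 * n) = q^3 * w^2 * (q^4) ^ n" 
        unfolding uw power_Suc power_mult P3 by (simp add: power2_eq_square power3_eq_cube mult_ac)
      show "u / (1 + q) * (qpoch (q^5) (q^4) n * qpoch (q^3) (q^4) n / (qpoch (q^4) (q^4) n * qpoch (q^6) (q^4) n) * (q * w^2) ^ n *
            (qpoch_inf (q^6 * w * (q^4) ^ n) (q^4) / qpoch_inf (q^3 * w^2 * (q^4) ^ n) (q^4))) = Y (Suc (2 * n)) * u ^ Suc (2 * n)"
        unfolding Y_def 1 2 3 4 5 using q1(1,2) by (simp add: mult_ac)
    qed
    with * show ?thesis unfolding val by simp
  qed
  from sums_unique2[OF this sums_odd_part[OF Y1]] have YO: "YO = (1 / r (- u) * S u - 1 / r u * S (- u)) / 2" .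
  \<comment> \<open>Two linear equations in \<open>S u\<close> and \<open>S (- u)\<close>; the
    weights \<open>1 / r u\<close> and \<open>r (- u)\<close> eliminate
    \<open>S (- u)\<close>.\<close>
  have "S u = XE / r u + r (- u) * YO"
    unfolding XE YO using r0 by (simp add: field_simps)
  moreover have "XE / r u + r (- u) * YO = 
    (qpoch_inf (- (u * q)) (q^2) / qpoch_inf (- u) (q^2) * (qpoch_inf (q^3) (q^12) * qpoch_inf (q^7) (q^12))
      + u * (qpoch_inf u (q^2) / qpoch_inf (u * q) (q^2)) * (qpoch_inf q (q^12) * qpoch_inf (q^9) (q^12)))
     / (qpoch_inf (q^4) (q^12) * qpoch_inf (q^2) (q^4) * qpoch_inf (w^2 * q) (q^2))"
  proof -
    have e: "qpoch_inf (w^2 * q) (q^2) = qpoch_inf (w^2 * q) (q^4) * qpoch_inf (w^2 * q^3) (q^4)"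
      using qpoch_inf_base2[OF q2, of "w^2 * q"] unfolding P3 by (simp add: eval_nat_numeral mult_ac)
    show ?thesis unfolding e XE_def YO_def r_def by (simp add: add_divide_distrib mult_ac)
  qed
  ultimately show ?thesis
    using summable_sums[OF quadratic_sum_first(2)[OF q nu]] unfolding S_def by simp
qed

section \<open>Theta functions\<close>

lemma summable_gaussian:
  fixes p z :: complex
  assumes p: "norm p < 1"
  shows "summable (\<lambda>n. norm (p ^ (n choose 2) * z ^ n))"
proof -
  obtain K where K: "\<And>n. norm (qpoch p p n) \<le> K"
    using Bseq_qpoch[OF p, of p] by (auto simp: Bseq_def)
  show ?thesis
  proof (rule summable_comparison_test'[OF summable_mult[OF summable_euler[OF p, of z], of K], of 0])
    fix n
    have "p ^ (n choose 2) * z ^ n = qpoch p p n * (p ^ (n choose 2) / qpoch p p n * z ^ n)"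
      using qpoch_nonzero'[OF p p, of n] by simp
    hence "norm (p ^ (n choose 2) * z ^ n) = norm (qpoch p p n) * norm (p ^ (n choose 2) / qpoch p p n * z ^ n)"
      by (metis norm_mult)
    thus "norm (norm (p ^ (n choose 2) * z ^ n)) \<le> K * norm (p ^ (n choose 2) / qpoch p p n * z ^ n)"
      using mult_right_mono[OF K[of n], of "norm (p ^ (n choose 2) / qpoch p p n * z ^ n)"] by simp
  qed
qed

text \<open>Extension of \<open>n choose 2\<close> to negative indices, for example
  \<open>tri (- 1) = 1\<close>, as the exponents of the bilateral theta series require.\<close>

definition tri :: "int \<Rightarrow> int" where "tri n = n * (n - 1) div 2"

lemma two_tri: "2 * tri n = n * (n - 1)"
  by (simp add: tri_def)

lemma tri_add: "tri (k + m) = tri k + tri m + k * m"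
proof -
  have "2 * tri (k + m) = 2 * (tri k + tri m + k * m)"
    unfolding distrib_left two_tri by (simp add: algebra_simps)
  thus ?thesis by simp
qed

lemma tri_of_nat: "tri (int n) = int (n choose 2)"
proof (induction n)
  case (Suc n)
  have "tri (int (Suc n)) = tri (int n) + tri 1 + int n"
    using tri_add[of "int n" 1] by (simp add: add.commute)
  thus ?case using Suc by (simp add: numeral_2_eq_2 tri_def)
qed (simp add: tri_def)

lemma tri_uminus: "tri (- n) = tri n + n"
proof -
  have "2 * tri (- n) = 2 * (tri n + n)"
    unfolding distrib_left two_tri by (simp add: algebra_simps)
  thus ?thesis by simp
qed

lemma tri_double: "tri (2 * n) = 4 * tri n + n" "tri (2 * n + 1) = 4 * tri n + 3 * n"
proof -
  have "2 * tri (2 * n) = 2 * (4 * tri n + n)" "2 * tri (2 * n + 1) = 2 * (4 * tri n + 3 * n)"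
    using two_tri[of n] two_tri[of "2 * n"] two_tri[of "2 * n + 1"] by (simp_all add: algebra_simps)
  thus "tri (2 * n) = 4 * tri n + n" "tri (2 * n + 1) = 4 * tri n + 3 * n" by simp_all
qed

lemma summable_theta:
  fixes q y :: complex
  assumes q: "norm q < 1" "q \<noteq> 0" and y: "y \<noteq> 0"
  shows "(\<lambda>n. q powi tri n * y powi n) summable_on UNIV"
proof -
  let ?f = "\<lambda>n. q powi tri n * y powi n"
  have "(?f \<circ> int) summable_on UNIV"
    using summable_gaussian[OF q(1), of y]
    by (simp add: norm_summable_iff_summable_on o_def tri_of_nat)
  hence 1: "?f summable_on range int"
    by (subst summable_on_reindex) auto
  have "?f \<circ> (\<lambda>n. - int n) = (\<lambda>n. q ^ (n choose 2) * (q / y) ^ n)"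
    using q(2) y
    by (auto simp: tri_uminus tri_of_nat power_int_add power_int_minus power_divide field_simps)
  hence "(?f \<circ> (\<lambda>n. - int n)) summable_on UNIV"
    using summable_gaussian[OF q(1), of "q / y"] by (simp add: norm_summable_iff_summable_on)
  hence 2: "?f summable_on range (\<lambda>n. - int n)"
    by (subst summable_on_reindex) (auto simp: inj_on_def)
  have "UNIV = range int \<union> range (\<lambda>n. - int n)"
  proof (intro set_eqI iffI)
    fix n :: int
    show "n \<in> range int \<union> range (\<lambda>n. - int n)"
      by (cases n rule: int_cases2) auto
  qed auto
  thus ?thesis using summable_on_union[OF 1 2] by simp
qed

lemma has_sum_euler:
  assumes p: "norm p < 1"
  shows "((\<lambda>n. p ^ (n choose 2) / qpoch p p n * z ^ n) has_sum qpoch_inf (- z) p) UNIV"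
  by (rule sums_imp_has_sum[OF euler_qpoch_inf[OF p] summable_euler[OF p]])

definition jtheta :: "complex \<Rightarrow> complex \<Rightarrow> complex" where
  "jtheta y q = qpoch_inf y q * qpoch_inf (q / y) q * qpoch_inf q q"

text \<open>The bilateral series is multiplied by 1/(q/y; q)_inf, expanded as a q-binomial series;
  this uses \<open>norm q < norm y\<close>. Regrouped by \<open>k = n - m\<close>, the sum over
  \<open>m\<close> is Euler's series for (q^(k+1); q)_inf, which vanishes for negative
  \<open>k\<close>. What remains is Euler's series for (y; q)_inf.\<close>

theorem jacobi_triple_product:
  assumes q: "norm q < 1" "q \<noteq> 0" and y: "y \<noteq> 0" "norm q < norm y"
  shows "((\<lambda>n. q powi tri n * (- y) powi n) has_sum jtheta y q) UNIV"
proof -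
  have qy: "norm (q / y) < 1" using y by (simp add: norm_divide)
  define T where "T = (\<lambda>n. q powi tri n * (- y) powi n)"
  define B where "B = (\<lambda>m. (q / y) ^ m / qpoch q q m)"
  \<comment> \<open>The value of (q^(k+1); q)_inf; for negative \<open>k\<close> one of its factors
    is 1 - 1.\<close>
  define E where "E = (\<lambda>k::int. if k \<ge> 0 then qpoch_inf q q / qpoch q q (nat k) else 0)"
  obtain S where S: "(T has_sum S) UNIV"
    using summable_theta[OF q, of "- y"] y by (auto simp: summable_on_def T_def)
  have B: "(B has_sum (1 / qpoch_inf (q / y) q)) UNIV"
    using sums_imp_has_sum[OF qbinomial_theorem[OF q(1) qy, of 0] summable_qbinomial[OF q(1) qy]]
    by (simp add: B_def)
  have "(\<lambda>(n, m). T n * B m) summable_on UNIV \<times> UNIV"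
    by (intro summable_on_product has_sum_imp_summable[OF S] has_sum_imp_summable[OF B])
  then obtain R where R: "((\<lambda>(n, m). T n * B m) has_sum R) (UNIV \<times> UNIV)"
    by (auto simp: summable_on_def)
  have "((\<lambda>n. T n * (1 / qpoch_inf (q / y) q)) has_sum R) UNIV"
    using R by (rule has_sum_SigmaD) (simp only: prod.case, intro has_sum_cmult_right B)
  moreover have "((\<lambda>n. T n * (1 / qpoch_inf (q / y) q)) has_sum (S * (1 / qpoch_inf (q / y) q))) UNIV"
    by (intro has_sum_cmult_left S)
  ultimately have R1: "R = S * (1 / qpoch_inf (q / y) q)" by (rule has_sum_unique)
  have qsum: "((\<lambda>m. q ^ (m choose 2) / qpoch q q m * (- (q powi (k + 1))) ^ m) has_sum E k) UNIV" for k
  proof -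
    have "qpoch_inf (q powi (k + 1)) q = E k"
    proof (cases "k \<ge> 0")
      case True
      hence "q powi (k + 1) = q * q ^ nat k"
        using q(2) by (simp add: power_int_nonneg_exp nat_add_distrib)
      thus ?thesis using True qpoch_inf_split[OF q(1), of q "nat k"] qpoch_nonzero'[OF q(1) q(1), of "nat k"]
        by (simp add: E_def)
    next
      case False
      define j where "j = nat (- k - 1)"
      have k: "k + 1 = - int j" using False by (simp add: j_def)
      have "qpoch_inf (q powi (k + 1)) q = 0"
        using qpoch_inf_split[OF q(1), of "q powi (k + 1)" "Suc j"] q(2)
        by (simp add: qpoch_Suc k power_int_minus)
      thus ?thesis using False by (simp add: E_def)
    qed
    with has_sum_euler[OF q(1), of "- (q powi (k + 1))"] show ?thesis by simp
  qed
  have term_eq: "T (k + int m) * B m = T k * (q ^ (m choose 2) / qpoch q q m * (- (q powi (k + 1))) ^ m)" for k m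
  proof -
    have 1: "q powi tri (k + int m) = q powi tri k * q ^ (m choose 2) * (q powi k) ^ m"
      using q(2) by (simp add: tri_add tri_of_nat power_int_add power_int_mult)
    have 2: "(- y) powi (k + int m) = (- y) powi k * (- y) ^ m"
      using y by (simp add: power_int_add)
    have 3: "(- (q powi (k + 1))) ^ m = (q powi k) ^ m * (- q) ^ m"
      using q(2) by (simp add: power_int_add flip: power_mult_distrib)
    have 4: "(- y) ^ m * (q / y) ^ m = (- q) ^ m"
      using y by (simp flip: power_mult_distrib)
    have "T (k + int m) * B m = q powi tri k * (- y) powi k *
        (q ^ (m choose 2) / qpoch q q m * ((q powi k) ^ m * ((- y) ^ m * (q / y) ^ m)))"
      unfolding T_def B_def 1 2 by (simp add: mult_ac)
    thus ?thesis unfolding T_def 3 4 .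
  qed
  have "((\<lambda>(k, m). T (k + int m) * B m) has_sum R) (UNIV \<times> UNIV)"
    using R by (subst has_sum_reindex_bij_witness[where T = "UNIV \<times> UNIV" and h = "\<lambda>(n, m). T n * B m"
          and j = "\<lambda>(k, m). (k + int m, m)" and i = "\<lambda>(n, m). (n - int m, m)"]) auto
  hence "((\<lambda>k. T k * E k) has_sum R) UNIV"
    by (rule has_sum_SigmaD) (simp only: prod.case term_eq, intro has_sum_cmult_right qsum)
  hence "((\<lambda>k. T k * E k) has_sum R) (range int)"
  proof (subst has_sum_cong_neutral[where T = UNIV and g = "\<lambda>k. T k * E k"])
    fix k assume "k \<in> UNIV - range int"
    hence "k < 0" by (metis DiffD2 linorder_not_less range_eqI int_nat_eq)
    thus "T k * E k = 0" by (simp add: E_def)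
  qed auto
  hence "((\<lambda>n. T (int n) * E (int n)) has_sum R) UNIV"
    by (subst (asm) has_sum_reindex) (auto simp: o_def)
  moreover have "((\<lambda>n. qpoch_inf q q * (q ^ (n choose 2) / qpoch q q n * (- y) ^ n)) has_sum (qpoch_inf q q * qpoch_inf y q)) UNIV"
    using has_sum_cmult_right[OF has_sum_euler[OF q(1), of "- y"]] by simp
  moreover have "(\<lambda>n. T (int n) * E (int n)) = (\<lambda>n. qpoch_inf q q * (q ^ (n choose 2) / qpoch q q n * (- y) ^ n))"
    by (simp add: T_def E_def tri_of_nat fun_eq_iff)
  ultimately have R2: "R = qpoch_inf q q * qpoch_inf y q"
    using has_sum_unique by metis
  have "S = jtheta y q"
    using R1 R2 qpoch_inf_nonzero'[OF q(1) qy] by (simp add: jtheta_def field_simps)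
  with S show ?thesis by (simp add: T_def)
qed

text \<open>The triple product series is split into even and odd \<open>n\<close>; by
  \<open>tri_double\<close> each half is again a theta series, in base \<open>q ^ 4\<close>. The
  triple product for the half with \<open>q ^ 3 * y ^ 2\<close> needs
  \<open>norm q < norm y ^ 2\<close>.\<close>

theorem jtheta_dissect:
  assumes q: "norm q < 1" "q \<noteq> 0" and y: "y \<noteq> 0" "norm q < norm y" "norm q < norm y ^ 2"
  shows "jtheta y q = jtheta (- (q * y^2)) (q^4) - y * jtheta (- (q^3 * y^2)) (q^4)"
proof -
  have q4: "norm (q^4) < 1" "q^4 \<noteq> 0" using q by (auto intro: power_less_1_norm simp del: norm_power)
  have n1: "norm (q^4) < norm (- (q * y^2))"
  proof -
    have "norm (q^2) \<le> 1" using norm_power_le_1[OF q(1)] .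
    hence "norm q * norm (q^2) \<le> norm q * 1" by (intro mult_left_mono) auto
    hence "norm q * norm (q^2) < norm y ^ 2" using y(3) by linarith
    hence "norm q * (norm q * norm (q^2)) < norm q * norm y ^ 2"
      using q(2) by (intro mult_strict_left_mono) auto
    thus ?thesis by (simp add: norm_mult norm_power power4_eq_xxxx power2_eq_square mult.assoc)
  qed
  have n2: "norm (q^4) < norm (- (q^3 * y^2))"
  proof -
    have "norm (q^3) * norm q < norm (q^3) * norm y ^ 2"
      using y(3) q(2) by (intro mult_strict_left_mono) auto
    thus ?thesis by (simp add: norm_mult norm_power power4_eq_xxxx power3_eq_cube mult_ac)
  qed
  let ?T = "\<lambda>n. q powi tri n * (- y) powi n"
  have nz: "- (q * y^2) \<noteq> 0" "- (q^3 * y^2) \<noteq> 0" using q y by auto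
  have "((\<lambda>n. (q^4) powi tri n * (q * y^2) powi n) has_sum jtheta (- (q * y^2)) (q^4)) UNIV"
    using jacobi_triple_product[OF q4 nz(1) n1] by simp
  also have "(\<lambda>n. (q^4) powi tri n * (q * y^2) powi n) = ?T \<circ> (\<lambda>n. 2 * n)"
    using q y by (simp add: fun_eq_iff tri_double power_int_add power_int_mult_distrib power_int_mult)
  finally have 1: "(?T has_sum jtheta (- (q * y^2)) (q^4)) (range (\<lambda>n. 2 * n))"
    by (rule has_sum_reindex[THEN iffD2, rotated]) (simp add: inj_on_def)
  have "((\<lambda>n. - y * ((q^4) powi tri n * (q^3 * y^2) powi n)) has_sum - y * jtheta (- (q^3 * y^2)) (q^4)) UNIV"
    using jacobi_triple_product[OF q4 nz(2) n2] by (intro has_sum_cmult_right) simp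
  also have "(\<lambda>n. - y * ((q^4) powi tri n * (q^3 * y^2) powi n)) = ?T \<circ> (\<lambda>n. 2 * n + 1)"
    using q y by (simp add: fun_eq_iff tri_double power_int_add power_int_mult_distrib power_int_mult)
  finally have 2: "(?T has_sum - y * jtheta (- (q^3 * y^2)) (q^4)) (range (\<lambda>n. 2 * n + 1))"
    by (rule has_sum_reindex[THEN iffD2, rotated]) (simp add: inj_on_def)
  have "range (\<lambda>n. 2 * n) \<inter> range (\<lambda>n. 2 * n + 1) = ({} :: int set)"
    by (auto simp: image_iff) presburger
  from has_sum_Un_disjoint[OF 1 2 this]
  have "(?T has_sum (jtheta (- (q * y^2)) (q^4) - y * jtheta (- (q^3 * y^2)) (q^4))) (range (\<lambda>n. 2 * n) \<union> range (\<lambda>n. 2 * n + 1))"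
    by simp
  also have "range (\<lambda>n. 2 * n) \<union> range (\<lambda>n. 2 * n + 1) = (UNIV :: int set)"
    by (auto simp: image_iff) presburger
  finally show ?thesis
    using jacobi_triple_product[OF q y(1,2)] has_sum_unique by blast
qed

text \<open>The partial products converge uniformly on closed discs of radius \<open>r < 1\<close>,
  where \<open>f\<close> is bounded and the base has norm at most \<open>r ^ j\<close>. The
  unimodular \<open>c\<close> covers negative bases such as \<open>- (s ^ 6)\<close>.\<close>

lemma continuous_on_qpoch_inf:
  assumes f: "continuous_on (ball 0 1) f" and j: "j > 0" and c: "norm c = 1"
  shows "continuous_on (ball 0 1) (\<lambda>s. qpoch_inf (f s) (c * s ^ j))"
proof -
  have *: "continuous_on (cball 0 r) (\<lambda>s. qpoch_inf (f s) (c * s ^ j))" if r: "0 < r" "r < 1" for r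
  proof -
    have fr: "continuous_on (cball 0 r) f"
      using f by (rule continuous_on_subset) (use r in auto)
    obtain K where K: "\<And>s. s \<in> cball 0 r \<Longrightarrow> norm (f s) \<le> K"
      using compact_continuous_image[OF fr compact_cball] by (fastforce dest!: compact_imp_bounded simp: bounded_iff)
    have nle: "norm (c * s ^ j) \<le> r ^ j" if "s \<in> cball 0 r" for s
      using that c by (simp add: norm_mult norm_power power_mono)
    have rj: "r ^ j < 1" using r j by (simp add: power_less_one_iff)
    have "uniformly_convergent_on (cball 0 r) (\<lambda>N s. \<Prod>n<N. 1 - f s * (c * s ^ j) ^ n)"
    proof (rule uniformly_convergent_on_prod')
      show "continuous_on (cball 0 r) (\<lambda>s. 1 - f s * (c * s ^ j) ^ n)" for n
        by (intro continuous_intros fr)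
      have "uniformly_convergent_on (cball 0 r) (\<lambda>N s. \<Sum>n<N. norm (1 - f s * (c * s ^ j) ^ n - 1))"
      proof (rule Weierstrass_m_test')
        fix n s assume s: "s \<in> cball (0::complex) r"
        have "norm (f s * (c * s ^ j) ^ n) \<le> K * (r ^ j) ^ n"
          unfolding norm_mult[of "f s"] norm_power[of "c * s ^ j"]
          using K[OF s] nle[OF s] r by (intro mult_mono power_mono) (auto intro: order_trans[OF norm_ge_zero])
        thus "norm (norm (1 - f s * (c * s ^ j) ^ n - 1)) \<le> K * (r ^ j) ^ n" by simp
      next
        show "summable (\<lambda>n. K * (r ^ j) ^ n)"
          using rj r by (intro summable_mult summable_geometric) auto
      qed
      thus "uniformly_convergent_on (cball 0 r) (\<lambda>N s. \<Sum>n<N. norm (1 - f s * (c * s ^ j) ^ n - 1))" .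
    qed auto
    then obtain l where l: "uniform_limit (cball 0 r) (\<lambda>N s. \<Prod>n<N. 1 - f s * (c * s ^ j) ^ n) l sequentially"
      by (auto simp: uniformly_convergent_on_def)
    have cl: "continuous_on (cball 0 r) l"
      by (rule uniform_limit_theorem[OF _ l]) (auto intro!: always_eventually continuous_intros fr)
    have "l s = qpoch_inf (f s) (c * s ^ j)" if "s \<in> cball 0 r" for s
    proof (rule qpoch_inf_eqI[symmetric])
      show "norm (c * s ^ j) < 1" using nle[OF that] rj by simp
      show "qpoch (f s) (c * s ^ j) \<longlonglongrightarrow> l s"
        using tendsto_uniform_limitI[OF l that] by (simp add: qpoch_def[abs_def])
    qed
    thus ?thesis by (rule continuous_on_eq[OF cl])
  qed
  show ?thesis
  proof (subst continuous_on_eq_continuous_at, simp, intro ballI)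
    fix s :: complex assume "s \<in> ball 0 1"
    then obtain r where r: "norm s < r" "r < 1" using dense[of "norm s" 1] by auto
    hence r0: "0 < r" using norm_ge_zero[of s] by linarith
    show "isCont (\<lambda>s. qpoch_inf (f s) (c * s ^ j)) s"
      by (rule continuous_on_interior[OF *[OF r0 r(2)]]) (use r in \<open>auto simp: interior_cball\<close>)
  qed
qed

text \<open>This is the dissection of \<open>jtheta (- (w ^ 2)) (- q)\<close>. The leading factor is
  \<open>1 + w ^ 2 = - w\<close>, and the rest becomes free of \<open>w\<close> once the three
  cube-root products are completed. It evaluates the cross term in the product of two
  brackets.\<close>

lemma jtheta_dissect_cube_root:
  assumes q: "norm q < 1" "q \<noteq> 0" and w: "w^2 + w + 1 = (0::complex)" "norm w = 1"
  shows "w^2 * qpoch_inf (w^2 * q^3) (q^4) * qpoch_inf (w * q) (q^4) + w * qpoch_inf (w * q^3) (q^4) * qpoch_inf (w^2 * q) (q^4)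
       = - (qpoch_inf (q^3) (- (q^3)) * qpoch_inf (- q) (- q) / (qpoch_inf q (- q) * qpoch_inf (q^4) (q^4)))"
proof -
  have w3: "w^2 * w^2 = w" "w * w^2 = 1" using w(1) by (algebra, algebra)
  have w0: "w \<noteq> 0" using w by auto
  have mq: "norm (- q) < 1" "- q \<noteq> 0" using q by auto
  have q4: "norm (q^4) < 1" using q by (auto intro: power_less_1_norm simp del: norm_power)
  have div: "- q / (- (w^2)) = w * q" "q^4 / (w * q) = w^2 * q^3" "q^4 / (w * q^3) = w^2 * q"
    using w3 w0 q(2) by (simp_all add: field_simps eval_nat_numeral)
  have y: "- (w^2) \<noteq> 0" "norm (- q) < norm (- (w^2))" "norm (- q) < norm (- (w^2)) ^ 2"
    using w w0 q by (auto simp: norm_power)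
  have e: "- (- q * (- (w^2))^2) = w * q" "- ((- q)^3 * (- (w^2))^2) = w * q^3" "(- q)^4 = q^4"
    using w3 by (simp_all add: power2_eq_square power3_eq_cube mult_ac)
  have "jtheta (- (w^2)) (- q) = jtheta (w * q) (q^4) + w^2 * jtheta (w * q^3) (q^4)"
    using jtheta_dissect[OF mq y] unfolding e by simp
  moreover have "jtheta (- (w^2)) (- q) = - w * qpoch_inf (w^2 * q) (- q) * qpoch_inf (w * q) (- q) * qpoch_inf (- q) (- q)"
  proof -
    have "1 + w^2 = - w" using w(1) by algebra
    hence "qpoch_inf (- (w^2)) (- q) = - w * qpoch_inf (w^2 * q) (- q)"
      using qpoch_inf_Suc[OF mq(1), of "- (w^2)"] by simp
    thus ?thesis unfolding jtheta_def div by simp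
  qed
  ultimately have L: "jtheta (w * q) (q^4) + w^2 * jtheta (w * q^3) (q^4) =
      - w * qpoch_inf (w^2 * q) (- q) * qpoch_inf (w * q) (- q) * qpoch_inf (- q) (- q)"
    by simp
  have C: "qpoch_inf q (- q) * qpoch_inf (w * q) (- q) * qpoch_inf (w^2 * q) (- q) = qpoch_inf (q^3) (- (q^3))"
    using qpoch_inf_cube_roots[OF mq(1) w(1), of q] by simp
  have "qpoch_inf q (- q) \<noteq> 0" by (rule qpoch_inf_nonzero'[OF mq(1) q(1)])
  hence *: "jtheta (w * q) (q^4) + w^2 * jtheta (w * q^3) (q^4) =
      - w * qpoch_inf (q^3) (- (q^3)) * qpoch_inf (- q) (- q) / qpoch_inf q (- q)"
    unfolding L C[symmetric] by simp
  have "qpoch_inf (q^4) (q^4) \<noteq> 0" by (rule qpoch_inf_nonzero'[OF q4 q4])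
  have "(w^2 * qpoch_inf (w^2 * q^3) (q^4) * qpoch_inf (w * q) (q^4) + w * qpoch_inf (w * q^3) (q^4) * qpoch_inf (w^2 * q) (q^4)) * qpoch_inf (q^4) (q^4)
     = w^2 * (jtheta (w * q) (q^4) + w^2 * jtheta (w * q^3) (q^4))"
    unfolding jtheta_def div using w3(1) by (simp add: distrib_left distrib_right mult_ac) 
  also have "\<dots> = - (w * w^2) * (qpoch_inf (q^3) (- (q^3)) * qpoch_inf (- q) (- q) / qpoch_inf q (- q))"
    unfolding * by simp
  finally show ?thesis
    unfolding w3 nonzero_eq_divide_eq[OF \<open>qpoch_inf (q^4) (q^4) \<noteq> 0\<close>, symmetric] by simp
qed

text \<open>Every product is reduced to residue classes (q^k; q^12)_inf, 12 being a common multiple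
  of the exponents of all bases once \<open>- q\<close> and \<open>- (q ^ 3)\<close> are squared.
  Identities between products then become rational identities in the \<open>e k\<close>.\<close>

lemma qpoch_inf_base12:
  assumes q: "norm q < 1"
  defines "e \<equiv> (\<lambda>k. qpoch_inf (q ^ k) (q^12))"
  shows "qpoch_inf q (q^6) = e 1 * e 7" "qpoch_inf (q^5) (q^6) = e 5 * e 11" "qpoch_inf (q^3) (q^6) = e 3 * e 9"
    and "qpoch_inf (q^2) (q^4) = e 2 * e 6 * e 10" "qpoch_inf (q^3) (q^4) = e 3 * e 7 * e 11"
    and "qpoch_inf q (q^4) = e 1 * e 5 * e 9" "qpoch_inf (q^4) (q^4) = e 4 * e 8 * e 12"
    and "qpoch_inf (q^4) (q^6) = e 4 * e 10"
    and "qpoch_inf (- q) (- q) = e 2 * e 6 * e 10 * (e 2 * e 6 * e 10 * (e 4 * e 8 * e 12)) / (e 1 * e 5 * e 9 * (e 3 * e 7 * e 11))"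
    and "qpoch_inf (- (q^3)) (- (q^3)) = e 6 * e 6 * e 12 / (e 3 * e 9)"
    and "qpoch_inf (q^3) (- (q^3)) = e 3 * e 9 / e 6"
    and "qpoch_inf q (- q) = e 1 * e 5 * e 9 * (e 3 * e 7 * e 11) / (e 2 * e 6 * e 10)"
    and "\<And>k. k > 0 \<Longrightarrow> e k \<noteq> 0"
proof -
  have n: "norm (q ^ k) < 1" if "k > 0" for k using q that by (rule power_less_1_norm)
  have mq: "norm (- q) < 1" "norm (- (q^3)) < 1" using q n[of 3] by auto
  note b2 = qpoch_inf_base2[OF n] and b3 = qpoch_inf_base3[OF n]
  show nz: "e k \<noteq> 0" if "k > 0" for k
    unfolding e_def using n that by (intro qpoch_inf_nonzero') auto
  show 1: "qpoch_inf q (q^6) = e 1 * e 7" "qpoch_inf (q^5) (q^6) = e 5 * e 11" and 3: "qpoch_inf (q^3) (q^6) = e 3 * e 9"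
    and "qpoch_inf (q^4) (q^6) = e 4 * e 10"
    using b2[of 6 q] b2[of 6 "q^5"] b2[of 6 "q^3"] b2[of 6 "q^4"] unfolding e_def
    by (simp_all flip: power_mult power_add power_Suc)
  show 4: "qpoch_inf (q^2) (q^4) = e 2 * e 6 * e 10" and 5: "qpoch_inf (q^3) (q^4) = e 3 * e 7 * e 11"
    and 6: "qpoch_inf q (q^4) = e 1 * e 5 * e 9" and 7: "qpoch_inf (q^4) (q^4) = e 4 * e 8 * e 12"
    using b3[of 4 "q^2"] b3[of 4 "q^3"] b3[of 4 q] b3[of 4 "q^4"] unfolding e_def
    by (simp_all flip: power_mult power_add power_Suc)
  have q12: "qpoch_inf q (q^2) = e 1 * e 5 * e 9 * (e 3 * e 7 * e 11)"
    using b2[of 2 q] unfolding 5[symmetric] 6[symmetric] by (simp flip: power_mult power_Suc)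
  have q22: "qpoch_inf (q^2) (q^2) = e 2 * e 6 * e 10 * (e 4 * e 8 * e 12)"
    using b2[of 2 "q^2"] unfolding 4[symmetric] 7[symmetric] by (simp flip: power_mult power_add)
  have "qpoch_inf (- q) (- q) = qpoch_inf (- q) (q^2) * qpoch_inf (q^2) (q^2)"
    using qpoch_inf_base2[OF mq(1), of "- q"] by (simp add: power2_eq_square)
  moreover have "qpoch_inf q (q^2) * qpoch_inf (- q) (q^2) = qpoch_inf (q^2) (q^4)"
    using qpoch_inf_minus_mult[OF n[of 2], of q] by (simp flip: power_mult)
  ultimately show "qpoch_inf (- q) (- q) = e 2 * e 6 * e 10 * (e 2 * e 6 * e 10 * (e 4 * e 8 * e 12)) / (e 1 * e 5 * e 9 * (e 3 * e 7 * e 11))"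
    using nz unfolding q12 q22 4 by (simp add: field_simps)
  have q66: "qpoch_inf (q^6) (q^6) = e 6 * e 12"
    using b2[of 6 "q^6"] unfolding e_def by (simp flip: power_mult power_add)
  have "qpoch_inf (- (q^3)) (- (q^3)) = qpoch_inf (- (q^3)) (q^6) * qpoch_inf (q^6) (q^6)"
    using qpoch_inf_base2[OF mq(2), of "- (q^3)"] by (simp flip: power_mult power_add)
  moreover have "qpoch_inf (q^3) (q^6) * qpoch_inf (- (q^3)) (q^6) = e 6"
    using qpoch_inf_minus_mult[OF n[of 6], of "q^3"] by (simp add: e_def flip: power_mult)
  ultimately show "qpoch_inf (- (q^3)) (- (q^3)) = e 6 * e 6 * e 12 / (e 3 * e 9)"
    using nz unfolding q66 3 by (simp add: field_simps)
  have "qpoch_inf (q^3) (- (q^3)) = qpoch_inf (q^3) (q^6) * qpoch_inf (- (q^6)) (q^6)"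
    using qpoch_inf_base2[OF mq(2), of "q^3"] by (simp flip: power_mult power_add)
  moreover have "qpoch_inf (q^6) (q^6) * qpoch_inf (- (q^6)) (q^6) = e 12"
    using qpoch_inf_minus_mult[OF n[of 6], of "q^6"] by (simp add: e_def flip: power_mult)
  ultimately show "qpoch_inf (q^3) (- (q^3)) = e 3 * e 9 / e 6"
    using nz[of 6] nz[of 12] unfolding q66 3 by (simp add: field_simps)
  have "qpoch_inf q (- q) = qpoch_inf q (q^2) * qpoch_inf (- (q^2)) (q^2)"
    using qpoch_inf_base2[OF mq(1), of q] by (simp add: power2_eq_square)
  moreover have "qpoch_inf (- (q^2)) (q^2) * qpoch_inf (q^2) (q^4) = 1"
    using euler_odd_distinct[OF n[of 2]] by (simp flip: power_mult)
  ultimately show "qpoch_inf q (- q) = e 1 * e 5 * e 9 * (e 3 * e 7 * e 11) / (e 2 * e 6 * e 10)"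
    using nz unfolding q12 4 by (simp add: field_simps)
qed

text \<open>Numerator of the value in \<open>quadratic_sum\<close>; the B of the overview is
  \<open>bracket (w * s) q\<close> as a function of \<open>w\<close>.\<close>

definition bracket :: "complex \<Rightarrow> complex \<Rightarrow> complex" where
  "bracket u q = qpoch_inf (- (u * q)) (q^2) / qpoch_inf (- u) (q^2) * (qpoch_inf (q^3) (q^12) * qpoch_inf (q^7) (q^12))
      + u * (qpoch_inf u (q^2) / qpoch_inf (u * q) (q^2)) * (qpoch_inf q (q^12) * qpoch_inf (q^9) (q^12))"

text \<open>The multiplier is exactly the product of the two denominators of the bracket; clearing
  them leaves infinite products that involve \<open>u\<close> only through
  \<open>u ^ 2\<close>.\<close>

lemma bracket_mult:
  assumes q: "norm q < 1" and u: "norm u < 1"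
  shows "bracket u q * qpoch_inf (- u) (- q) =
     qpoch_inf (u^2 * q^2) (q^4) * (qpoch_inf (q^3) (q^12) * qpoch_inf (q^7) (q^12)) +
     u * qpoch_inf (u^2) (q^4) * (qpoch_inf q (q^12) * qpoch_inf (q^9) (q^12))"
proof -
  have q2: "norm (q^2) < 1" using q by (rule power_less_1_norm) simp
  have mq: "norm (- q) < 1" using q by simp
  have d: "qpoch_inf (- u) (- q) = qpoch_inf (- u) (q^2) * qpoch_inf (u * q) (q^2)"
    using qpoch_inf_base2[OF mq, of "- u"] by simp
  have 1: "qpoch_inf (u^2 * q^2) (q^4) = qpoch_inf (u * q) (q^2) * qpoch_inf (- (u * q)) (q^2)"
    using qpoch_inf_minus_mult[OF q2, of "u * q"] by (simp add: power_mult_distrib flip: power_mult)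
  have 2: "qpoch_inf (u^2) (q^4) = qpoch_inf u (q^2) * qpoch_inf (- u) (q^2)"
    using qpoch_inf_minus_mult[OF q2, of u] by (simp flip: power_mult)
  have nz: "qpoch_inf (- u) (q^2) \<noteq> 0" "qpoch_inf (u * q) (q^2) \<noteq> 0"
    using norm_mult_less[OF u q] u by (auto intro!: qpoch_inf_nonzero'[OF q2])
  show ?thesis unfolding d 1 2 bracket_def using nz by (simp add: field_simps)
qed

text \<open>With denominators cleared, the product has three terms. \<open>A1 * A2\<close> and
  \<open>B1 * B2\<close> lose \<open>w\<close> through the cube-root product, the cross term through
  \<open>jtheta_dissect_cube_root\<close>. One further dissection joins the outer terms, and another
  joins the result with the cross term.\<close>

theorem bracket_mult_bracket:
  assumes s: "norm s < 1" "s \<noteq> 0" and w: "w^2 + w + 1 = (0::complex)" "norm w = 1" and sq: "s^2 = q"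
  shows "bracket (w * s) q * bracket (w^2 * s) q =
    (qpoch_inf (q^2) (q^4) * qpoch_inf (q^6) (q^12) / (qpoch_inf (- (s^3)) (- (q^3)) * qpoch_inf (s^5) (- (q^3))))^2"
proof -
  have q: "norm q < 1" "q \<noteq> 0" using s unfolding sq[symmetric] by (auto intro: power_less_1_norm simp del: norm_power)
  have n: "norm (q ^ k) < 1" if "k > 0" for k using q(1) that by (rule power_less_1_norm)
  have mq: "norm (- q) < 1" "norm (- (q^3)) < 1" "- (q^3) \<noteq> 0" using q n[of 3] by auto
  have w3: "w^2 * w^2 = w" "w * w^2 = 1" using w(1) by (algebra, algebra)
  have ws: "norm (w * s) < 1" "norm (w^2 * s) < 1" using w s by (simp_all add: norm_mult norm_power)
  define e where "e = (\<lambda>k. qpoch_inf (q ^ k) (q^12))"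
  have e1: "qpoch_inf q (q^12) = e 1" by (simp add: e_def)
  have ee: "qpoch_inf (q ^ k) (q^12) = e k" for k by (simp add: e_def)
  note E = qpoch_inf_base12[OF q(1), unfolded ee]
  note nz = E(13)
  define A1 B1 A2 B2 where "A1 = qpoch_inf (w^2 * q^3) (q^4)" and "B1 = qpoch_inf (w^2 * q) (q^4)"
    and "A2 = qpoch_inf (w * q^3) (q^4)" and "B2 = qpoch_inf (w * q) (q^4)"
  have sq4: "(w * s)^2 = w^2 * q" "(w^2 * s)^2 = w * q" "w^2 * q * q^2 = w^2 * q^3" "w * q * q^2 = w * q^3"
    using w3 sq by (simp_all add: power_mult_distrib eval_nat_numeral mult_ac)
  define d1 d2 where "d1 = qpoch_inf (- (w * s)) (- q)" and "d2 = qpoch_inf (- (w^2 * s)) (- q)"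
  have b1: "bracket (w * s) q * d1 = A1 * (e 3 * e 7) + w * s * B1 * (e 1 * e 9)"
    using bracket_mult[OF q(1) ws(1)] unfolding sq4 e1 ee d1_def A1_def B1_def by simp
  have b2: "bracket (w^2 * s) q * d2 = A2 * (e 3 * e 7) + w^2 * s * B2 * (e 1 * e 9)"
    using bracket_mult[OF q(1) ws(2)] unfolding sq4 e1 ee d2_def A2_def B2_def by simp
  have A12: "A1 * A2 = e 9 / (e 3 * e 7 * e 11)"
    using qpoch_inf_cube_roots[OF n[of 4] w(1), of "q^3"] nz[of 3] nz[of 7] nz[of 11]
    by (simp add: A1_def A2_def E(5) ee field_simps flip: power_mult)
  have B12: "B1 * B2 = e 3 / (e 1 * e 5 * e 9)"
    using qpoch_inf_cube_roots[OF n[of 4] w(1), of q] nz[of 1] nz[of 5] nz[of 9]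
    by (simp add: B1_def B2_def E(6) ee e1 field_simps del: One_nat_def flip: power_mult)
  have th: "w^2 * A1 * B2 + w * A2 * B1 = - (e 3 * e 9 / e 6 * qpoch_inf (- q) (- q) / (qpoch_inf q (- q) * (e 4 * e 8 * e 12)))"
    using jtheta_dissect_cube_root[OF q w] unfolding E(7,11) A1_def A2_def B1_def B2_def .
  \<comment> \<open>Dissection of \<open>jtheta (- q) (- (q ^ 3))\<close>: its factors start at
    \<open>- q\<close>, \<open>q ^ 2\<close> and \<open>- (q ^ 3)\<close>, so together they form
    (-q; -q)_inf.\<close>
  have five: "e 5 * e 7 * e 12 + q * (e 1 * e 11 * e 12) = qpoch_inf (- q) (- q)"
  proof -
    have y: "- q \<noteq> 0" "norm (- (q^3)) < norm (- q)" "norm (- (q^3)) < norm (- q) ^ 2"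
    proof -
      have "norm q * norm (q^2) < norm q * 1" using n[of 2] q(2) by (intro mult_strict_left_mono) auto
      thus "norm (- (q^3)) < norm (- q)" by (simp add: norm_mult norm_power power3_eq_cube power2_eq_square)
      have "norm (q^2) * norm q < norm (q^2) * 1" using q by (intro mult_strict_left_mono) auto
      thus "norm (- (q^3)) < norm (- q) ^ 2" by (simp add: norm_mult norm_power power3_eq_cube power2_eq_square)
    qed (use q in simp)
    have ex: "- (- (q^3) * (- q)^2) = q^5" "- ((- (q^3))^3 * (- q)^2) = q^11" "(- (q^3))^4 = q^12"
      by (simp_all flip: power_mult power_add)
    have dv: "q^12 / q^5 = q^7" "q^12 / q^11 = q" "- (q^3) / (- q) = q^2"
      using q(2) by (simp_all add: eval_nat_numeral)
    have "jtheta (- q) (- (q^3)) = jtheta (q^5) (q^12) + q * jtheta (q^11) (q^12)"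
      using jtheta_dissect[OF mq(2,3) y] unfolding ex by simp
    moreover have "jtheta (- q) (- (q^3)) = qpoch_inf (- q) (- q)"
      using qpoch_inf_base3[OF mq(1), of "- q"] unfolding jtheta_def dv by (simp add: power2_eq_square power3_eq_cube mult.assoc)
    ultimately show ?thesis
      unfolding jtheta_def dv ee e1 by (simp add: mult_ac)
  qed
  \<comment> \<open>Paired by sign of the argument: \<open>U\<close> with \<open>Z\<close>,
    \<open>X3\<close> with \<open>X\<close>, \<open>Y\<close> with \<open>V\<close>.
    \<open>X\<close> and \<open>Y\<close> form the target denominator, the others have to
    cancel.\<close>
  define X Y Z X3 V U where "X = qpoch_inf (- (s^3)) (- (q^3))" and "Y = qpoch_inf (s^5) (- (q^3))"
    and "Z = qpoch_inf (- s) (- (q^3))" and "X3 = qpoch_inf (s^3) (- (q^3))" and "V = qpoch_inf (- (s^5)) (- (q^3))"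
    and "U = qpoch_inf s (- (q^3))"
  \<comment> \<open>Dissection of \<open>jtheta s (- (q ^ 3))\<close>, where
    \<open>- (q ^ 3) / s = - (s ^ 5)\<close> because \<open>q = s ^ 2\<close>.\<close>
  have six: "U * V * (e 6 * e 6 * e 12 / (e 3 * e 9)) = e 4 * e 8 * e 12 - s * (e 2 * e 10 * e 12)"
  proof -
    have y: "norm (- (q^3)) < norm s" "norm (- (q^3)) < norm s ^ 2"
    proof -
      have "norm (q^2) * norm q < 1 * norm q" using n[of 2] q(2) by (intro mult_strict_right_mono) auto
      hence "norm (- (q^3)) < norm q" by (simp add: norm_mult norm_power power3_eq_cube power2_eq_square)
      moreover have "norm q = norm s * norm s" unfolding sq[symmetric] by (simp add: norm_mult power2_eq_square)
      moreover have "norm s * norm s \<le> norm s * 1" using s by (intro mult_left_mono) auto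
      ultimately show "norm (- (q^3)) < norm s" "norm (- (q^3)) < norm s ^ 2" by (simp_all add: power2_eq_square)
    qed
    have ex: "- (- (q^3) * s^2) = q^4" "- ((- (q^3))^3 * s^2) = q^10" "(- (q^3))^4 = q^12"
      unfolding sq by (simp_all flip: power_mult power_add power_Suc power_Suc2)
    have dv: "q^12 / q^4 = q^8" "q^12 / q^10 = q^2" using q(2) by (simp_all add: eval_nat_numeral)
    have dv': "- (q^3) / s = - (s^5)" using s(2) unfolding sq[symmetric] by (simp add: eval_nat_numeral)
    have "jtheta s (- (q^3)) = jtheta (q^4) (q^12) - s * jtheta (q^10) (q^12)"
      using jtheta_dissect[OF mq(2,3) s(2) y] unfolding ex .
    thus ?thesis
      unfolding jtheta_def dv dv' ee E(10) U_def V_def by (simp add: mult_ac)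
  qed
  have ms: "(- (q^3))^2 = q^6" by (simp flip: power_mult)
  have s2: "(s^3)^2 = q^3" "(s^5)^2 = q^5" unfolding sq[symmetric] by (simp_all flip: power_mult)
  have UZ: "U * Z = e 1 * e 7" and X3X: "X3 * X = e 3 * e 9" and YV: "Y * V = e 5 * e 11"
    using qpoch_inf_minus_mult[OF mq(2), of s] qpoch_inf_minus_mult[OF mq(2), of "s^3"] qpoch_inf_minus_mult[OF mq(2), of "s^5"]
    unfolding ms s2 sq E(1-3) U_def Z_def X3_def X_def Y_def V_def by simp_all
  have "qpoch_inf (- s) (- q) = Z * X3 * V"
  proof -
    have "- s * - q = s^3" "- s * (- q)^2 = - (s^5)" "(- q)^3 = - (q^3)"
      unfolding sq[symmetric] by (simp_all add: eval_nat_numeral)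
    thus ?thesis
      using qpoch_inf_base3[OF mq(1), of "- s"] unfolding Z_def X3_def V_def by simp
  qed
  \<comment> \<open>\<open>d1\<close> and \<open>d2\<close> are two members of a cube-root triple
    whose third member is (-s; -q)_inf.\<close>
  hence d12: "Z * X3 * V * d1 * d2 = X"
    using qpoch_inf_cube_roots[OF mq(1) w(1), of "- s"] by (simp add: d1_def d2_def X_def)
  have XY: "X \<noteq> 0" "Y \<noteq> 0" "Z \<noteq> 0" "X3 \<noteq> 0" "V \<noteq> 0" "U \<noteq> 0"
    unfolding X_def Y_def Z_def X3_def V_def U_def
    using s power_less_1_norm[OF s(1), of 3] power_less_1_norm[OF s(1), of 5]
    by (auto intro!: qpoch_inf_nonzero'[OF mq(2)] simp del: norm_power)
  \<comment> \<open>The factor shared by \<open>even\<close> and \<open>odd\<close> below; what they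
    leave, \<open>e 4 * e 8\<close> and \<open>- (e 2 * e 10)\<close>, is the right-hand side of
    \<open>six\<close> up to \<open>s\<close> and \<open>e 12\<close>.\<close>
  define M where "M = (e 2 * e 6 * e 10)^2 / (e 1 * e 7 * (e 5 * e 11)^2)"
  define N where "N = A1 * A2 * (e 3 * e 7)^2 + s * (e 3 * e 7 * (e 1 * e 9)) * (w^2 * A1 * B2 + w * A2 * B1) + q * (B1 * B2) * (e 1 * e 9)^2"
  have N1: "(bracket (w * s) q * d1) * (bracket (w^2 * s) q * d2) = N"
  proof -
    have "(A1 * a + w * s * B1 * c) * (A2 * a + w^2 * s * B2 * c) =
        A1 * A2 * a^2 + s * (a * c) * (w^2 * A1 * B2 + w * A2 * B1) + s^2 * (B1 * B2) * c^2" for a c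
      using w3(2) by algebra
    thus ?thesis unfolding b1 b2 N_def sq .
  qed
  have even: "A1 * A2 * (e 3 * e 7)^2 + q * (B1 * B2) * (e 1 * e 9)^2 = M * (e 4 * e 8)"
  proof -
    have "A1 * A2 * (e 3 * e 7)^2 + q * (B1 * B2) * (e 1 * e 9)^2 =
       e 3 * e 9 / (e 5 * e 11 * e 12) * (e 5 * e 7 * e 12 + q * (e 1 * e 11 * e 12))"
      unfolding A12 B12 using nz by (simp add: field_simps power2_eq_square)
    also have "\<dots> = M * (e 4 * e 8)"
      unfolding five E(9) M_def using nz by (simp add: field_simps power2_eq_square)
    finally show ?thesis .
  qed
  have odd: "(e 3 * e 7 * (e 1 * e 9)) * (w^2 * A1 * B2 + w * A2 * B1) = - (M * (e 2 * e 10))"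
    unfolding th E(9) E(12) M_def using nz by (simp add: field_simps power2_eq_square)
  have "N = M * (e 4 * e 8) - s * (M * (e 2 * e 10))"
    unfolding even[symmetric] N_def using odd by (simp add: mult.assoc)
  also have "\<dots> = M * (U * V * (e 6 * e 6 / (e 3 * e 9)))"
  proof -
    have "U * V * (e 6 * e 6 / (e 3 * e 9)) = e 4 * e 8 - s * (e 2 * e 10)"
    proof -
      have "U * V * (e 6 * e 6 / (e 3 * e 9)) * e 12 = (e 4 * e 8 - s * (e 2 * e 10)) * e 12"
        using six by (simp add: algebra_simps)
      thus ?thesis using nz[of 12] by (simp only: mult_cancel_right) simp
    qed
    thus ?thesis by (simp only: right_diff_distrib mult.left_commute)
  qed
  finally have N2: "N = M * (U * V * (e 6 * e 6 / (e 3 * e 9)))" .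
  have dne: "d1 \<noteq> 0" "d2 \<noteq> 0" using d12 XY by auto
  have "bracket (w * s) q * bracket (w^2 * s) q = N / (d1 * d2)"
    using N1 dne by (simp add: field_simps)
  also have "\<dots> = N * (Z * X3 * V) / X"
    using d12 dne XY by (simp add: field_simps)
  \<comment> \<open>Multiplying numerator and denominator by \<open>X * Y ^ 2\<close> completes the
    sign pairs, so everything depending on \<open>s\<close> rather than \<open>q\<close> is
    collected in \<open>(X * Y) ^ 2\<close>.\<close>
  also have "\<dots> = M * (e 6 * e 6 / (e 3 * e 9)) * (U * Z) * (X3 * X) * (Y * V)^2 / (X * Y)^2"
    unfolding N2 using XY by (simp add: field_simps power2_eq_square)
  also have "\<dots> = (e 2 * e 6 * e 10 * e 6 / (X * Y))^2"
    unfolding UZ X3X YV M_def using nz by (simp add: field_simps power2_eq_square)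
  finally show ?thesis unfolding E(4) ee X_def Y_def .
qed

section \<open>Determination of the sign\<close>

lemma continuous_on_qpoch_inf_square:
  assumes f: "continuous_on (ball 0 1) f" and k: "k > 0"
  shows "continuous_on (ball 0 1) (\<lambda>s. qpoch_inf (f s) ((s^2) ^ k))"
  using continuous_on_qpoch_inf[OF f, of "2 * k" 1] k by (simp add: power_mult)

lemma continuous_on_qpoch_inf_square_minus:
  assumes f: "continuous_on (ball 0 1) f" and k: "k > 0"
  shows "continuous_on (ball 0 1) (\<lambda>s. qpoch_inf (f s) (- ((s^2) ^ k)))"
  using continuous_on_qpoch_inf[OF f, of "2 * k" "-1"] k by (simp add: power_mult)

text \<open>
  The squares of both sides agree, so their quotient is a continuous $\pm 1$-valued function
  of $s$ on the unit disc; it equals $1$ at $s = 0$.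
\<close>

theorem bracket_closed_form:
  assumes w: "w^2 + w + 1 = (0::complex)" "norm w = 1"
    and symm: "\<And>s. s \<noteq> 0 \<Longrightarrow> norm s < 1 \<Longrightarrow> bracket (w * s) (s^2) = bracket (w^2 * s) (s^2)"
    and s: "norm s < 1"
  shows "bracket (w * s) (s^2) =
    qpoch_inf ((s^2)^2) ((s^2)^4) * qpoch_inf ((s^2)^6) ((s^2)^12) /
      (qpoch_inf (- (s^3)) (- ((s^2)^3)) * qpoch_inf (s^5) (- ((s^2)^3)))"
proof -
  define R where "R = (\<lambda>s. qpoch_inf ((s^2)^2) ((s^2)^4) * qpoch_inf ((s^2)^6) ((s^2)^12) /
      (qpoch_inf (- (s^3)) (- ((s^2)^3)) * qpoch_inf (s^5) (- ((s^2)^3))))"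
  define B where "B = ball (0::complex) 1"
  have pw: "norm (s ^ k) < 1" if "norm s < 1" "k > 0" for s :: complex and k
    using that by (rule power_less_1_norm)
  have pw2: "norm ((s^2) ^ k) < 1" if "norm s < 1" "k > 0" for s :: complex and k
    using pw[OF that(1), of "2 * k"] that(2) by (simp add: power_mult)
  have R0: "R s \<noteq> 0" if "s \<in> B" for s
  proof -
    have s: "norm s < 1" using that by (simp add: B_def)
    have "qpoch_inf ((s^2)^2) ((s^2)^4) \<noteq> 0" "qpoch_inf ((s^2)^6) ((s^2)^12) \<noteq> 0"
      by (intro qpoch_inf_nonzero' pw2[OF s]; simp)+
    moreover have "qpoch_inf (- (s^3)) (- ((s^2)^3)) \<noteq> 0" "qpoch_inf (s^5) (- ((s^2)^3)) \<noteq> 0"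
      by (intro qpoch_inf_nonzero'; simp only: norm_minus_cancel pw[OF s] pw2[OF s] zero_less_numeral)+
    ultimately show ?thesis by (simp add: R_def)
  qed
  have cR: "continuous_on B R"
    unfolding R_def B_def
  proof (intro continuous_intros continuous_on_qpoch_inf_square continuous_on_qpoch_inf_square_minus ballI)
    fix s :: complex assume "s \<in> ball 0 1"
    thus "qpoch_inf (- (s^3)) (- ((s^2)^3)) * qpoch_inf (s^5) (- ((s^2)^3)) \<noteq> 0"
      using R0[of s] by (auto simp: R_def B_def)
  qed auto
  have cB: "continuous_on B (\<lambda>s. bracket (w * s) (s^2))"
  proof -
    have nz: "qpoch_inf (- (w * s)) ((s^2)^2) \<noteq> 0" "qpoch_inf (w * s * s^2) ((s^2)^2) \<noteq> 0"
      if "s \<in> B" for s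
    proof -
      have s: "norm s < 1" using that by (simp add: B_def)
      have ws: "norm (w * s) < 1" using s w(2) by (simp add: norm_mult)
      show "qpoch_inf (- (w * s)) ((s^2)^2) \<noteq> 0"
        using ws by (intro qpoch_inf_nonzero' pw2 s) auto
      show "qpoch_inf (w * s * s^2) ((s^2)^2) \<noteq> 0"
        using norm_mult_less[OF ws pw[OF s, of 2]] by (intro qpoch_inf_nonzero' pw2 s) auto
    qed
    have "continuous_on B (\<lambda>s. qpoch_inf (s^2) ((s^2)^12))" "continuous_on B (\<lambda>s. qpoch_inf (w * s) ((s^2)^2))"
      "continuous_on B (\<lambda>s. qpoch_inf (w * s * s^2) ((s^2)^2))"
      unfolding B_def by (intro continuous_on_qpoch_inf_square continuous_intros; simp)+
    moreover have "continuous_on B (\<lambda>s. qpoch_inf ((s^2)^3) ((s^2)^12))" "continuous_on B (\<lambda>s. qpoch_inf ((s^2)^7) ((s^2)^12))"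
      "continuous_on B (\<lambda>s. qpoch_inf ((s^2)^9) ((s^2)^12))" "continuous_on B (\<lambda>s. qpoch_inf (- (w * s * s^2)) ((s^2)^2))"
      "continuous_on B (\<lambda>s. qpoch_inf (- (w * s)) ((s^2)^2))"
      unfolding B_def by (intro continuous_on_qpoch_inf_square continuous_intros; simp)+
    ultimately show ?thesis
      unfolding bracket_def by (intro continuous_intros) (use nz in auto)
  qed
  \<comment> \<open>The point \<open>s = 0\<close> is outside the reach of
    \<open>bracket_mult_bracket\<close>; there all products have argument 0 and value 1.\<close>
  have sq: "(bracket (w * s) (s^2) / R s)^2 = 1" if "s \<in> B" for s
  proof (cases "s = 0")
    case True
    thus ?thesis by (simp add: bracket_def R_def)
  next
    case False
    have "norm s < 1" using that by (simp add: B_def)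
    from bracket_mult_bracket[OF this False w refl] symm[OF False this]
    have "bracket (w * s) (s^2) ^ 2 = R s ^ 2" by (simp add: R_def power2_eq_square)
    thus ?thesis using R0[OF that] by (simp add: power_divide)
  qed
  have "(\<lambda>s. bracket (w * s) (s^2) / R s) constant_on B"
  proof (rule continuous_finite_range_constant)
    show "connected B" by (simp add: B_def)
    show "continuous_on B (\<lambda>s. bracket (w * s) (s^2) / R s)"
      using R0 by (intro continuous_intros cB cR) auto
    have "(\<lambda>s. bracket (w * s) (s^2) / R s) ` B \<subseteq> {1, -1}"
      using sq[unfolded power2_eq_1_iff] by blast
    thus "finite ((\<lambda>s. bracket (w * s) (s^2) / R s) ` B)"
      by (rule finite_subset) simp
  qed
  then obtain c where c: "\<And>s. s \<in> B \<Longrightarrow> bracket (w * s) (s^2) / R s = c"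
    by (auto simp: constant_on_def)
  have "c = 1" using c[of 0] by (simp add: B_def bracket_def R_def)
  hence "bracket (w * s) (s^2) = R s" using c[of s] R0[of s] s by (simp add: B_def)
  thus ?thesis by (simp only: R_def)
qed

section \<open>q-difference equations for formal power series\<close>

text \<open>The dilation Z -> pZ, so that q-difference equations can be used without any radius of
  convergence.\<close>

definition fps_scale :: "complex \<Rightarrow> complex fps \<Rightarrow> complex fps" where
  "fps_scale p F = Abs_fps (\<lambda>n. p ^ n * fps_nth F n)"

lemma fps_scale_nth [simp]: "fps_nth (fps_scale p F) n = p ^ n * fps_nth F n"
  by (simp add: fps_scale_def)

lemma fps_scale_mult: "fps_scale p (F * G) = fps_scale p F * fps_scale p G"
proof (rule fps_ext)
  fix n
  have "p ^ n * (fps_nth F i * fps_nth G (n - i)) = p ^ i * fps_nth F i * (p ^ (n - i) * fps_nth G (n - i))" if "i \<le> n" for i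
    using that power_add[of p i "n - i"] by simp
  thus "fps_nth (fps_scale p (F * G)) n = fps_nth (fps_scale p F * fps_scale p G) n"
    unfolding fps_scale_nth fps_mult_nth sum_distrib_left by (intro sum.cong) auto
qed

lemma fps_scale_diff: "fps_scale p (F - G) = fps_scale p F - fps_scale p G"
  by (rule fps_ext) (simp add: algebra_simps)

lemma fps_scale_scale: "fps_scale p (fps_scale r F) = fps_scale (p * r) F"
  by (rule fps_ext) (simp add: power_mult_distrib)

definition fps_lin :: "complex \<Rightarrow> complex fps" where
  "fps_lin c = 1 - fps_const c * fps_X"

lemma fps_scale_lin: "fps_scale p (fps_lin c) = fps_lin (p * c)"
  by (rule fps_ext) (auto simp: fps_lin_def le_Suc_eq)

lemma fps_lin_nonzero: "fps_lin c \<noteq> 0"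
proof
  assume "fps_lin c = 0"
  hence "fps_nth (fps_lin c) 0 = 0" by simp
  thus False by (simp add: fps_lin_def)
qed

lemma fps_lin_mult_nth:
  "fps_nth (F * fps_lin c) n = fps_nth F n - (if n = 0 then 0 else c * fps_nth F (n - 1))"
proof -
  have "F * fps_lin c = F - fps_const c * (fps_X * F)"
    by (simp add: fps_lin_def algebra_simps)
  thus ?thesis by simp
qed

text \<open>In the coefficient of index \<open>n\<close> the right-hand side contains
  \<open>p ^ n\<close> times the same coefficient and otherwise only earlier ones, owing to the
  factors \<open>fps_X\<close>. The term with \<open>p ^ 2\<close> admits second order
  equations.\<close>

lemma fps_q_recurrence_unique:
  assumes p: "\<And>n. n > 0 \<Longrightarrow> p ^ n \<noteq> 1" and D0: "fps_nth D 0 = 0"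
    and eq: "D = fps_scale p D + fps_X * (A * D) + fps_X * (B * fps_scale p D) + fps_X * (C * fps_scale (p^2) D)"
  shows "D = 0"
proof (rule fps_ext)
  fix n show "fps_nth D n = fps_nth 0 n"
  proof (induction n rule: less_induct)
    case (less n)
    show ?case
    proof (cases n)
      case (Suc m)
      have z: "fps_nth (E * fps_scale r D) m = 0" for E r
        unfolding fps_mult_nth by (rule sum.neutral) (use less Suc in auto)
      have z': "fps_nth (E * D) m = 0" for E
        unfolding fps_mult_nth by (rule sum.neutral) (use less Suc in auto)
      have "fps_nth D n = p ^ n * fps_nth D n"
        by (subst eq) (simp add: Suc z z')
      hence "(1 - p ^ n) * fps_nth D n = 0" by (simp add: algebra_simps)
      thus ?thesis using p[of n] Suc by auto
    qed (use D0 in simp)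
  qed
qed

text \<open>Formal counterpart of (aZ; p)_inf / (Z; p)_inf; with \<open>a = 0\<close> it is 1/(Z;
  p)_inf.\<close>

definition fps_qbinomial :: "complex \<Rightarrow> complex \<Rightarrow> complex fps" where
  "fps_qbinomial a p = Abs_fps (\<lambda>n. qpoch a p n / qpoch p p n)"

lemma fps_qbinomial_eq:
  assumes "norm p < 1"
  shows "fps_qbinomial a p * fps_lin 1 = fps_scale p (fps_qbinomial a p) * fps_lin a"
proof (rule fps_ext)
  fix n show "fps_nth (fps_qbinomial a p * fps_lin 1) n = fps_nth (fps_scale p (fps_qbinomial a p) * fps_lin a) n"
  proof (cases n)
    case (Suc m)
    have "qpoch p p m \<noteq> 0" "1 - p * p ^ m \<noteq> 0"
      using qpoch_nonzero'[OF assms assms] mult_power_neq_1[OF assms assms, of m] by auto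
    thus ?thesis unfolding Suc fps_lin_mult_nth
      by (simp add: fps_qbinomial_def qpoch_Suc divide_simps) (simp add: algebra_simps)
  qed (simp add: fps_lin_mult_nth fps_qbinomial_def fps_lin_def)
qed

text \<open>Formal counterpart of (-Z; p)_inf.\<close>

definition fps_euler :: "complex \<Rightarrow> complex fps" where
  "fps_euler p = Abs_fps (\<lambda>n. p ^ (n choose 2) / qpoch p p n)"

lemma fps_euler_eq:
  assumes "norm p < 1"
  shows "fps_euler p = fps_scale p (fps_euler p) * fps_lin (- 1)"
proof (rule fps_ext)
  fix n show "fps_nth (fps_euler p) n = fps_nth (fps_scale p (fps_euler p) * fps_lin (- 1)) n"
  proof (cases n)
    case (Suc m)
    have "qpoch p p m \<noteq> 0" "1 - p * p ^ m \<noteq> 0"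
      using qpoch_nonzero'[OF assms assms] mult_power_neq_1[OF assms assms, of m] by auto
    thus ?thesis unfolding Suc fps_lin_mult_nth
      by (simp add: fps_euler_def qpoch_Suc power_choose_2_Suc divide_simps) (simp add: algebra_simps)
  qed (simp add: fps_lin_mult_nth fps_euler_def fps_lin_def)
qed

section \<open>The triple sum\<close>

lemma fps_scale_qbinomial_eq:
  assumes "norm p < 1"
  shows "fps_scale z (fps_qbinomial a p) * fps_lin z = fps_scale p (fps_scale z (fps_qbinomial a p)) * fps_lin (z * a)"
  using arg_cong[OF fps_qbinomial_eq[OF assms, of a], of "fps_scale z"]
  unfolding fps_scale_mult fps_scale_lin fps_scale_scale mult.commute[of z p] mult_1_right .

lemma fps_scale_euler_eq:
  assumes "norm p < 1"
  shows "fps_scale z (fps_euler p) = fps_scale p (fps_scale z (fps_euler p)) * fps_lin (- z)"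
  using arg_cong[OF fps_euler_eq[OF assms], of "fps_scale z"]
  unfolding fps_scale_mult fps_scale_lin fps_scale_scale mult.commute[of z p] mult_minus1_right .

lemma fps_lin_0 [simp]: "fps_lin 0 = 1"
  by (simp add: fps_lin_def)

lemma fps_lin_nth_0 [simp]: "fps_nth (fps_lin c) 0 = 1"
  by (simp add: fps_lin_def)

lemma fps_eq_1_plus_X_mult:
  fixes F :: "complex fps"
  assumes "fps_nth F 0 = 1"
  shows "F = 1 + fps_X * fps_shift 1 F"
proof (rule fps_ext)
  fix n show "fps_nth F n = fps_nth (1 + fps_X * fps_shift 1 F) n"
    using assms by (cases n) simp_all
qed

lemma fps_q_equation_unique:
  assumes p: "\<And>n. n > 0 \<Longrightarrow> p ^ n \<noteq> 1" and 0: "fps_nth F 0 = fps_nth G 0" "fps_nth A 0 = 1" "fps_nth B 0 = 1"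
    and F: "F * A = fps_scale p F * B" and G: "G * A = fps_scale p G * B"
  shows "F = G"
proof -
  define D where "D = F - G"
  have "D * A = fps_scale p D * B"
    unfolding D_def fps_scale_diff using F G by (simp add: algebra_simps)
  hence "D * (1 + fps_X * fps_shift 1 A) = fps_scale p D * (1 + fps_X * fps_shift 1 B)"
    using fps_eq_1_plus_X_mult[OF 0(2)] fps_eq_1_plus_X_mult[OF 0(3)] by simp
  hence "D = fps_scale p D + fps_X * (- fps_shift 1 A * D) + fps_X * (fps_shift 1 B * fps_scale p D) + fps_X * (0 * fps_scale (p^2) D)"
    by (simp add: algebra_simps eq_diff_eq)
  from fps_q_recurrence_unique[OF p _ this] have "D = 0" using 0(1) by (simp add: D_def)
  thus ?thesis by (simp add: D_def)
qed

lemma fps_q_equation_unique2: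
  assumes p: "\<And>n. n > 0 \<Longrightarrow> p ^ n \<noteq> 1" and 0: "fps_nth F 0 = fps_nth G 0"
    and F: "F = fps_scale p F + fps_X * (B * fps_scale p F) + fps_X * (C * fps_scale (p^2) F)"
    and G: "G = fps_scale p G + fps_X * (B * fps_scale p G) + fps_X * (C * fps_scale (p^2) G)"
  shows "F = G"
proof -
  have "F - G = fps_scale p (F - G) + fps_X * (0 * (F - G)) + fps_X * (B * fps_scale p (F - G)) + fps_X * (C * fps_scale (p^2) (F - G))"
    unfolding fps_scale_diff by (subst F, subst G) (simp add: algebra_simps)
  from fps_q_recurrence_unique[OF p _ this] show ?thesis using 0 by simp
qed

lemma fps_lin_mult: "fps_lin a * fps_lin b = 1 - fps_const (a + b) * fps_X + fps_const (a * b) * fps_X^2"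
  by (simp add: fps_lin_def algebra_simps power2_eq_square flip: fps_const_add fps_const_mult)

text \<open>Formal counterpart of (q^3 Z^3; q^6)_inf, by Euler's series in Z^3; the index
  \<open>3 * k\<close> carries the third summation variable.\<close>

definition fps_cubic :: "complex \<Rightarrow> complex fps" where
  "fps_cubic q = Abs_fps (\<lambda>n. if 3 dvd n then
     (- 1) ^ (n div 3) * q ^ (6 * (n div 3 choose 2) + 3 * (n div 3)) / qpoch (q^6) (q^6) (n div 3) else 0)"

lemma fps_cubic_eq:
  assumes q: "norm q < 1"
  shows "fps_cubic q = (1 - fps_const (q^3) * fps_X^3) * fps_scale (q^2) (fps_cubic q)"
proof (rule fps_ext)
  fix n
  have q6: "norm (q^6) < 1" using q by (rule power_less_1_norm) simp
  have *: "fps_nth ((1 - fps_const (q^3) * fps_X^3) * fps_scale (q^2) (fps_cubic q)) n =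
      (q^2) ^ n * fps_nth (fps_cubic q) n - (if n < 3 then 0 else q^3 * ((q^2) ^ (n - 3) * fps_nth (fps_cubic q) (n - 3)))"
    by (simp add: left_diff_distrib mult.assoc fps_X_power_mult_nth)
  show "fps_nth (fps_cubic q) n = fps_nth ((1 - fps_const (q^3) * fps_X^3) * fps_scale (q^2) (fps_cubic q)) n"
  proof (cases "3 dvd n")
    case False
    hence "n < 3 \<or> \<not> 3 dvd (n - 3)" by presburger
    thus ?thesis unfolding * using False by (auto simp: fps_cubic_def)
  next
    case True
    then obtain m where m: "n = 3 * m" by auto
    show ?thesis
    proof (cases m)
      case 0
      thus ?thesis unfolding * m by (simp add: fps_cubic_def)
    next
      case (Suc k)
      define t where "t = q ^ (6 * k)"
      define P where "P = q ^ (6 * (k choose 2) + 3 * k)"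
      have nz: "qpoch (q^6) (q^6) k \<noteq> 0" "1 - q^6 * t \<noteq> 0"
        using qpoch_nonzero'[OF q6 q6] mult_power_neq_1[OF q6 q6, of k] by (auto simp: t_def power_mult)
      have e1: "q ^ (6 * (Suc k choose 2) + 3 * Suc k) = P * t * q^3"
        by (simp add: P_def t_def numeral_2_eq_2 flip: power_add) (simp add: algebra_simps)
      have e2: "(q^2) ^ (3 * Suc k) = t * q^6" "(q^2) ^ (3 * Suc k - 3) = t"
        by (simp_all add: t_def algebra_simps flip: power_mult power_add)
      have e3: "qpoch (q^6) (q^6) (Suc k) = qpoch (q^6) (q^6) k * (1 - q^6 * t)"
        by (simp add: qpoch_Suc t_def power_mult)
      have c1: "fps_nth (fps_cubic q) (3 * Suc k) = (- 1) ^ Suc k * (P * t * q^3) / (qpoch (q^6) (q^6) k * (1 - q^6 * t))"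
        unfolding e1[symmetric] e3[symmetric] by (simp add: fps_cubic_def del: power_Suc)
      have c2: "fps_nth (fps_cubic q) (3 * Suc k - 3) = (- 1) ^ k * P / qpoch (q^6) (q^6) k"
        by (simp add: fps_cubic_def P_def)
      have n3: "\<not> 3 * Suc k < 3" by simp
      show ?thesis unfolding * unfolding m Suc e2 c1 c2 if_not_P[OF n3] using nz by (simp add: divide_simps) algebra
    qed
  qed
qed

text \<open>
  Both sides satisfy
  $F(Z)(1-Z)(1+Z/s)(1-sZ) = F(q^2Z)(1-\omega qZ)(1-\omega^2qZ)$.
\<close>

lemma fps_triple_factor:
  assumes s: "norm s < 1" "s \<noteq> 0" and w: "w^2 + w + 1 = (0::complex)" and sq: "s^2 = q"
  shows "fps_qbinomial 0 q * (fps_scale (- 1 / s) (fps_qbinomial 0 (- q)) * fps_cubic q) =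
     fps_qbinomial (w^2 * q) (q^2) * (fps_scale (- (w * q)) (fps_euler (q^2)) * fps_scale (- 1 / s) (fps_qbinomial 0 (- q)))"
    (is "?e * (?g * ?K) = ?L * (?E * ?g)")
proof -
  have q: "norm q < 1" unfolding sq[symmetric] using s(1) by (rule power_less_1_norm) simp
  have mq: "norm (- q) < 1" using q by simp
  have q2: "norm (q^2) < 1" using q by (rule power_less_1_norm) simp
  have e1: "?e * fps_lin 1 = fps_scale q ?e"
    using fps_qbinomial_eq[OF q, of 0] by simp
  from arg_cong[OF this, of "fps_scale q"]
  have e2: "fps_scale q ?e * fps_lin q = fps_scale (q^2) ?e"
    by (simp add: fps_scale_mult fps_scale_lin fps_scale_scale power2_eq_square)
  have g1: "?g * fps_lin (- 1 / s) = fps_scale (- q) ?g"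
    using fps_scale_qbinomial_eq[OF mq, of "- 1 / s" 0] by simp
  \<comment> \<open>Two shifts by \<open>- q\<close> make one shift by \<open>q ^ 2\<close>; the
    second factor is \<open>fps_lin s\<close> because \<open>q / s = s\<close>.\<close>
  from arg_cong[OF this, of "fps_scale (- q)"]
  have g2: "fps_scale (- q) ?g * fps_lin s = fps_scale (q^2) ?g"
    using s(2) by (simp add: fps_scale_mult fps_scale_lin fps_scale_scale power2_eq_square mult.assoc flip: sq)
  have cub: "1 - fps_const (q^3) * fps_X^3 = fps_lin q * (fps_lin (w * q) * fps_lin (w^2 * q))"
  proof -
    have 1: "w * q + w^2 * q = - q" "w * q * (w^2 * q) = q^2" using w by (algebra, algebra)
    show ?thesis unfolding fps_lin_mult 1 unfolding fps_lin_def
      by (simp add: algebra_simps power2_eq_square power3_eq_cube flip: fps_const_mult)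
  qed
  have K: "?K = fps_lin q * (fps_lin (w * q) * fps_lin (w^2 * q)) * fps_scale (q^2) ?K"
    using fps_cubic_eq[OF q] unfolding cub .
  have E: "?E = fps_scale (q^2) ?E * fps_lin (w * q)"
    using fps_scale_euler_eq[OF q2, of "- (w * q)"] by simp
  have L: "?L * fps_lin 1 = fps_scale (q^2) ?L * fps_lin (w^2 * q)"
    by (rule fps_qbinomial_eq[OF q2])
  let ?A = "fps_lin 1 * (fps_lin (- 1 / s) * fps_lin s)"
  let ?B = "fps_lin (w * q) * fps_lin (w^2 * q)"
  have F: "?e * (?g * ?K) * ?A = fps_scale (q^2) (?e * (?g * ?K)) * ?B"
  proof -
    \<comment> \<open>The factor 1 - qZ from the two-step shift of the first series also divides 1 -
      q^3 Z^3. It is cancelled by comparing both sides after multiplication by it.\<close>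
    have "(?e * (?g * ?K) * ?A) * fps_lin q = (?e * fps_lin 1) * fps_lin q * ((?g * fps_lin (- 1 / s)) * fps_lin s) * ?K"
      by (simp only: mult_ac)
    also have "\<dots> = fps_scale (q^2) ?e * fps_scale (q^2) ?g * (fps_lin q * ?B * fps_scale (q^2) ?K)"
      unfolding e1 e2 g1 g2 using K by simp
    also have "\<dots> = (fps_scale (q^2) (?e * (?g * ?K)) * ?B) * fps_lin q"
      unfolding fps_scale_mult by (simp only: mult_ac)
    finally show ?thesis using fps_lin_nonzero mult_right_cancel by blast
  qed
  have G: "?L * (?E * ?g) * ?A = fps_scale (q^2) (?L * (?E * ?g)) * ?B"
  proof -
    have "?L * (?E * ?g) * ?A = (?L * fps_lin 1) * ((?g * fps_lin (- 1 / s)) * fps_lin s) * ?E"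
      by (simp only: mult_ac)
    also have "\<dots> = fps_scale (q^2) ?L * fps_lin (w^2 * q) * fps_scale (q^2) ?g * (fps_scale (q^2) ?E * fps_lin (w * q))"
      unfolding L g1 g2 using E by simp
    also have "\<dots> = fps_scale (q^2) (?L * (?E * ?g)) * ?B"
      unfolding fps_scale_mult by (simp only: mult_ac)
    finally show ?thesis .
  qed
  show ?thesis
  proof (rule fps_q_equation_unique[OF _ _ _ _ F G])
    fix n :: nat assume "n > 0"
    thus "(q^2) ^ n \<noteq> 1" using power_less_1_norm[OF q2, of n] by auto
  qed (simp_all add: fps_qbinomial_def fps_euler_def fps_cubic_def binomial_eq_0)
qed

text \<open>With p = q^2, the weights p^((n+1) choose 2) turn multiplication by Z into
  multiplication by pZ combined with the dilation Z -> pZ. The first order equation of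
  \<open>H\<close> thus becomes a second order one, which the product on the right satisfies as
  well.\<close>

lemma fps_gaussian_transform:
  assumes s: "norm s < 1" "s \<noteq> 0" and w: "w^2 + w + 1 = (0::complex)" and sq: "s^2 = q"
  defines "H \<equiv> fps_scale (- (w * q)) (fps_euler (q^2)) * fps_scale (- 1 / s) (fps_qbinomial 0 (- q))"
  shows "Abs_fps (\<lambda>n. (q^2) ^ (Suc n choose 2) * fps_nth H n) =
     fps_scale (- (w^2 * q)) (fps_euler (q^2)) *
     Abs_fps (\<lambda>n. qpoch (w * s) (- q) (2 * n) / qpoch (q^2) (q^2) n * (w^2 * q) ^ n)"
    (is "?W = ?E * ?Y")
proof -
  have q: "norm q < 1" unfolding sq[symmetric] using s(1) by (rule power_less_1_norm) simp
  have mq: "norm (- q) < 1" using q by simp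
  have q2: "norm (q^2) < 1" using q by (rule power_less_1_norm) simp
  define p where "p = q^2"
  \<comment> \<open>The linear coefficient in (1 + Z/s)(1 - sZ) = 1 - si Z - Z^2.\<close>
  define si where "si = s - 1 / s"
  have p1: "norm p < 1" using q2 by (simp add: p_def)
  define g where "g = fps_scale (- 1 / s) (fps_qbinomial 0 (- q))"
  have g1: "g * fps_lin (- 1 / s) = fps_scale (- q) g"
    using fps_scale_qbinomial_eq[OF mq, of "- 1 / s" 0] by (simp add: g_def)
  from arg_cong[OF this, of "fps_scale (- q)"]
  have g2: "fps_scale (- q) g * fps_lin s = fps_scale p g"
    using s(2) by (simp add: fps_scale_mult fps_scale_lin fps_scale_scale power2_eq_square p_def mult.assoc flip: sq)
  define EA where "EA = fps_scale (- (w * q)) (fps_euler p)"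
  have EA: "EA = fps_scale p EA * fps_lin (w * q)"
    using fps_scale_euler_eq[OF p1, of "- (w * q)"] by (simp add: EA_def)
  have H: "H = EA * g" by (simp add: H_def EA_def g_def p_def)
  have "H * (fps_lin (- 1 / s) * fps_lin s) = EA * ((g * fps_lin (- 1 / s)) * fps_lin s)"
    unfolding H by (simp only: mult_ac)
  also have "\<dots> = fps_scale p EA * fps_lin (w * q) * fps_scale p g"
    unfolding g1 g2 using EA by simp
  also have "\<dots> = fps_scale p H * fps_lin (w * q)"
    unfolding H fps_scale_mult by (simp only: mult_ac)
  finally have H1: "H * fps_lin (- 1 / s) * fps_lin s = fps_scale p H * fps_lin (w * q)"
    by (simp only: mult.assoc)
  have Hn: "fps_nth H (Suc (Suc m)) - si * fps_nth H (Suc m) - fps_nth H m =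
      p ^ (Suc (Suc m)) * fps_nth H (Suc (Suc m)) - w * q * (p ^ Suc m * fps_nth H (Suc m))" for m
    using arg_cong[OF H1, of "\<lambda>F. fps_nth F (Suc (Suc m))"] s(2)
    unfolding fps_lin_mult_nth si_def by (simp add: algebra_simps)
  have H01: "fps_nth H (Suc 0) - si * fps_nth H 0 = p * fps_nth H (Suc 0) - w * q * fps_nth H 0"
    using arg_cong[OF H1, of "\<lambda>F. fps_nth F (Suc 0)"]
    unfolding fps_lin_mult_nth si_def by (simp add: algebra_simps)
  \<comment> \<open>The terms with a double dilation: they stem from the Z^2 on the left and the wqZ
    on the right of the equation of \<open>H\<close>.\<close>
  let ?C = "fps_const (p^3) * fps_X - fps_const (w * q * p)"
  have W: "?W = fps_scale p ?W + fps_X * (fps_const (si * p) * fps_scale p ?W) + fps_X * (?C * fps_scale (p^2) ?W)"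
    (is "_ = ?rhs")
  proof (rule fps_ext)
    fix n
    consider "n = 0" | "n = Suc 0" | m where "n = Suc (Suc m)" by (metis not0_implies_Suc)
    thus "fps_nth ?W n = fps_nth ?rhs n"
    proof cases
      case 3
      define t where "t = p ^ m"
      define P where "P = p ^ (Suc m choose 2)"
      have t2: "(p^2) ^ m = t^2" by (simp add: t_def flip: power_mult) (simp add: mult.commute)
      have e: "p ^ (Suc (Suc m) choose 2) = P * (p * t)" "p ^ (Suc (Suc (Suc m)) choose 2) = P * (p * t) * (p^2 * t)"
        unfolding power_choose_2_Suc[of p "Suc m"] power_choose_2_Suc[of p "Suc (Suc m)"] P_def t_def
        by (simp_all add: power2_eq_square)
      have W0: "fps_nth ?W m = P * fps_nth H m" "fps_nth ?W (Suc m) = P * (p * t) * fps_nth H (Suc m)"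
        "fps_nth ?W (Suc (Suc m)) = P * (p * t) * (p^2 * t) * fps_nth H (Suc (Suc m))"
        unfolding fps_nth_Abs_fps p_def[symmetric] e by (simp_all add: P_def)
      have "fps_nth ?rhs n = p^2 * t * fps_nth ?W (Suc (Suc m)) + si * p * (p * t * fps_nth ?W (Suc m))
          + (p^3 * (t^2 * fps_nth ?W m) - w * q * p * (p^2 * t^2 * fps_nth ?W (Suc m)))"
        unfolding 3 by (simp add: left_diff_distrib mult.assoc t2 t2[unfolded power2_eq_square[of p]] power2_eq_square[of p] flip: t_def del: fps_nth_Abs_fps)
      also have "\<dots> = fps_nth ?W n"
        unfolding 3 W0 using Hn[of m] unfolding power_Suc t_def[symmetric] by algebra
      finally show ?thesis ..
    next
      case 2
      have W01: "fps_nth ?W 0 = fps_nth H 0" "fps_nth ?W (Suc 0) = p * fps_nth H (Suc 0)"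
        by (simp_all add: p_def numeral_2_eq_2)
      have "fps_nth ?rhs n = p * fps_nth ?W (Suc 0) + si * p * fps_nth ?W 0 - w * q * p * fps_nth ?W 0"
        unfolding 2 by (simp add: left_diff_distrib mult.assoc del: fps_nth_Abs_fps)
      also have "\<dots> = fps_nth ?W n"
        unfolding 2 W01 using H01 by algebra
      finally show ?thesis ..
    qed simp
  qed
  define E where "E = fps_scale (- (w^2 * q)) (fps_euler p)"
  have E1: "E = fps_scale p E * fps_lin (w^2 * q)"
    using fps_scale_euler_eq[OF p1, of "- (w^2 * q)"] by (simp add: E_def)
  from arg_cong[OF this, of "fps_scale p"]
  have E2: "fps_scale p E = fps_scale (p^2) E * fps_lin (p * (w^2 * q))"
    by (simp add: fps_scale_mult fps_scale_lin fps_scale_scale power2_eq_square)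
  define Y where "Y = Abs_fps (\<lambda>n. qpoch (w * s) (- q) (2 * n) / qpoch p p n * (w^2 * q) ^ n)"
  have Y: "Y * fps_lin (w^2 * q) = fps_scale p Y + fps_X * (fps_const (si * p) * fps_scale p Y) - fps_X * (fps_const (w * q * p) * fps_scale (p^2) Y)"
  proof (rule fps_ext)
    fix n
    show "fps_nth (Y * fps_lin (w^2 * q)) n =
      fps_nth (fps_scale p Y + fps_X * (fps_const (si * p) * fps_scale p Y) - fps_X * (fps_const (w * q * p) * fps_scale (p^2) Y)) n"
    proof (cases n)
      case (Suc m)
      define t where "t = p ^ m"
      have nz: "qpoch p p m \<noteq> 0" "1 - p * t \<noteq> 0"
        using qpoch_nonzero'[OF p1 p1] mult_power_neq_1[OF p1 p1, of m] by (auto simp: t_def)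
      have t2: "(p^2) ^ m = t^2" by (simp add: t_def flip: power_mult) (simp add: mult.commute)
      have t3: "(- q) ^ (2 * m) = t" by (simp add: t_def p_def power_mult)
      define y where "y = fps_nth Y m"
      have "fps_nth Y (Suc m) = y * ((1 - w * s * t) * (1 + w * s * q * t) * (w^2 * q)) / (1 - p * t)"
        unfolding Y_def y_def using nz t3
        by (simp add: qpoch_Suc flip: t_def)
      hence ys: "fps_nth Y (Suc m) * (1 - p * t) = y * ((1 - w * s * t) * (1 + w * s * q * t) * (w^2 * q))"
        using nz by simp
      have w3: "w^3 = 1" using w by algebra
      have sip: "si * p = q * s * (q - 1)"
        using s(2) unfolding si_def p_def sq[symmetric] by (simp add: field_simps eval_nat_numeral)
      \<comment> \<open>These are the two factors gained by
        \<open>qpoch (w * s) (- q) (2 * n)\<close> in one step. Each power of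
        \<open>t = p ^ m\<close> corresponds to one dilation of \<open>Y\<close>.\<close>
      have "(1 - w * s * t) * (1 + w * s * q * t) * (w^2 * q) = w^2 * q + si * p * t - w * q * p * t^2"
        unfolding sip unfolding p_def using w3 sq by algebra
      with ys have "fps_nth Y (Suc m) * (1 - p * t) = y * (w^2 * q + si * p * t - w * q * p * t^2)" by simp
      thus ?thesis
        unfolding Suc fps_lin_mult_nth by (simp add: t2 mult.assoc flip: t_def y_def) algebra
    qed (simp add: fps_lin_mult_nth Y_def)
  qed
  have V: "E * Y = fps_scale p (E * Y) + fps_X * (fps_const (si * p) * fps_scale p (E * Y)) + fps_X * (?C * fps_scale (p^2) (E * Y))"
  proof -
    have "E * Y = fps_scale p E * (Y * fps_lin (w^2 * q))"
      by (subst E1) (simp only: mult_ac)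
    also have "\<dots> = fps_scale p (E * Y) + fps_X * (fps_const (si * p) * fps_scale p (E * Y))
        - fps_scale p E * (fps_X * (fps_const (w * q * p) * fps_scale (p^2) Y))"
      unfolding Y fps_scale_mult by (simp add: algebra_simps)
    \<comment> \<open>Only the doubly dilated term needs a second step of the equation of
      \<open>E\<close>; the factor gained there supplies the \<open>fps_X\<close> term of
      \<open>?C\<close>.\<close>
    also have "fps_scale p E * (fps_X * (fps_const (w * q * p) * fps_scale (p^2) Y))
       = fps_X * (fps_const (w * q * p) * fps_lin (p * (w^2 * q)) * fps_scale (p^2) (E * Y))"
      unfolding fps_scale_mult by (subst E2) (simp only: mult_ac)
    also have "fps_const (w * q * p) * fps_lin (p * (w^2 * q)) = - ?C"
    proof -
      have "w * q * p * (p * (w^2 * q)) = p^3" unfolding p_def using w by algebra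
      thus ?thesis by (simp add: fps_lin_def algebra_simps)
    qed
    finally show ?thesis by (simp only: mult_minus_left mult_minus_right diff_minus_eq_add)
  qed
  have "?W = E * Y"
  proof (rule fps_q_equation_unique2[OF _ _ W V])
    fix n :: nat assume "n > 0"
    thus "p ^ n \<noteq> 1" using power_less_1_norm[OF p1, of n] by auto
  qed (simp add: H EA_def g_def E_def Y_def fps_qbinomial_def fps_euler_def numeral_2_eq_2)
  thus ?thesis unfolding E_def Y_def p_def .
qed

section \<open>Analytic evaluation of the weighted series\<close>

lemma summable_Bseq_mult:
  fixes f g :: "nat \<Rightarrow> complex"
  assumes "Bseq f" "summable (\<lambda>n. norm (g n))"
  shows "summable (\<lambda>n. norm (f n * g n))"
proof -
  obtain K where K: "\<And>n. norm (f n) \<le> K"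
    using assms(1) by (auto simp: Bseq_def)
  show ?thesis
    by (rule summable_comparison_test'[OF summable_mult[OF assms(2), of K], of 0])
       (auto simp: norm_mult intro!: mult_right_mono K)
qed

lemma power_choose_2_add:
  "(p::complex) ^ (Suc (i + m) choose 2) = p ^ (Suc i choose 2) * p ^ (Suc m choose 2) * p ^ (i * m)"
proof (induction m)
  case (Suc m)
  have "p ^ (Suc (i + Suc m) choose 2) = p ^ (Suc (i + m) choose 2) * p ^ Suc (i + m)"
    using power_choose_2_Suc[of p "Suc (i + m)"] by simp
  also have "\<dots> = p ^ (Suc i choose 2) * (p ^ (Suc m choose 2) * p ^ Suc m) * p ^ (i * Suc m)"
    unfolding Suc by (simp add: power_add mult_ac)
  also have "p ^ (Suc m choose 2) * p ^ Suc m = p ^ (Suc (Suc m) choose 2)"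
    using power_choose_2_Suc[of p "Suc m"] by simp
  finally show ?case .
qed (simp add: binomial_eq_0)

text \<open>\<open>power_choose_2_add\<close> splits the weight of index \<open>i + m\<close> into
  two weights and the kernel \<open>p ^ (i * m)\<close>. The sum over \<open>m\<close> yields
  \<open>qpoch_inf (b * p ^ i) p\<close>, which merges with \<open>qpoch b p i\<close> into a
  constant. The sum over \<open>i\<close> is then Euler's series, and the single sum of
  \<open>quadratic_sum\<close> remains.\<close>

theorem graded_sum:
  assumes s: "norm s < 1" "s \<noteq> 0" and w: "w^2 + w + 1 = (0::complex)" "norm w = 1" and sq: "s^2 = q"
  shows "(\<lambda>n. (q^2) ^ (Suc n choose 2) *
            fps_nth (fps_qbinomial 0 q * (fps_scale (- 1 / s) (fps_qbinomial 0 (- q)) * fps_cubic q)) n)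
          sums (qpoch_inf (- (q^2)) (q^2) * bracket (w * s) q / (qpoch_inf (q^4) (q^12) * qpoch_inf (q^2) (q^4)))"
proof -
  have q: "norm q < 1" "q \<noteq> 0" using s unfolding sq[symmetric] by (auto intro: power_less_1_norm simp del: norm_power)
  have mq: "norm (- q) < 1" using q by simp
  define p where "p = q^2"
  define b where "b = w^2 * q"
  define u where "u = w * s"
  have p: "norm p < 1" unfolding p_def using q(1) by (rule power_less_1_norm) simp
  have b: "norm b < 1" using q(1) w(2) by (simp add: b_def norm_mult norm_power)
  have u2: "u^2 = w^2 * q" by (simp add: u_def power_mult_distrib sq)
  have mp: "norm (- p) < 1" using p by simp
  define H where "H = fps_scale (- (w * q)) (fps_euler p) * fps_scale (- 1 / s) (fps_qbinomial 0 (- q))"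
  define y where "y = (\<lambda>n. qpoch u (- q) (2 * n) / qpoch p p n * b ^ n)"
  define W where "W = (\<lambda>m. p ^ (Suc m choose 2) * fps_nth H m)"
  have W: "W m = (\<Sum>i\<le>m. (p ^ (i choose 2) / qpoch p p i * (- b) ^ i) * y (m - i))" for m
  proof -
    have "W m = fps_nth (fps_scale (- b) (fps_euler p) * Abs_fps y) m"
      using arg_cong[OF fps_gaussian_transform[OF s w(1) sq, folded p_def b_def u_def, folded H_def], of "\<lambda>F. fps_nth F m"]
      by (simp only: fps_nth_Abs_fps W_def y_def)
    thus ?thesis
      unfolding fps_mult_nth by (simp add: fps_euler_def atLeast0AtMost mult_ac)
  qed
  have sy: "summable (\<lambda>n. norm (y n))"
  proof -
    have "Bseq (\<lambda>n. qpoch u (- q) (2 * n))"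
      using Bseq_qpoch[OF mq, of u] by (auto simp: Bseq_def)
    from Bseq_mult[OF this Bseq_inverse_qpoch'[OF p p]]
    show ?thesis unfolding y_def by (intro summable_Bseq_geometric b) (simp add: divide_inverse)
  qed
  have ple: "norm (p ^ i) \<le> 1" for i by (rule norm_power_le_1[OF p])
  have syp: "summable (\<lambda>n. norm (y n * p ^ (i * n)))" for i
    by (rule summable_comparison_test'[OF sy]) (use ple in \<open>simp add: norm_mult mult_left_le\<close>)
  define V where "V = (\<lambda>i. \<Sum>n. y n * p ^ (i * n))"
  have V: "(\<lambda>n. y n * p ^ (i * n)) sums V i" for i
    unfolding V_def by (rule summable_sums[OF summable_norm_cancel[OF syp]])
  have Wsum: "(\<lambda>m. W m * p ^ (i * m)) sums (qpoch_inf (b * p ^ i) p * V i)" for i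
  proof -
    have E: "(\<lambda>n. p ^ (n choose 2) / qpoch p p n * (- b) ^ n * p ^ (i * n)) sums qpoch_inf (b * p ^ i) p"
      using euler_qpoch_inf[OF p, of "- b * p ^ i"] unfolding power_mult_distrib by (simp add: mult_ac flip: power_mult)
    have sE: "summable (\<lambda>n. norm (p ^ (n choose 2) / qpoch p p n * (- b) ^ n * p ^ (i * n)))"
      using summable_euler[OF p, of "- b * p ^ i"] unfolding power_mult_distrib by (simp add: mult_ac flip: power_mult)
    have "(\<lambda>m. \<Sum>k\<le>m. (p ^ (k choose 2) / qpoch p p k * (- b) ^ k * p ^ (i * k)) * (y (m - k) * p ^ (i * (m - k))))
        sums (qpoch_inf (b * p ^ i) p * V i)"
      using Cauchy_product_sums[OF sE syp[of i]] E V[of i] by (simp add: sums_iff)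
    also have "(\<lambda>m. \<Sum>k\<le>m. (p ^ (k choose 2) / qpoch p p k * (- b) ^ k * p ^ (i * k)) * (y (m - k) * p ^ (i * (m - k))))
       = (\<lambda>m. W m * p ^ (i * m))"
    proof
      fix m
      have "(p ^ (k choose 2) / qpoch p p k * (- b) ^ k * p ^ (i * k)) * (y (m - k) * p ^ (i * (m - k)))
           = (p ^ (k choose 2) / qpoch p p k * (- b) ^ k) * y (m - k) * p ^ (i * m)" if "k \<le> m" for k
      proof -
        have "p ^ (i * m) = p ^ (i * k) * p ^ (i * (m - k))"
          using that by (simp flip: power_add distrib_left)
        thus ?thesis by (simp only: mult_ac)
      qed
      thus "(\<Sum>k\<le>m. (p ^ (k choose 2) / qpoch p p k * (- b) ^ k * p ^ (i * k)) * (y (m - k) * p ^ (i * (m - k)))) = W m * p ^ (i * m)"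
        unfolding W sum_distrib_right by (intro sum.cong) auto
    qed
    finally show ?thesis .
  qed
  have sW: "summable (\<lambda>m. norm (W m))"
  proof (rule summable_comparison_test')
    show "summable (\<lambda>m. \<Sum>i\<le>m. norm (p ^ (i choose 2) / qpoch p p i * (- b) ^ i) * norm (y (m - i)))"
      using summable_euler[OF p, of "- b"] sy by (intro summable_Cauchy_product) auto
    show "norm (norm (W m)) \<le> (\<Sum>i\<le>m. norm (p ^ (i choose 2) / qpoch p p i * (- b) ^ i) * norm (y (m - i)))" for m
      unfolding W norm_mult[symmetric] real_norm_def abs_norm_cancel by (rule norm_sum)
  qed
  \<comment> \<open>The weight \<open>p ^ (Suc i choose 2)\<close> of the q-binomial index together
    with its denominator; the numerator \<open>qpoch b p i\<close> is held back for the
    merging.\<close>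
  define a where "a = (\<lambda>i. p ^ (i choose 2) / qpoch p p i * p ^ i)"
  have sa: "summable (\<lambda>i. norm (a i))" unfolding a_def by (rule summable_euler[OF p])
  have G: "(\<lambda>i. a i * p ^ (i * n)) sums qpoch_inf (- (p * p ^ n)) p" for n
    using euler_qpoch_inf[OF p, of "p * p ^ n"] by (simp add: a_def power_mult_distrib mult_ac flip: power_mult)
  have aV: "(\<lambda>i. a i * V i) sums (\<Sum>n. y n * qpoch_inf (- (p * p ^ n)) p)"
    by (rule sums_swap_kernel(1)[OF sa sy ple V G])
  \<comment> \<open>Euler's value supplies (-p; p)_n in the denominator, and (p; p)_n (-p; p)_n =
    (q^4; q^4)_n.\<close>
  have yG: "y n * qpoch_inf (- (p * p ^ n)) p =
      qpoch_inf (- p) p * (qpoch u (- q) (2 * n) / qpoch (q^4) (q^4) n * u ^ (2 * n))" for n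
  proof -
    have "qpoch (q^4) (q^4) n = qpoch p p n * qpoch (- p) p n"
      unfolding qpoch_minus_mult by (simp add: p_def flip: power_mult)
    moreover have "qpoch_inf (- p) p = qpoch (- p) p n * qpoch_inf (- (p * p ^ n)) p"
      using qpoch_inf_split[OF p, of "- p" n] by simp
    moreover have "b ^ n = u ^ (2 * n)" by (simp add: b_def power_mult u2)
    ultimately show ?thesis
      using qpoch_nonzero'[OF p mp, of n] by (simp add: y_def)
  qed
  define S where "S = bracket u q / (qpoch_inf (q^4) (q^12) * qpoch_inf (q^2) (q^4) * qpoch_inf b p)"
  have "(\<lambda>n. qpoch u (- q) (2 * n) / qpoch (q^4) (q^4) n * u ^ (2 * n)) sums S"
    using quadratic_sum[OF q w u2] unfolding S_def bracket_def b_def p_def .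
  from sums_mult[OF this, of "qpoch_inf (- p) p"]
  have "(\<Sum>n. y n * qpoch_inf (- (p * p ^ n)) p) = qpoch_inf (- p) p * S"
    unfolding yG by (simp add: sums_iff)
  with sums_mult[OF aV, of "qpoch_inf b p"]
  have *: "(\<lambda>i. qpoch_inf b p * (a i * V i)) sums (qpoch_inf b p * (qpoch_inf (- p) p * S))" by simp
  define f where "f = (\<lambda>i m. qpoch b p i * a i * W m * p ^ (i * m))"
  have "(\<lambda>m. f i m) sums (qpoch b p i * a i * (qpoch_inf (b * p ^ i) p * V i))" for i
    unfolding f_def using sums_mult[OF Wsum[of i], of "qpoch b p i * a i"] by (simp add: mult_ac)
  hence F: "(\<lambda>m. f i m) sums (qpoch_inf b p * (a i * V i))" for i
    using qpoch_inf_split[OF p, of b i] by (simp add: mult_ac)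
  have "(\<lambda>(i, m). f i m) summable_on UNIV \<times> UNIV"
  proof -
    have "(\<lambda>(i, m). (qpoch b p i * a i) * W m) summable_on UNIV \<times> UNIV"
      by (intro summable_on_product)
         (use summable_Bseq_mult[OF Bseq_qpoch[OF p, of b] sa] sW in \<open>simp_all add: norm_summable_iff_summable_on\<close>)
    hence "(\<lambda>x. (case x of (i, m) \<Rightarrow> (qpoch b p i * a i) * W m) * (case x of (i, m) \<Rightarrow> p ^ (i * m))) summable_on UNIV \<times> UNIV"
      by (rule summable_on_mult_bounded) (use ple in auto)
    thus ?thesis by (simp add: f_def case_prod_unfold)
  qed
  from sums_antidiagonal[OF this F *]
  have "(\<lambda>n. \<Sum>i\<le>n. f i (n - i)) sums (qpoch_inf b p * (qpoch_inf (- p) p * S))" .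
  also have "(\<lambda>n. \<Sum>i\<le>n. f i (n - i)) = (\<lambda>n. p ^ (Suc n choose 2) * fps_nth (fps_qbinomial b p * H) n)"
  proof
    fix n
    have "f i (n - i) = p ^ (Suc n choose 2) * (qpoch b p i / qpoch p p i * fps_nth H (n - i))" if "i \<le> n" for i
      using power_choose_2_add[of p i "n - i"] power_choose_2_Suc[of p i] that
      by (simp add: f_def W_def a_def)
    thus "(\<Sum>i\<le>n. f i (n - i)) = p ^ (Suc n choose 2) * fps_nth (fps_qbinomial b p * H) n"
      unfolding fps_mult_nth sum_distrib_left atLeast0AtMost
      by (intro sum.cong) (auto simp: fps_qbinomial_def)
  qed
  also have "fps_qbinomial b p * H = fps_qbinomial 0 q * (fps_scale (- 1 / s) (fps_qbinomial 0 (- q)) * fps_cubic q)"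
    unfolding fps_triple_factor[OF s w(1) sq] H_def b_def p_def ..
  finally show ?thesis
    using qpoch_inf_nonzero'[OF p b] by (simp add: S_def u_def p_def mult_ac)
qed

text \<open>\<open>w ^ 2\<close> is again a primitive cube root of unity, and the series in
  \<open>graded_sum\<close> is free of \<open>w\<close>. This supplies the hypothesis
  \<open>symm\<close> of \<open>bracket_closed_form\<close>.\<close>

lemma bracket_symmetric:
  assumes s: "norm s < 1" "s \<noteq> 0" and w: "w^2 + w + 1 = (0::complex)" "norm w = 1"
  shows "bracket (w * s) (s^2) = bracket (w^2 * s) (s^2)"
proof -
  have w': "(w^2)^2 + w^2 + 1 = 0" "norm (w^2) = 1"
    subgoal using w(1) by algebra
    subgoal using w(2) by (simp add: norm_power)
    done
  define q where "q = s^2"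
  have q: "norm q < 1" unfolding q_def using s(1) by (rule power_less_1_norm) simp
  have q2: "norm (q^2) < 1" "norm (- (q^2)) < 1" "norm (q^4) < 1" "norm (q^12) < 1"
    using power_less_1_norm[OF q] by (simp_all del: norm_power)
  have nz: "qpoch_inf (- (q^2)) (q^2) \<noteq> 0" "qpoch_inf (q^4) (q^12) \<noteq> 0" "qpoch_inf (q^2) (q^4) \<noteq> 0"
    by (rule qpoch_inf_nonzero'; rule q2)+
  show ?thesis
    using sums_unique2[OF graded_sum[OF s w refl] graded_sum[OF s w' refl]] nz by (simp add: q_def)
qed

lemma primitive_cube_root:
  obtains w :: complex where "w^2 + w + 1 = 0" "norm w = 1"
proof
  show "(Complex (-1/2) (sqrt 3 / 2))^2 + Complex (-1/2) (sqrt 3 / 2) + 1 = 0"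
    by (simp add: complex_eq_iff power2_eq_square)
  show "norm (Complex (-1/2) (sqrt 3 / 2)) = 1"
    by (simp add: cmod_def power_divide)
qed

theorem theorem5p3:
  fixes q s :: complex
  assumes "0 < norm q" and "norm q < 1" and "s ^ 2 = q"
  shows "((\<lambda>(i, j, k).
            (- 1) ^ (j + k)
              * q ^ (2 * ((i + j + 3 * k) choose 2) + 6 * (k choose 2) + 2 * i + 9 * k)
              * (s ^ 3) ^ j
            / (qpoch q q i * qpoch (- q) (- q) j * qpoch (q ^ 6) (q ^ 6) k))
          has_sum
            1 / (qpoch_inf (- (s ^ 3)) (- (q ^ 3)) * qpoch_inf (s ^ 5) (- (q ^ 3))
                 * qpoch_inf (q ^ 4) (q ^ 6) * qpoch_inf (q ^ 2) (q ^ 12)))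
         (UNIV :: (nat \<times> nat \<times> nat) set)"
    (is "(?t has_sum ?R) UNIV")
proof -
  note q = assms(2) and sq = assms(3)
  have s: "norm s < 1" "s \<noteq> 0"
  proof -
    have "norm s ^ 2 < 1" using q unfolding sq[symmetric] by (simp add: norm_power)
    thus "norm s < 1" by (simp add: power_less_one_iff)
    show "s \<noteq> 0" using assms(1) sq by auto
  qed
  obtain w :: complex where w: "w^2 + w + 1 = 0" "norm w = 1" by (rule primitive_cube_root)
  have pw: "norm (q ^ n) < 1" if "n > 0" for n using q that by (rule power_less_1_norm)
  have mq: "norm (- q) < 1" using q by simp
  define e where "e = fps_qbinomial 0 q"
  define g where "g = fps_scale (- 1 / s) (fps_qbinomial 0 (- q))"
  \<comment> \<open>The index \<open>m\<close> runs over all naturals, with zero terms unless 3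
    divides it, so that coefficients of an ordinary product of three series appear.\<close>
  define t where "t = (\<lambda>(i, j, m). (q^2) ^ (Suc (i + j + m) choose 2) * (fps_nth e i * (fps_nth g j * fps_nth (fps_cubic q) m)))"
  have t_eq: "?t x = t (case x of (i, j, k) \<Rightarrow> (i, j, 3 * k))" for x
  proof -
    obtain i j k where x: "x = (i, j, k)" by (cases x) auto
    \<comment> \<open>As \<open>q ^ 2 = s ^ 4\<close>, the weight \<open>q ^ 2\<close> per unit of
      the index turns \<open>- 1 / s\<close> into the \<open>- (s ^ 3)\<close> of the
      statement.\<close>
    have s3: "q^2 * (- 1 / s) = - (s^3)" using s(2) unfolding sq[symmetric] by (simp add: eval_nat_numeral)
    have qq: "q ^ (2 * ((i + j + 3 * k) choose 2) + 6 * (k choose 2) + 2 * i + 9 * k) =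
        q ^ (2 * ((i + j + 3 * k) choose 2)) * (q^2) ^ i * q ^ (6 * (k choose 2) + 9 * k)"
      by (simp add: add_ac flip: power_mult power_add)
    have "(q^2) ^ (Suc (i + j + 3 * k) choose 2) * (- 1 / s) ^ j * q ^ (6 * (k choose 2) + 3 * k)
       = q ^ (2 * ((i + j + 3 * k) choose 2)) * (q^2) ^ i * ((q^2) ^ j * (- 1 / s) ^ j) * ((q^2) ^ (3 * k) * q ^ (6 * (k choose 2) + 3 * k))"
      unfolding power_choose_2_Suc by (simp add: power_add power_mult)
    also have "(q^2) ^ j * (- 1 / s) ^ j = (- 1) ^ j * (s^3) ^ j"
      unfolding power_mult_distrib[symmetric] s3 by simp
    also have "(q^2) ^ (3 * k) * q ^ (6 * (k choose 2) + 3 * k) = q ^ (6 * (k choose 2) + 9 * k)"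
      by (simp add: add.commute flip: power_mult power_add)
    finally have A: "(q^2) ^ (Suc (i + j + 3 * k) choose 2) * (- 1 / s) ^ j * q ^ (6 * (k choose 2) + 3 * k)
       = (- 1) ^ j * q ^ (2 * ((i + j + 3 * k) choose 2) + 6 * (k choose 2) + 2 * i + 9 * k) * (s^3) ^ j"
      unfolding qq by (simp only: mult_ac)
    have B: "t (i, j, 3 * k) = (q^2) ^ (Suc (i + j + 3 * k) choose 2) * (- 1 / s) ^ j * q ^ (6 * (k choose 2) + 3 * k) *
        (- 1) ^ k / (qpoch q q i * qpoch (- q) (- q) j * qpoch (q ^ 6) (q ^ 6) k)"
      by (simp add: t_def e_def g_def fps_qbinomial_def fps_cubic_def mult_ac)
    have "?t x = (- 1) ^ j * q ^ (2 * ((i + j + 3 * k) choose 2) + 6 * (k choose 2) + 2 * i + 9 * k) * (s^3) ^ j *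
        (- 1) ^ k / (qpoch q q i * qpoch (- q) (- q) j * qpoch (q ^ 6) (q ^ 6) k)"
      unfolding x prod.case power_add[of "- 1 :: complex" j k] by (simp only: mult_ac)
    thus ?thesis unfolding A[symmetric] B[symmetric] x prod.case .
  qed
  have "?t summable_on UNIV"
  proof -
    \<comment> \<open>For convergence the powers with quadratic exponent are only bounded by 1; the
      three remaining series have ratios governed by \<open>q ^ 2\<close>, \<open>- (s ^ 3)\<close>
      and \<open>- (q ^ 9)\<close>.\<close>
    have A: "(\<lambda>i. (q^2) ^ i / qpoch q q i) summable_on UNIV"
      using summable_qbinomial[OF q pw[of 2], of 0] by (simp flip: norm_summable_iff_summable_on)
    have B: "(\<lambda>j. (- (s^3)) ^ j / qpoch (- q) (- q) j) summable_on UNIV"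
      using summable_qbinomial[OF mq, of "- (s^3)" 0] power_less_1_norm[OF s(1), of 3]
      by (simp flip: norm_summable_iff_summable_on)
    have C: "(\<lambda>k. (- (q^9)) ^ k / qpoch (q^6) (q^6) k) summable_on UNIV"
      using summable_qbinomial[OF pw[of 6], of "- (q^9)" 0] pw[of 9] by (simp flip: norm_summable_iff_summable_on)
    have "(\<lambda>x. (case x of (i, y) \<Rightarrow> (q^2) ^ i / qpoch q q i *
          (case y of (j, k) \<Rightarrow> (- (s^3)) ^ j / qpoch (- q) (- q) j * ((- (q^9)) ^ k / qpoch (q^6) (q^6) k))) *
          (case x of (i, j, k) \<Rightarrow> q ^ (2 * ((i + j + 3 * k) choose 2) + 6 * (k choose 2)))) summable_on UNIV"
    proof (rule summable_on_mult_bounded)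
      show "(\<lambda>(i, y). (q^2) ^ i / qpoch q q i *
          (case y of (j, k) \<Rightarrow> (- (s^3)) ^ j / qpoch (- q) (- q) j * ((- (q^9)) ^ k / qpoch (q^6) (q^6) k))) summable_on UNIV"
        using summable_on_product[OF A summable_on_product[OF B C, unfolded UNIV_Times_UNIV]] by simp
      show "norm (case x of (i, j, k) \<Rightarrow> q ^ (2 * ((i + j + 3 * k) choose 2) + 6 * (k choose 2))) \<le> 1" for x
        using norm_power_le_1[OF q] by (simp add: case_prod_unfold)
    qed
    also have "(\<lambda>x. (case x of (i, y) \<Rightarrow> (q^2) ^ i / qpoch q q i *
          (case y of (j, k) \<Rightarrow> (- (s^3)) ^ j / qpoch (- q) (- q) j * ((- (q^9)) ^ k / qpoch (q^6) (q^6) k))) *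
          (case x of (i, j, k) \<Rightarrow> q ^ (2 * ((i + j + 3 * k) choose 2) + 6 * (k choose 2)))) = ?t"
      by (simp add: fun_eq_iff power_add power_mult power_minus[of "s^3"] power_minus[of "q^9"] mult_ac) (simp add: mult_ac flip: power_mult)
    finally show ?thesis .
  qed
  then obtain T where T: "(?t has_sum T) UNIV" by (auto simp: summable_on_def)
  have "((t \<circ> (\<lambda>(i, j, k). (i, j, 3 * k))) has_sum T) UNIV"
    using T unfolding o_def t_eq .
  hence "(t has_sum T) (range (\<lambda>(i, j, k). (i, j, 3 * k)))"
    by (rule has_sum_reindex[THEN iffD2, rotated]) (auto simp: inj_on_def)
  hence "(t has_sum T) UNIV"
  proof (rule has_sum_cong_neutral[THEN iffD1, rotated -1])
    fix x assume "x \<in> UNIV - range (\<lambda>(i :: nat, j :: nat, k :: nat). (i, j, 3 * k))"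
    moreover obtain i j m where x: "x = (i, j, m)" by (cases x) auto
    ultimately have "m \<noteq> 3 * k" for k by (auto simp: image_iff)
    hence "\<not> 3 dvd m" by (auto simp: dvd_def)
    thus "t x = 0" by (simp add: t_def x fps_cubic_def)
  qed auto
  \<comment> \<open>Grouping by \<open>n = i + j + m\<close>; on this index set the truncated
    subtraction is exact.\<close>
  hence "((\<lambda>(n, i, j). t (i, j, n - i - j)) has_sum T) (SIGMA n:UNIV. SIGMA i:{..n}. {..n - i})"
    by (subst has_sum_reindex_bij_witness[where T = UNIV and h = t
          and j = "\<lambda>(n, i, j). (i, j, n - i - j)" and i = "\<lambda>(i, j, m). (i + j + m, i, j)"]) auto
  hence "((\<lambda>n. \<Sum>(i, j)\<in>(SIGMA i:{..n}. {..n - i}). t (i, j, n - i - j)) has_sum T) UNIV"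
    by (rule has_sum_SigmaD) (auto simp: case_prod_unfold intro!: has_sum_finite)
  also have "(\<lambda>n. \<Sum>(i, j)\<in>(SIGMA i:{..n}. {..n - i}). t (i, j, n - i - j)) =
      (\<lambda>n. (q^2) ^ (Suc n choose 2) * fps_nth (e * (g * fps_cubic q)) n)"
  proof
    fix n
    have "(\<Sum>(i, j)\<in>(SIGMA i:{..n}. {..n - i}). t (i, j, n - i - j)) = (\<Sum>i\<le>n. \<Sum>j\<le>n - i. t (i, j, n - i - j))"
      by (subst sum.Sigma) auto
    also have "\<dots> = (q^2) ^ (Suc n choose 2) * fps_nth (e * (g * fps_cubic q)) n"
      unfolding fps_mult_nth sum_distrib_left atLeast0AtMost
      by (intro sum.cong) (auto simp: t_def)
    finally show "(\<Sum>(i, j)\<in>(SIGMA i:{..n}. {..n - i}). t (i, j, n - i - j)) = (q^2) ^ (Suc n choose 2) * fps_nth (e * (g * fps_cubic q)) n" .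
  qed
  finally have "(\<lambda>n. (q^2) ^ (Suc n choose 2) * fps_nth (e * (g * fps_cubic q)) n) sums T"
    by (rule has_sum_imp_sums)
  from sums_unique2[OF this graded_sum[OF s w sq, folded e_def g_def]]
  have T1: "T = qpoch_inf (- (q^2)) (q^2) * bracket (w * s) q / (qpoch_inf (q^4) (q^12) * qpoch_inf (q^2) (q^4))" .
  have br: "bracket (w * s) q = qpoch_inf (q^2) (q^4) * qpoch_inf (q^6) (q^12) /
      (qpoch_inf (- (s^3)) (- (q^3)) * qpoch_inf (s^5) (- (q^3)))"
    using bracket_closed_form[OF w _ s(1)] bracket_symmetric[OF _ _ w] unfolding sq by blast
  \<comment> \<open>Euler's identity removes (-q^2; q^2)_inf. Modulo 12, only the classes 2, 4 and
    10 then remain in the denominator, besides the two products in \<open>s\<close>.\<close>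
  have "T = ?R"
  proof -
    note E = qpoch_inf_base12[OF q]
    have "qpoch_inf (- (q^2)) (q^2) * qpoch_inf (q^2) (q^4) = 1"
      using euler_odd_distinct[OF pw[of 2]] by (simp flip: power_mult)
    hence m: "qpoch_inf (- (q^2)) (q^2) = 1 / (qpoch_inf (q^2) (q^12) * qpoch_inf (q^6) (q^12) * qpoch_inf (q^10) (q^12))"
      using E(13)[of 2] E(13)[of 6] E(13)[of 10] unfolding E(4) by (simp add: field_simps)
    show ?thesis
      unfolding T1 br m E(4) E(8) using E(13)[of 2] E(13)[of 4] E(13)[of 6] E(13)[of 10]
      by (simp add: field_simps)
  qed
  with T show ?thesis by simp
qed

end
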